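(* Assume the $ABC$ conjecture. Then there is a positive integer $C_1$ such that $M(d)\le C_1$ for every positive integer $d$. Moreover, $M(d)\le 9$ for every sufficiently large positive integer $d$.
   Context: A pair $(a,b)\in\mathbb{Z}^2$ is multiplicatively dependent if $ab\neq 0$ and there is $(k_1,k_2)\in\mathbb{Z}^2\setminus\{(0,0)\}$ with $a^{k_1}b^{k_2}=1$. For $d\in\mathbb{Z}$, $\mathcal{M}(d)$ is the set of multiplicatively dependent pairs $(a,b)\in\mathbb{Z}^2$ with $ab\ne0$ and $b-a=d$, and $M(d)=|\mathcal{M}(d)|$. The $ABC$ conjecture: for every real $\varepsilon>0$ there is a constant $K_\varepsilon$ such that for all non-zero integers $A,B,C$ with $A+B=C$ and $\gcd(A,B)=1$ one has $\max\{|A|,|B|,|C|\}\le K_\varepsilon\big(\prod_{p\mid ABC}p\big)^{1+\varepsilon}$, the product over the distinct primes dividing $ABC$. *)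

theory Defs
  imports Complex_Main "HOL-Computational_Algebra.Primes"
begin

text \<open>
  The exponents may be negative, so the relation \<open>a\<^sup>k\<^sup>1 b\<^sup>k\<^sup>2 = 1\<close> is read in the rationals.
\<close>

definition mult_dependent :: "int \<Rightarrow> int \<Rightarrow> bool" where
  "mult_dependent a b \<longleftrightarrow> a * b \<noteq> 0 \<and>
     (\<exists>k1 k2 :: int. (k1, k2) \<noteq> (0, 0) \<and> rat_of_int a powi k1 * rat_of_int b powi k2 = 1)"

definition mult_dep_pairs :: "int \<Rightarrow> (int \<times> int) set" where
  "mult_dep_pairs d = {(a, b). mult_dependent a b \<and> a * b \<noteq> 0 \<and> b - a = d}"

text \<open>
  Only meaningful when the set is finite (\<open>card\<close> of an infinite set is \<open>0\<close>), so an
  upper bound on this number has to be accompanied by a finiteness claim.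
\<close>

definition mult_dep_count :: "int \<Rightarrow> nat" where
  "mult_dep_count d = card (mult_dep_pairs d)"

definition abc_conjecture :: bool where
  "abc_conjecture \<longleftrightarrow>
     (\<forall>\<epsilon> :: real. \<epsilon> > 0 \<longrightarrow>
       (\<exists>K :: real. \<forall>A B C :: int.
          A \<noteq> 0 \<longrightarrow> B \<noteq> 0 \<longrightarrow> C \<noteq> 0 \<longrightarrow> A + B = C \<longrightarrow> gcd A B = 1 \<longrightarrow>
          real_of_int (Max {\<bar>A\<bar>, \<bar>B\<bar>, \<bar>C\<bar>})
            \<le> K * real_of_int (\<Prod>p\<in>prime_factors (A * B * C). p) powr (1 + \<epsilon>)))"

end

theory Submission
  imports Defs
begin

text \<open>
  Apart from at most five pairs with \<open>\<bar>a\<bar> = 1\<close>, \<open>\<bar>b\<bar> = 1\<close> or \<open>a = - b\<close>, the members of a pair are,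
  up to sign, powers of a common base \<open>g\<close> that is not a perfect power, and then
  \<open>d = g\<^sup>m (g\<^sup>n + s)\<close> with \<open>s = 1\<close> or \<open>s = - 1\<close>; each such representation accounts for two pairs. So it
  suffices that a large \<open>d\<close> has at most two representations.

  If some representation has \<open>m = n\<close>, then \<open>d = G (G + 1)\<close>. There are at most two representations with
  \<open>m = n\<close>, and a further one \<open>d = h\<^sup>k (h\<^sup>l + t)\<close> with \<open>k \<noteq> l\<close> is impossible for large \<open>d\<close>: splitting \<open>h\<close>
  between \<open>G\<close> and \<open>G + 1\<close> leads to binary quadratic forms representing \<open>1\<close> at high powers, and
  the \<open>abc\<close> conjecture bounds \<open>k\<close> and \<open>l\<close>; for fixed exponents one applies the \<open>abc\<close> conjecture after a
  Belyi map ramified over \<open>\<infinity>\<close>, \<open>0\<close> and the critical values of the two representations.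

  If no representation has \<open>m = n\<close>, take two of them, \<open>g\<^sup>m (g\<^sup>n + s) = h\<^sup>k (h\<^sup>l + t)\<close> with \<open>g\<^sup>m > h\<^sup>k\<close>, and split off
  the part of \<open>g\<close> and \<open>h\<close> supported on common primes. Applying the \<open>abc\<close> conjecture to \<open>(h\<^sup>l + t) - h\<^sup>l = t\<close> and to
  \<open>g\<^sup>m\<^sup>+\<^sup>n - h\<^sup>k\<^sup>+\<^sup>l = t h\<^sup>k - s g\<^sup>m\<close> gives linear inequalities between the logarithms of the pieces which leave
  only a few exponent patterns, and no three representations fit these patterns pairwise.
\<close>

section \<open>The radical and the abc conjecture\<close>

definition rad :: "int \<Rightarrow> int" where
  "rad x = \<Prod>(prime_factors x)"

lemma rad_ge_1: "1 \<le> rad x"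
  unfolding rad_def by (rule prod_ge_1) (auto dest!: in_prime_factors_imp_prime prime_ge_2_int)

lemma rad_zero [simp]: "rad 0 = 1"
  by (simp add: rad_def)

lemma rad_mono:
  assumes "prime_factors x \<subseteq> prime_factors y"
  shows "rad x \<le> rad y"
  unfolding rad_def
  by (rule prod_mono2) (use assms in \<open>auto dest!: in_prime_factors_imp_prime prime_ge_2_int\<close>)

lemma rad_dvd_mono: "x dvd y \<Longrightarrow> y \<noteq> 0 \<Longrightarrow> rad x \<le> rad y"
  by (intro rad_mono dvd_prime_factors)

lemma rad_minus [simp]: "rad (- x) = rad x"
  by (cases "x = 0") (auto intro!: antisym rad_dvd_mono)

text \<open>For non-zero arguments the two sides differ exactly by the product of the common
  primes.\<close>

lemma rad_mult_le: "rad (x * y) \<le> rad x * rad y"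
proof (cases "x * y = 0")
  case True
  then show ?thesis
    using mult_mono[of 1 "rad x" 1 "rad y"] rad_ge_1[of x] rad_ge_1[of y] by (metis rad_zero mult_1 order_trans zero_le_one)
next
  case False
  have "rad (x * y) = \<Prod>(prime_factors x \<union> prime_factors y)"
    using False by (simp add: rad_def prime_factors_product)
  also have "\<dots> * \<Prod>(prime_factors x \<inter> prime_factors y) = rad x * rad y"
    unfolding rad_def by (subst prod.union_inter) auto
  finally have "rad (x * y) * \<Prod>(prime_factors x \<inter> prime_factors y) = rad x * rad y" .
  moreover have "1 \<le> \<Prod>(prime_factors x \<inter> prime_factors y)"
    by (rule prod_ge_1) (auto dest!: in_prime_factors_imp_prime prime_ge_2_int)
  ultimately show ?thesis
    by (metis mult.right_neutral mult_left_mono order_trans rad_ge_1 zero_le_one)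
qed

lemma rad_le_abs:
  assumes "x \<noteq> 0"
  shows "rad x \<le> \<bar>x\<bar>"
proof -
  have "rad x \<le> (\<Prod>p\<in>prime_factors x. p ^ multiplicity p x)"
    unfolding rad_def
  proof (rule prod_mono, safe)
    fix p assume p: "p \<in># prime_factorization x"
    then have "p \<ge> 2" by (auto dest!: in_prime_factors_imp_prime prime_ge_2_int)
    moreover have "multiplicity p x > 0"
      using p by (simp add: prime_factors_multiplicity)
    ultimately show "0 \<le> p" "p \<le> p ^ multiplicity p x"
      by (auto intro: self_le_power)
  qed
  also have "\<dots> = \<bar>x\<bar>"
    using prod_prime_factors[OF assms] by simp
  finally show ?thesis .
qed

lemma rad_power_le: "rad (x ^ n) \<le> rad x"
proof (cases "n = 0")
  case True
  then show ?thesis using rad_ge_1[of x] by (simp add: rad_def)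
next
  case False
  then show ?thesis
    by (cases "x = 0")
       (auto intro!: rad_mono simp: prime_factors_dvd power_0_left dest: prime_dvd_power)
qed

text \<open>Write \<open>F\<close> as \<open>v * v * c\<close> and bound the radical by
  \<open>\<bar>v\<bar> * \<bar>c\<bar>\<close>. This is how a double point of a polynomial map turns
  into a saving in the radical later.\<close>

lemma rad_le_of_square_dvd:
  fixes v F :: int
  assumes "v\<^sup>2 dvd F" "F \<noteq> 0"
  shows "\<bar>v\<bar> * rad F \<le> \<bar>F\<bar>"
proof -
  obtain c where c: "F = v\<^sup>2 * c" using assms by blast
  have "v \<noteq> 0" "c \<noteq> 0" using c assms by auto
  have "rad F \<le> rad v * rad c"
    using rad_mult_le[of "v\<^sup>2" c] mult_right_mono[OF rad_power_le[of v 2], of "rad c"] rad_ge_1[of c] c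
    by (simp add: order_trans)
  also have "\<dots> \<le> \<bar>v\<bar> * \<bar>c\<bar>"
    using rad_le_abs[OF \<open>v \<noteq> 0\<close>] rad_le_abs[OF \<open>c \<noteq> 0\<close>] rad_ge_1[of c] by (intro mult_mono) auto
  finally have "\<bar>v\<bar> * rad F \<le> \<bar>v\<bar> * (\<bar>v\<bar> * \<bar>c\<bar>)" by (intro mult_left_mono) auto
  also have "\<dots> = \<bar>F\<bar>" using c by (simp add: abs_mult power2_eq_square)
  finally show ?thesis .
qed

section \<open>Logarithmic form of radicals and of the abc inequality\<close>

lemma ln_rad_mult_le: "ln (real_of_int (rad (x * y))) \<le> ln (rad x) + ln (rad y)"
proof -
  have "real_of_int (rad (x * y)) \<le> rad x * rad y"
    using rad_mult_le[of x y] by (metis of_int_le_iff of_int_mult)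
  then show ?thesis
    using rad_ge_1[of x] rad_ge_1[of y] rad_ge_1[of "x * y"]
    by (subst ln_mult_pos[symmetric]) auto
qed

lemma ln_rad_le: "x \<noteq> 0 \<Longrightarrow> ln (real_of_int (rad x)) \<le> ln \<bar>real_of_int x\<bar>"
  using rad_le_abs[of x] rad_ge_1[of x] by simp

lemma ln_rad_power_le: "ln (real_of_int (rad (x ^ n))) \<le> ln (rad x)"
  using rad_power_le[of x n] rad_ge_1[of "x ^ n"] by simp

text \<open>Bounding \<open>rad C\<close> by \<open>\<bar>C\<bar>\<close> makes the coprimality hypothesis superfluous: a common factor
  enters both sides with exponents \<open>1\<close> and \<open>1 + \<epsilon>\<close>.\<close>

lemma abc_log:
  assumes abc: abc_conjecture and \<epsilon>: "\<epsilon> > 0"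
  obtains K :: real where "K \<ge> 0"
    "\<And>A B C :: int. A + B = C \<Longrightarrow> A \<noteq> 0 \<Longrightarrow> C \<noteq> 0 \<Longrightarrow>
       ln \<bar>real_of_int A\<bar> \<le> (1 + \<epsilon>) * (ln (rad (A * B)) + ln \<bar>real_of_int C\<bar>) + K"
proof -
  obtain K where K: "\<And>A B C :: int. A \<noteq> 0 \<Longrightarrow> B \<noteq> 0 \<Longrightarrow> C \<noteq> 0 \<Longrightarrow> A + B = C \<Longrightarrow> gcd A B = 1 \<Longrightarrow>
          real_of_int (Max {\<bar>A\<bar>, \<bar>B\<bar>, \<bar>C\<bar>}) \<le> K * real_of_int (rad (A * B * C)) powr (1 + \<epsilon>)"
    using abc \<epsilon> unfolding abc_conjecture_def rad_def by meson
  \<comment> \<open>Nothing is known about the sign of \<open>K\<close>; the maximum with 1 makes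
    the logarithm meaningful and non-negative.\<close>
  define K' where "K' = ln (max K 1)"
  have "K' \<ge> 0" by (simp add: K'_def)
  have "ln \<bar>real_of_int A\<bar> \<le> (1 + \<epsilon>) * (ln (rad (A * B)) + ln \<bar>real_of_int C\<bar>) + K'"
    if sum: "A + B = C" and nz: "A \<noteq> 0" "C \<noteq> 0" for A B C :: int
  proof (cases "B = 0")
    case True
    \<comment> \<open>For \<open>B = 0\<close> one has \<open>A = C\<close> and
      \<open>rad 0 = 1\<close>, so this product and \<open>K'\<close> are the whole slack.\<close>
    have "0 \<le> \<epsilon> * ln \<bar>real_of_int A\<bar>" using nz \<epsilon> by simp
    then show ?thesis using True sum \<open>K' \<ge> 0\<close> by (simp add: algebra_simps)
  next
    case False
    define e where "e = gcd A B"
    obtain A' B' where AB: "A = e * A'" "B = e * B'" and cop: "coprime A' B'"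
      using gcd_coprime_exists[of A B] nz unfolding e_def by (metis gcd_eq_0_iff mult.commute)
    define C' where "C' = A' + B'"
    have C: "C = e * C'" using sum AB by (simp add: C'_def algebra_simps)
    have "e \<ge> 1" unfolding e_def using nz by (metis False gcd_pos_int int_one_le_iff_zero_less)
    have nz': "A' \<noteq> 0" "B' \<noteq> 0" "C' \<noteq> 0" using AB C nz False by auto
    have "real_of_int \<bar>A'\<bar> \<le> real_of_int (Max {\<bar>A'\<bar>, \<bar>B'\<bar>, \<bar>C'\<bar>})"
      by (subst of_int_le_iff) auto
    also have "\<dots> \<le> K * real_of_int (rad (A' * B' * C')) powr (1 + \<epsilon>)"
      by (rule K) (use nz' cop C'_def in auto)
    also have "\<dots> \<le> max K 1 * real_of_int (rad (A' * B' * C')) powr (1 + \<epsilon>)"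
      by (intro mult_right_mono) auto
    finally have "ln (real_of_int \<bar>A'\<bar>) \<le> ln (max K 1 * real_of_int (rad (A' * B' * C')) powr (1 + \<epsilon>))"
      using nz' by (simp del: of_int_abs)
    also have "\<dots> = K' + (1 + \<epsilon>) * ln (rad (A' * B' * C'))"
      using rad_ge_1[of "A' * B' * C'"] by (subst ln_mult_pos) (auto simp: K'_def ln_powr)
    also have "ln (rad (A' * B' * C')) \<le> ln (rad (A * B)) + ln \<bar>real_of_int C'\<bar>"
    proof -
      have "ln (rad (A' * B')) \<le> ln (rad (A * B))"
        using rad_dvd_mono[of "A' * B'" "A * B"] AB nz False rad_ge_1[of "A' * B'"] by simp
      then show ?thesis using ln_rad_mult_le[of "A' * B'" C'] ln_rad_le[of C'] nz' by linarith
    qed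
    finally have *: "ln \<bar>real_of_int A'\<bar> \<le> K' + (1 + \<epsilon>) * (ln (rad (A * B)) + ln \<bar>real_of_int C'\<bar>)"
      using \<epsilon> by simp
    have "ln \<bar>real_of_int A\<bar> = ln e + ln \<bar>real_of_int A'\<bar>" "ln \<bar>real_of_int C\<bar> = ln e + ln \<bar>real_of_int C'\<bar>"
      using AB C \<open>e \<ge> 1\<close> nz' by (auto simp: abs_mult ln_mult_pos)
    moreover have "0 \<le> \<epsilon> * ln (real_of_int e)" using \<epsilon> \<open>e \<ge> 1\<close> by simp
    ultimately show ?thesis using * by (simp add: algebra_simps)
  qed
  then show ?thesis using that \<open>K' \<ge> 0\<close> by blast
qed

section \<open>Two representations\<close>

text \<open>\<open>g1\<close> and \<open>h1\<close> collect the primes common to \<open>g\<close>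
  and \<open>h\<close>. Such a prime divides neither cofactor, so it has the same multiplicity in
  \<open>g ^ m\<close> and \<open>h ^ k\<close>. Cancelling leaves coprime \<open>g2\<close>,
  \<open>h2\<close>, and each of \<open>g2 ^ m\<close>, \<open>h2 ^ k\<close> must divide the
  cofactor on the other side. \<open>r\<close> is the product of the common primes.\<close>

lemma pair_decomposition:
  fixes g h D E :: int and m k :: nat
  assumes pos: "g \<ge> 1" "h \<ge> 1" "D \<ge> 1" "E \<ge> 1" "m \<ge> 1" "k \<ge> 1"
    and eq: "g ^ m * D = h ^ k * E" and cop: "coprime g D" "coprime h E"
  obtains g1 g2 h1 h2 w r :: int where
    "g1 \<ge> 1" "g2 \<ge> 1" "h1 \<ge> 1" "h2 \<ge> 1" "w \<ge> 1" "r \<ge> 1"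
    "g = g1 * g2" "h = h1 * h2" "g1 ^ m = h1 ^ k" "D = h2 ^ k * w" "E = g2 ^ m * w"
    "r ^ (k div gcd m k) \<le> g1" "rad (g * h) \<le> r * g2 * h2"
proof -
  define S where "S = prime_factors g \<inter> prime_factors h"
  define pp where "pp x T = (\<Prod>p\<in>T. p ^ multiplicity p x)" for x :: int and T :: "int set"
  define g1 where "g1 = pp g S"
  define g2 where "g2 = pp g (prime_factors g - S)"
  define h1 where "h1 = pp h S"
  define h2 where "h2 = pp h (prime_factors h - S)"
  define r where "r = \<Prod>S"
  have nz: "g \<noteq> 0" "h \<noteq> 0" "D \<noteq> 0" "E \<noteq> 0" using pos by auto
  have fin: "finite S" by (simp add: S_def)
  have pp_ge: "pp x T \<ge> 1" if "T \<subseteq> prime_factors y" for x y T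
    unfolding pp_def
  proof (rule prod_ge_1)
    fix p assume "p \<in> T"
    with that have "prime p" by auto
    then show "1 \<le> p ^ multiplicity p x"
      by (meson one_le_power prime_ge_1_int)
  qed
  have ge: "g1 \<ge> 1" "g2 \<ge> 1" "h1 \<ge> 1" "h2 \<ge> 1"
    unfolding g1_def g2_def h1_def h2_def
    by (rule pp_ge[of _ g], simp add: S_def, rule pp_ge[of _ g], force, rule pp_ge[of _ h],
        simp add: S_def, rule pp_ge[of _ h], force)
  have "r \<ge> 1" unfolding r_def S_def
    by (rule prod_ge_1) (auto dest!: in_prime_factors_imp_prime prime_ge_1_int)
  have split: "x = pp x S * pp x (prime_factors x - S)" if "x \<ge> 1" "S \<subseteq> prime_factors x" for x
  proof -
    have "pp x (prime_factors x - S) * pp x S = pp x (prime_factors x)"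
      unfolding pp_def by (rule prod.subset_diff[symmetric]) (use that in auto)
    also have "\<dots> = x" unfolding pp_def using prod_prime_factors[of x] that by simp
    finally show ?thesis by (simp add: mult.commute)
  qed
  have g: "g = g1 * g2" unfolding g1_def g2_def by (rule split) (auto simp: pos S_def)
  have h: "h = h1 * h2" unfolding h1_def h2_def by (rule split) (auto simp: pos S_def)
  have mult: "m * multiplicity p g = k * multiplicity p h" if "p \<in> S" for p
  proof -
    from that have p: "prime p" "p dvd g" "p dvd h" by (auto simp: S_def prime_factors_dvd)
    have no: "\<not> p dvd D" "\<not> p dvd E"
      using p cop by (meson coprime_common_divisor not_prime_unit)+
    have "multiplicity p (g ^ m * D) = m * multiplicity p g + multiplicity p D"
      "multiplicity p (h ^ k * E) = k * multiplicity p h + multiplicity p E"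
      using p nz by (auto simp: prime_elem_multiplicity_mult_distrib prime_elem_multiplicity_power_distrib)
    then show ?thesis using eq no by (simp add: not_dvd_imp_multiplicity_0)
  qed
  have e1: "g1 ^ m = h1 ^ k"
    unfolding g1_def h1_def pp_def prod_power_distrib power_mult[symmetric]
    by (rule prod.cong) (auto dest: mult simp: mult.commute)
  have "g2 ^ m * D = h2 ^ k * E"
  proof -
    have "g1 ^ m * (g2 ^ m * D) = g1 ^ m * (h2 ^ k * E)"
      using eq e1 by (simp add: g h power_mult_distrib mult.assoc)
    then show ?thesis using ge by simp
  qed
  have cop2: "coprime g2 h2"
  proof (rule coprimeI, rule ccontr)
    fix c :: int assume c: "c dvd g2" "c dvd h2" "\<not> is_unit c"
    then obtain p where "prime p" "p dvd c"
      using ge(2) prime_divisor_exists[of c] by force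
    with c have p: "prime p" "p dvd g2" "p dvd h2" by auto
    have *: "p \<in> T" if dv: "p dvd pp x T" and sub: "T \<subseteq> prime_factors x" for x T
    proof -
      have "finite T" using sub finite_subset by blast
      then obtain q where q: "q \<in> T" "p dvd q ^ multiplicity q x"
        using dv p(1) prime_dvd_prod_iff[of T p "\<lambda>q. q ^ multiplicity q x"] unfolding pp_def by blast
      then have "p dvd q" using p prime_dvd_power by blast
      then have "p = q" using p q sub by (metis in_prime_factors_imp_prime primes_dvd_imp_eq subsetD)
      then show ?thesis using q by simp
    qed
    have "p \<in> prime_factors g - S" "p \<in> prime_factors h - S"
      using *[of g] *[of h] p unfolding g2_def h2_def by blast+
    then show False by (auto simp: S_def)
  qed
  have "h2 ^ k dvd g2 ^ m * D" using \<open>g2 ^ m * D = h2 ^ k * E\<close> by simp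
  then have "h2 ^ k dvd D"
    using cop2 by (simp add: coprime_commute coprime_dvd_mult_right_iff)
  then obtain w where w: "D = h2 ^ k * w" by blast
  have "h2 ^ k > 0" using ge by simp
  then have "w \<ge> 1" using w pos(3) by (metis int_one_le_iff_zero_less mult.commute zero_less_mult_pos2)
  have E: "E = g2 ^ m * w"
  proof -
    have "h2 ^ k * E = h2 ^ k * (g2 ^ m * w)"
      using \<open>g2 ^ m * D = h2 ^ k * E\<close>[symmetric] unfolding w by (simp only: mult_ac)
    then show ?thesis using \<open>h2 ^ k > 0\<close> by (metis mult_cancel_left less_irrefl)
  qed
  \<comment> \<open>From \<open>m * multiplicity p g = k * multiplicity p h\<close>, the number
    \<open>k div gcd m k\<close> divides \<open>multiplicity p g\<close>, so every common prime
    occurs in \<open>g1\<close> at least to that power.\<close>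
  have rk: "r ^ (k div gcd m k) \<le> g1"
    unfolding r_def g1_def pp_def prod_power_distrib
  proof (rule prod_mono, safe)
    fix p assume p: "p \<in> S"
    then have pr: "prime p" "multiplicity p g > 0"
      by (auto simp: S_def prime_factors_multiplicity)
    then have "p \<ge> 1" by (simp add: prime_ge_1_int)
    define e where "e = gcd m k"
    have "e > 0" using pos(6) by (simp add: e_def)
    have "e * (m div e * multiplicity p g) = e * (k div e * multiplicity p h)"
      using mult[OF p] by (simp add: e_def flip: mult.assoc)
    then have "k div e dvd m div e * multiplicity p g" using \<open>e > 0\<close> by simp
    moreover have "coprime (k div e) (m div e)"
      using div_gcd_coprime[of m k] pos(6) by (simp add: e_def coprime_commute)
    ultimately have "k div gcd m k dvd multiplicity p g"
      by (simp add: coprime_dvd_mult_right_iff e_def)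
    then have "k div gcd m k \<le> multiplicity p g" using pr by (simp add: dvd_imp_le)
    then show "p ^ (k div gcd m k) \<le> p ^ multiplicity p g"
      using \<open>p \<ge> 1\<close> by (rule power_increasing)
    show "0 \<le> p ^ (k div gcd m k)" using \<open>p \<ge> 1\<close> by simp
  qed
  have "rad (g * h) \<le> r * g2 * h2"
  proof -
    \<comment> \<open>\<open>g1\<close> and \<open>h1\<close> contribute only primes of
      \<open>S\<close>, and all of these divide \<open>r\<close>.\<close>
    have sub: "prime_factors (pp x S) \<subseteq> S" for x
    proof
      fix p assume "p \<in> prime_factors (pp x S)"
      then have p: "prime p" "p dvd pp x S" by (auto simp: prime_factors_dvd)
      then obtain q where q: "q \<in> S" "p dvd q ^ multiplicity q x"
        using fin prime_dvd_prod_iff[of S p "\<lambda>q. q ^ multiplicity q x"] unfolding pp_def by blast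
      then have "p dvd q" "prime q" using p prime_dvd_power by (auto simp: S_def)
      then show "p \<in> S" using p q by (metis primes_dvd_imp_eq)
    qed
    have pr: "prime p" if "p \<in> S" for p using that by (auto simp: S_def)
    have "S \<subseteq> prime_factors r"
    proof
      fix p assume "p \<in> S"
      then show "p \<in> prime_factors r"
        using fin pr pr[of 0] \<open>r \<ge> 1\<close> dvd_prodI[of S p id] by (auto simp: in_prime_factors_iff r_def)
    qed
    moreover have "prime_factors (g * h) = prime_factors g1 \<union> prime_factors g2 \<union> (prime_factors h1 \<union> prime_factors h2)"
      unfolding g h using ge by (simp add: prime_factors_product)
    moreover have "prime_factors (r * g2 * h2) = prime_factors r \<union> prime_factors g2 \<union> prime_factors h2"
      using ge \<open>r \<ge> 1\<close> by (simp add: prime_factors_product)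
    ultimately have "prime_factors (g * h) \<subseteq> prime_factors (r * g2 * h2)"
      using sub[of g, folded g1_def] sub[of h, folded h1_def] by blast
    then have "rad (g * h) \<le> rad (r * g2 * h2)" by (rule rad_mono)
    also have "\<dots> \<le> \<bar>r * g2 * h2\<bar>" using ge \<open>r \<ge> 1\<close> by (intro rad_le_abs) auto
    also have "\<dots> = r * g2 * h2" using ge \<open>r \<ge> 1\<close> by (simp add: abs_mult)
    finally show ?thesis .
  qed
  from that[OF ge \<open>w \<ge> 1\<close> \<open>r \<ge> 1\<close> g h e1 w E rk this] show ?thesis .
qed

text \<open>The integers \<open>g\<^sup>m\<close> and \<open>g\<^sup>m\<^sup>+\<^sup>n\<close>, with suitable signs, form a multiplicatively dependent pair with
  difference \<open>d\<close>.\<close>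

definition rep :: "int \<Rightarrow> int \<Rightarrow> nat \<Rightarrow> nat \<Rightarrow> int \<Rightarrow> bool" where
  "rep d g m n s \<longleftrightarrow> g \<ge> 2 \<and> m \<ge> 1 \<and> n \<ge> 1 \<and> \<bar>s\<bar> = 1 \<and> d = g ^ m * (g ^ n + s)"

text \<open>A common divisor of \<open>g\<close> and the cofactor divides the unit \<open>s\<close>;
  and \<open>g ^ n \<ge> 2\<close> keeps the cofactor within a factor 2 of
  \<open>g ^ n\<close>.\<close>

lemma rep_cofactor:
  assumes "rep d g m n s"
  shows "g ^ n + s \<ge> 1" "coprime g (g ^ n + s)"
    "\<bar>ln (real_of_int (g ^ n + s)) - n * ln g\<bar> \<le> ln 2"
proof -
  have r: "g \<ge> 2" "n \<ge> 1" "s = 1 \<or> s = -1" using assms by (auto simp: rep_def)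
  have gn: "g ^ n \<ge> 2" using self_le_power[of g n] r by linarith
  then show ge: "g ^ n + s \<ge> 1" using r by auto
  show "coprime g (g ^ n + s)"
  proof (rule coprimeI)
    fix c assume c: "c dvd g" "c dvd g ^ n + s"
    have "c dvd g ^ n" using c r by (meson dvd_trans dvd_power less_le_trans zero_less_one)
    then have "c dvd s" using c by (simp add: dvd_add_right_iff)
    then show "is_unit c" using r by auto
  qed
  have "g ^ n + s \<le> 2 * g ^ n" "g ^ n \<le> 2 * (g ^ n + s)" using gn r(3) by auto
  then have "real_of_int (g ^ n + s) \<le> 2 * real_of_int (g ^ n)" "real_of_int (g ^ n) \<le> 2 * real_of_int (g ^ n + s)"
    by (metis of_int_le_iff of_int_mult of_int_numeral)+
  then have "ln (real_of_int (g ^ n + s)) \<le> ln (2 * real_of_int (g ^ n))"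
     "ln (real_of_int (g ^ n)) \<le> ln (2 * real_of_int (g ^ n + s))"
    using ge gn by (subst ln_le_cancel_iff; linarith)+
  moreover have "ln (2 * real_of_int (g ^ n)) = ln 2 + n * ln g"
    using r(1) by (simp add: ln_mult_pos ln_realpow)
  moreover have "ln (2 * real_of_int (g ^ n + s)) = ln 2 + ln (real_of_int (g ^ n + s))"
    using ge by (intro ln_mult_pos) linarith+
  moreover have "ln (real_of_int (g ^ n)) = n * ln g" using r(1) by (simp add: ln_realpow)
  ultimately show "\<bar>ln (real_of_int (g ^ n + s)) - n * ln g\<bar> \<le> ln 2" by linarith
qed

text \<open>The logarithms of the pieces of \<open>pair_decomposition\<close> satisfy linear
  relations up to a constant depending only on \<open>\<epsilon>\<close>. The two inequalities with
  \<open>\<epsilon>\<close> come from two applications of the abc conjecture, \<open>T1\<close> and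
  \<open>T2\<close> below.\<close>

lemma pair_inequalities:
  assumes abc: abc_conjecture and \<epsilon>: "\<epsilon> > 0"
  obtains C :: real where "C \<ge> 0"
    "\<And>d g m n s h k l t. rep d g m n s \<Longrightarrow> rep d h k l t \<Longrightarrow> g ^ m > h ^ k \<Longrightarrow>
       \<exists>a a' b b' w r. 0 \<le> a \<and> 0 \<le> a' \<and> 0 \<le> b \<and> 0 \<le> b' \<and> 0 \<le> w \<and> 0 \<le> r \<and>
         a + a' = ln (real_of_int g) \<and> b + b' = ln (real_of_int h) \<and>
         \<bar>n * (a + a') - (k * b' + w)\<bar> \<le> C \<and> \<bar>l * (b + b') - (m * a' + w)\<bar> \<le> C \<and>
         m * a = k * b \<and> real (k div gcd m k) * r \<le> a \<and>
         m * a' \<le> r + a' + b' + \<epsilon> * (r + a' + b' + w) + C \<and>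
         n * (a + a') \<le> r + a' + b' + \<epsilon> * (r + a' + b' + w) + C \<and> k * b' \<le> m * a'"
proof -
  \<comment> \<open>Three losses of size \<open>\<delta> * M\<close> accumulate in estimate 6, hence
    \<open>\<epsilon> / 3\<close>; the bound 1 keeps every factor \<open>1 + \<delta>\<close> below
    2.\<close>
  define \<delta> where "\<delta> = min (\<epsilon> / 3) 1"
  have \<delta>: "0 < \<delta>" "\<delta> \<le> 1" "3 * \<delta> \<le> \<epsilon>" using \<epsilon> by (auto simp: \<delta>_def)
  obtain K where K: "K \<ge> 0" "\<And>A B C :: int. A + B = C \<Longrightarrow> A \<noteq> 0 \<Longrightarrow> C \<noteq> 0 \<Longrightarrow>
       ln \<bar>real_of_int A\<bar> \<le> (1 + \<delta>) * (ln (rad (A * B)) + ln \<bar>real_of_int C\<bar>) + K"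
    using abc_log[OF abc \<delta>(1)] by metis
  define C where "C = 2 * K + 2"
  have "\<exists>a a' b b' w r. 0 \<le> a \<and> 0 \<le> a' \<and> 0 \<le> b \<and> 0 \<le> b' \<and> 0 \<le> w \<and> 0 \<le> r \<and>
         a + a' = ln (real_of_int g) \<and> b + b' = ln (real_of_int h) \<and>
         \<bar>n * (a + a') - (k * b' + w)\<bar> \<le> C \<and> \<bar>l * (b + b') - (m * a' + w)\<bar> \<le> C \<and>
         m * a = k * b \<and> real (k div gcd m k) * r \<le> a \<and>
         m * a' \<le> r + a' + b' + \<epsilon> * (r + a' + b' + w) + C \<and>
         n * (a + a') \<le> r + a' + b' + \<epsilon> * (r + a' + b' + w) + C \<and> k * b' \<le> m * a'"
    if rg: "rep d g m n s" and rh: "rep d h k l t" and gt: "g ^ m > h ^ k" for d g m n s h k l t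
  proof -
    have basic: "g \<ge> 2" "h \<ge> 2" "m \<ge> 1" "n \<ge> 1" "k \<ge> 1" "l \<ge> 1" "\<bar>s\<bar> = 1" "\<bar>t\<bar> = 1"
      "g ^ m * (g ^ n + s) = h ^ k * (h ^ l + t)" using rg rh by (auto simp: rep_def)
    obtain g1 g2 h1 h2 w r :: int where
      ge: "g1 \<ge> 1" "g2 \<ge> 1" "h1 \<ge> 1" "h2 \<ge> 1" "w \<ge> 1" "r \<ge> 1"
      and g: "g = g1 * g2" and h: "h = h1 * h2" and e1: "g1 ^ m = h1 ^ k"
      and D: "g ^ n + s = h2 ^ k * w" and E: "h ^ l + t = g2 ^ m * w"
      and rk: "r ^ (k div gcd m k) \<le> g1" and rad: "rad (g * h) \<le> r * g2 * h2"
    proof (rule pair_decomposition)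
      show "g \<ge> 1" "h \<ge> 1" using basic by auto
    qed (rule rep_cofactor[OF rg] rep_cofactor[OF rh] basic that; assumption?)+
    define a a' b b' \<omega> \<rho> where defs: "a = ln (real_of_int g1)" "a' = ln (real_of_int g2)"
      "b = ln (real_of_int h1)" "b' = ln (real_of_int h2)" "\<omega> = ln (real_of_int w)" "\<rho> = ln (real_of_int r)"
    note pos = ge[folded of_int_1_le_iff[where ?'a = real]]
    have nn: "0 \<le> a" "0 \<le> a'" "0 \<le> b" "0 \<le> b'" "0 \<le> \<omega>" "0 \<le> \<rho>" using pos by (auto simp: defs)
    have lg: "a + a' = ln (real_of_int g)" and lh: "b + b' = ln (real_of_int h)"
      using pos by (auto simp: defs g h ln_mult_pos)
    have lD: "ln (real_of_int (g ^ n + s)) = k * b' + \<omega>"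
      unfolding D using pos by (simp add: ln_mult_pos ln_realpow defs)
    have lE: "ln (real_of_int (h ^ l + t)) = m * a' + \<omega>"
      unfolding E using pos by (simp add: ln_mult_pos ln_realpow defs)
    have ln2: "ln 2 \<le> C" using ln_le_minus_one[of "2::real"] K by (simp add: C_def)
    have 1: "\<bar>n * (a + a') - (k * b' + \<omega>)\<bar> \<le> C"
      using rep_cofactor(3)[OF rg] ln2 unfolding lD lg by linarith
    have 2: "\<bar>l * (b + b') - (m * a' + \<omega>)\<bar> \<le> C"
      using rep_cofactor(3)[OF rh] ln2 unfolding lE lh by linarith
    have 3: "m * a = k * b"
    proof -
      have "ln (real_of_int (g1 ^ m)) = ln (real_of_int (h1 ^ k))" using e1 by simp
      then show ?thesis using pos by (simp add: ln_realpow defs)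
    qed
    have 4: "real (k div gcd m k) * \<rho> \<le> a"
    proof -
      have "real_of_int (r ^ (k div gcd m k)) \<le> real_of_int g1" using rk by linarith
      then have "ln (real_of_int (r ^ (k div gcd m k))) \<le> ln (real_of_int g1)"
        using pos ge by (subst ln_le_cancel_iff) auto
      then show ?thesis using pos by (simp add: ln_realpow defs)
    qed
    have lrad: "ln (real_of_int (rad (g * h))) \<le> \<rho> + a' + b'"
    proof -
      have "real_of_int (rad (g * h)) \<le> r * g2 * h2" using rad by linarith
      then have "ln (real_of_int (rad (g * h))) \<le> ln (real_of_int r * g2 * h2)"
        using rad_ge_1[of "g * h"] pos by (subst ln_le_cancel_iff) auto
      then show ?thesis using pos by (simp add: ln_mult_pos defs)
    qed
    define M where "M = \<rho> + a' + b' + \<omega>"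
    have "M \<ge> 0" using nn by (simp add: M_def)
    have T1: "m * a' + \<omega> \<le> (1 + \<delta>) * M + K"
    proof -
      have "ln \<bar>real_of_int (h ^ l + t)\<bar> \<le>
          (1 + \<delta>) * (ln (rad ((h ^ l + t) * (- (h ^ l)))) + ln \<bar>real_of_int t\<bar>) + K"
        by (rule K(2)) (use basic rep_cofactor(1)[OF rh] in auto)
      moreover have "ln \<bar>real_of_int t\<bar> = 0" using basic(8) by (metis of_int_abs of_int_1 ln_one)
      moreover have "ln (rad ((h ^ l + t) * (- (h ^ l)))) \<le> M"
      proof -
        \<comment> \<open>Exponents do not matter to the radical, so \<open>g2\<close> and
          \<open>h\<close> cost only \<open>rad (g * h)\<close>. Nothing is known about
          \<open>w\<close>, which is charged in full; this is why \<open>\<omega>\<close> enters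
          \<open>M\<close>.\<close>
        have "(h ^ l + t) * h ^ l dvd (g * h) ^ (l + m) * w"
        proof -
          have "g2 ^ m dvd (g * h) ^ m" by (rule dvd_power_same) (simp add: g)
          moreover have "h ^ l dvd (g * h) ^ l" by (rule dvd_power_same) simp
          ultimately have "h ^ l * (g2 ^ m * w) dvd (g * h) ^ l * ((g * h) ^ m * w)"
            by (intro mult_dvd_mono) auto
          then show ?thesis unfolding E by (simp add: power_add mult_ac)
        qed
        then have "rad ((h ^ l + t) * h ^ l) \<le> rad ((g * h) ^ (l + m) * w)"
          using basic ge by (intro rad_dvd_mono) auto
        then have "ln (real_of_int (rad ((h ^ l + t) * h ^ l))) \<le> ln (rad ((g * h) ^ (l + m) * w))"
          using rad_ge_1[of "(h ^ l + t) * h ^ l"] by simp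
        then show ?thesis
          using ln_rad_mult_le[of "(g * h) ^ (l + m)" w] ln_rad_power_le[of "g * h" "l + m"] ln_rad_le[of w] ge lrad
          by (simp add: M_def defs)
      qed
      moreover from this have "(1 + \<delta>) * ln (rad ((h ^ l + t) * (- (h ^ l)))) \<le> (1 + \<delta>) * M"
        using \<delta> by (intro mult_left_mono) auto
      moreover have "ln \<bar>real_of_int (h ^ l + t)\<bar> = m * a' + \<omega>"
        using lE rep_cofactor(1)[OF rh] by (metis abs_of_pos int_one_le_iff_zero_less of_int_0_less_iff)
      ultimately show ?thesis by (metis add.right_neutral add_right_mono order_trans)
    qed
    have T2: "n * (a + a') \<le> (1 + \<delta>) * (\<rho> + a' + b') + \<delta> * (m * a') + (1 + \<delta>) * ln 2 + K"
    proof -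
      \<comment> \<open>\<open>U - V = Z\<close> is
        \<open>g ^ (m + n) - h ^ (k + l) = t * h ^ k - s * g ^ m\<close> divided by
        \<open>g1 ^ m = h1 ^ k\<close>. The radical of \<open>U * V\<close> does not involve
        \<open>w\<close>.\<close>
      define U V Z where "U = g ^ n * g2 ^ m" and "V = h ^ l * h2 ^ k" and "Z = t * h2 ^ k - s * g2 ^ m"
      have "(g ^ n + s) * g2 ^ m = (h ^ l + t) * h2 ^ k" unfolding D E by simp
      then have UVZ: "U + (- V) = Z" by (simp add: U_def V_def Z_def algebra_simps)
      \<comment> \<open>The ordering of the two powers becomes \<open>h2 ^ k < g2 ^ m\<close>, which
        makes \<open>Z\<close> non-zero and bounds it by \<open>2 * g2 ^ m\<close>.\<close>
      have "h1 ^ k * h2 ^ k < h1 ^ k * g2 ^ m" using gt e1 by (simp add: g h power_mult_distrib)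
      then have lt: "h2 ^ k < g2 ^ m" using ge by simp
      have "0 < h2 ^ k" using ge by simp
      have "Z \<noteq> 0"
        using lt \<open>0 < h2 ^ k\<close> basic(7,8) by (auto simp: Z_def abs_if split: if_splits)
      have Zle: "\<bar>Z\<bar> \<le> 2 * g2 ^ m"
        using lt \<open>0 < h2 ^ k\<close> basic(7,8) by (auto simp: Z_def abs_if split: if_splits)
      have "U \<ge> 1" using basic ge by (simp add: U_def int_one_le_iff_zero_less)
      have "ln \<bar>real_of_int U\<bar> \<le> (1 + \<delta>) * (ln (rad (U * - V)) + ln \<bar>real_of_int Z\<bar>) + K"
        by (rule K(2)[OF UVZ]) (use \<open>Z \<noteq> 0\<close> \<open>U \<ge> 1\<close> in auto)
      moreover have "ln \<bar>real_of_int U\<bar> = n * (a + a') + m * a'"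
        using pos basic(1) unfolding lg U_def by (simp add: ln_mult_pos ln_realpow defs abs_mult)
      moreover have "ln \<bar>real_of_int Z\<bar> \<le> ln 2 + m * a'"
      proof -
        have "\<bar>real_of_int Z\<bar> \<le> 2 * real_of_int g2 ^ m"
          using of_int_le_iff[THEN iffD2, OF Zle, where 'a1 = real] by simp
        then have "ln \<bar>real_of_int Z\<bar> \<le> ln (2 * real_of_int g2 ^ m)"
          using \<open>Z \<noteq> 0\<close> pos by (subst ln_le_cancel_iff) auto
        then show ?thesis using pos by (simp add: ln_mult_pos ln_realpow defs)
      qed
      moreover have "ln (rad (U * - V)) \<le> \<rho> + a' + b'"
      proof -
        have "U * V dvd (g * h) ^ (n + m + l + k)"
        proof -
          have "g ^ n dvd (g * h) ^ n" "h ^ l dvd (g * h) ^ l" "g2 ^ m dvd (g * h) ^ m" "h2 ^ k dvd (g * h) ^ k"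
            by (rule dvd_power_same; simp add: g h)+
          then have "(g ^ n * g2 ^ m) * (h ^ l * h2 ^ k) dvd ((g * h) ^ n * (g * h) ^ m) * ((g * h) ^ l * (g * h) ^ k)"
            by (intro mult_dvd_mono)
          then show ?thesis unfolding U_def V_def by (simp only: power_add mult.assoc)
        qed
        then have "rad (U * V) \<le> rad ((g * h) ^ (n + m + l + k))"
          using basic by (intro rad_dvd_mono) auto
        then have "ln (real_of_int (rad (U * V))) \<le> ln (real_of_int (rad ((g * h) ^ (n + m + l + k))))"
          using rad_ge_1[of "U * V"] by simp
        then show ?thesis using ln_rad_power_le[of "g * h" "n + m + l + k"] lrad by simp
      qed
      ultimately have "n * (a + a') + m * a' \<le> (1 + \<delta>) * (ln (rad (U * - V)) + ln \<bar>real_of_int Z\<bar>) + K"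
        "ln (rad (U * - V)) + ln \<bar>real_of_int Z\<bar> \<le> \<rho> + a' + b' + ln 2 + m * a'" by auto
      moreover from this(2) have "(1 + \<delta>) * (ln (rad (U * - V)) + ln \<bar>real_of_int Z\<bar>) \<le> (1 + \<delta>) * (\<rho> + a' + b' + ln 2 + m * a')"
        using \<delta> by (intro mult_left_mono) auto
      ultimately show ?thesis by (simp add: algebra_simps)
    qed
    have "\<delta> * M \<le> \<epsilon> * M / 3" using \<delta> \<open>M \<ge> 0\<close> mult_right_mono[of "3 * \<delta>" \<epsilon> M] by simp
    have 5: "m * a' \<le> \<rho> + a' + b' + \<epsilon> * M + C"
    proof -
      have "0 \<le> \<epsilon> * M" using \<epsilon> \<open>M \<ge> 0\<close> by simp
      then show ?thesis using T1 \<open>\<delta> * M \<le> \<epsilon> * M / 3\<close> K(1) unfolding C_def by (simp add: M_def algebra_simps)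
    qed
    have 6: "n * (a + a') \<le> \<rho> + a' + b' + \<epsilon> * M + C"
    proof -
      \<comment> \<open>\<open>T1\<close> bounds \<open>m * a'\<close> by \<open>2 * M + K\<close>,
        so the term \<open>\<delta> * (m * a')\<close> of \<open>T2\<close> is only an
        error.\<close>
      have "\<delta> * (m * a') \<le> \<delta> * (2 * M + K)"
      proof (rule mult_left_mono)
        have "\<delta> * M \<le> 1 * M" using \<delta> \<open>M \<ge> 0\<close> by (intro mult_right_mono) auto
        then show "m * a' \<le> 2 * M + K" using T1 nn by (simp add: algebra_simps)
      qed (use \<delta> in simp)
      moreover have "\<delta> * K \<le> K" using \<delta> K(1) by (simp add: mult_left_le_one_le)
      moreover have "(1 + \<delta>) * ln 2 \<le> 2"
        using mult_mono[of "1 + \<delta>" 2 "ln 2" 1] ln_le_minus_one[of "2::real"] \<delta> by simp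
      moreover have "\<delta> * (\<rho> + a' + b') \<le> \<delta> * M" using \<delta> nn by (intro mult_left_mono) (auto simp: M_def)
      ultimately have "n * (a + a') \<le> \<rho> + a' + b' + 3 * (\<delta> * M) + C"
        using T2 unfolding C_def by (simp add: algebra_simps)
      then show ?thesis using \<open>\<delta> * M \<le> \<epsilon> * M / 3\<close> by linarith
    qed
    have 7: "k * b' \<le> m * a'"
    proof -
      have "h1 ^ k * h2 ^ k \<le> h1 ^ k * g2 ^ m" using gt e1 by (simp add: g h power_mult_distrib)
      then have "h2 ^ k \<le> g2 ^ m" using ge by simp
      then have "real_of_int (h2 ^ k) \<le> real_of_int (g2 ^ m)" by (rule of_int_le_iff[THEN iffD2])
      then have "ln (real_of_int (h2 ^ k)) \<le> ln (real_of_int (g2 ^ m))"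
        using pos by (subst ln_le_cancel_iff) auto
      then show ?thesis using pos by (simp add: ln_realpow defs)
    qed
    show ?thesis
      using nn lg lh 1 2 3 4 5 6 7 unfolding M_def by blast
  qed
  moreover have "C \<ge> 0" using K by (simp add: C_def)
  ultimately show ?thesis using that by blast
qed

text \<open>The reals stand for the logarithms of the pieces in \<open>pair_decomposition\<close>: \<open>a, a'\<close> for the factors of \<open>g\<close>,
  \<open>b, b'\<close> for those of \<open>h\<close> (the unprimed ones supported on the common primes), \<open>w\<close> for the
  common cofactor and \<open>r\<close> for the product of the common primes. The error \<open>E\<close> absorbs the \<open>\<epsilon>\<close> and the
  constants of the \<open>abc\<close> conjecture.\<close>

locale pair_config =
  fixes m n k l :: nat and a a' b b' w r E :: real
  assumes exps: "m \<ge> 1" "n \<ge> 1" "k \<ge> 1" "l \<ge> 1"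
    and nonneg: "0 \<le> a" "0 \<le> a'" "0 \<le> b" "0 \<le> b'" "0 \<le> w" "0 \<le> r"
    and cofactor1: "\<bar>n * (a + a') - (k * b' + w)\<bar> \<le> E"
    and cofactor2: "\<bar>l * (b + b') - (m * a' + w)\<bar> \<le> E"
    and common: "m * a = k * b"
    and radical: "real (k div gcd m k) * r \<le> a"
    and order: "k * b' \<le> m * a'"
    and abc1: "m * a' \<le> r + a' + b' + E"
    and abc2: "n * (a + a') \<le> r + a' + b' + E"
    and large: "1000 * E < r + a' + b' + w"
begin

section \<open>Exclusion of exponent patterns by linear inequalities\<close>

lemma scale: "c \<le> x \<Longrightarrow> 0 \<le> y \<Longrightarrow> real c * y \<le> real x * y"
  by (intro mult_right_mono) auto

lemma E_nonneg: "0 \<le> E"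
  using cofactor1 by linarith

lemma radical_le: "r \<le> a"
proof -
  have "k div gcd m k \<ge> 1" using exps by (simp add: Suc_le_eq div_greater_zero_iff gcd_le2_nat)
  then show ?thesis using radical scale[of 1 "k div gcd m k" r] nonneg by simp
qed

text \<open>For \<open>E = 0\<close>, the assumptions \<open>cofactor1\<close>, \<open>abc2\<close>
  and \<open>r \<le> a\<close> would give \<open>(n - 1) * (a + a') \<le> b'\<close> and
  \<open>(k - 1) * b' + w \<le> a + a'\<close>. So if \<open>(n - 1) * (k - 1) > 1\<close>, all
  pieces vanish up to multiples of \<open>E\<close>, against \<open>large\<close>. The cases
  \<open>k = 1\<close> and \<open>k = n = 2\<close> bring in the other inequalities. The two
  patterns left over are excluded later by comparing bases.\<close>

lemma exponents_of_cofactor_ge_2: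
  assumes n: "n \<ge> 2" and diag: "m \<noteq> n" "k \<noteq> l"
  shows "(m, n, k, l) = (4, 2, 2, 1) \<or> (m, n, k, l) = (1, 2, 1, 2)"
proof (rule ccontr)
  assume neg: "\<not> ?thesis"
  note facts = nonneg E_nonneg radical_le large order
  define na na' where "na = n * a" and "na' = n * a'"
  define ma ma' where "ma = m * a" and "ma' = m * a'"
  have sum: "n * (a + a') = na + na'" by (simp add: na_def na'_def algebra_simps)
  note ineqs = cofactor1[unfolded sum] abc1[folded ma'_def] abc2[unfolded sum]
  have na: "2 * a \<le> na" "2 * a' \<le> na'" "a \<le> ma" "a' \<le> ma'"
    using scale[OF n, of a] scale[OF n, of a'] scale[OF exps(1), of a] scale[OF exps(1), of a'] nonneg
    by (auto simp: na_def na'_def ma_def ma'_def)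
  consider "k \<ge> 3" | "k = 2" "n \<ge> 3" | "k = 2" "n = 2" | "k = 1" using exps n by linarith
  then show False
  proof cases
    case 1
    then have "3 * b' \<le> k * b'" using scale[of 3 k b'] nonneg by simp
    then show False using facts na ineqs by linarith
  next
    case 2
    then have "3 * a \<le> na" "3 * a' \<le> na'" using scale[of 3 n a] scale[of 3 n a'] nonneg by (auto simp: na_def na'_def)
    then show False using facts na ineqs 2 by simp
  next
    case 3
    have b: "ma = 2 * b" using common 3 by (simp add: ma_def)
    have eqs: "na = 2 * a" "na' = 2 * a'" using 3 by (auto simp: na_def na'_def)
    have ub: "b' + w \<le> r + a' + 2 * E" "2 * a + a' \<le> r + b' + E" using 3 ineqs eqs by auto
    have c2: "l * (b + b') \<le> ma' + w + E" using cofactor2 by (simp add: ma'_def)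
    have bb: "b + b' \<le> ma' + w + E" using order_trans[OF _ c2] scale[of 1 l "b + b'"] exps nonneg by simp
    consider "m = 1" | "m \<ge> 3" using diag 3 exps by linarith
    then show False
    proof cases
      case 1
      then have "2 * b' \<le> a'" using order 3 by simp
      then show False using ub facts by linarith
    next
      case m: 2
      have m3: "3 * a' \<le> ma'" "3 * a \<le> ma" using scale[OF m, of a'] scale[OF m, of a] nonneg by (auto simp: ma'_def ma_def)
      consider "l \<ge> 2" | "l = 1" "m \<ge> 5" | "l = 1" "m = 3" | "l = 1" "m = 4" using m exps by linarith
      then show False
      proof cases
        case 1
        then have "2 * (b + b') \<le> l * (b + b')" using scale[of 2 l "b + b'"] nonneg by simp
        then have "2 * b + 2 * b' \<le> ma' + w + E" using order_trans[OF _ c2] by (simp add: distrib_left)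
        then show False using ub m3 b nonneg E_nonneg radical_le large abc1[folded ma'_def] by linarith
      next
        case 2
        have "5 * a' \<le> ma'" "5 * a \<le> ma"
          using scale[OF 2(2), of a'] scale[OF 2(2), of a] nonneg by (auto simp: ma'_def ma_def)
        then show False using bb ub b facts ineqs by linarith
      next
        case l: 3
        \<comment> \<open>Since 3 and 2 are coprime, the common primes occur in \<open>g\<close> at
          least squared.\<close>
        have "2 * r \<le> a" using radical 3 l by (simp add: gcd.commute[of 3])
        then show False using ub m3 facts ineqs by linarith
      next
        case 4
        then show False using neg 3 by simp
      qed
    qed
  next
    case 4
    have b: "b = ma" using common 4 by (simp add: ma_def)
    have ub: "w \<le> r + a' + 2 * E" using ineqs 4 by simp
    have c2: "l * (b + b') \<le> ma' + w + E" "ma' + w \<le> l * (b + b') + E" using cofactor2 by (auto simp: ma'_def)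
    have c1: "b' + w \<le> na + na' + E" "na + na' \<le> b' + w + E" using ineqs 4 by auto
    note facts4 = nonneg E_nonneg radical_le large
    note ineqs4 = abc1[folded ma'_def] abc2[unfolded sum]
    have "l \<ge> 2" using diag 4 exps by linarith
    then consider "l \<ge> 4" | "l = 3" | "l = 2" by linarith
    then show False
    proof cases
      case 1
      then have "4 * (b + b') \<le> l * (b + b')" using scale[of 4 l "b + b'"] nonneg by simp
      then have "4 * b + 4 * b' \<le> ma' + w + E" using order_trans[OF _ c2(1)] by (simp add: distrib_left)
      then show False using ub na b facts ineqs by linarith
    next
      case l: 2
      have c2': "3 * b + 3 * b' \<le> ma' + w + E" using c2 l by auto
      consider "n \<ge> 3" | "n = 2" "m \<ge> 3" | "n = 2" "m = 1" using n diag exps by linarith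
      then show False
      proof cases
        case 1
        then have "3 * a \<le> na" "3 * a' \<le> na'" using scale[of 3 n a] scale[of 3 n a'] nonneg by (auto simp: na_def na'_def)
        then show False using c2' ub na b facts4 ineqs4 by linarith
      next
        case 2
        then have "3 * a' \<le> ma'" using scale[of 3 m a'] nonneg by (auto simp: ma'_def)
        then show False using c2' ub na b facts4 ineqs4 by linarith
      next
        case 3
        then have "ma' = a'" by (auto simp: ma'_def)
        then show False using c2' ub na b facts4 ineqs4 by linarith
      qed
    next
      case l: 3
      have c2': "2 * b + 2 * b' \<le> ma' + w + E" "ma' + w \<le> 2 * b + 2 * b' + E" using c2 l by auto
      consider "n \<ge> 4" | "n = 3" "m \<ge> 4" | "n = 3" "m \<le> 2" | "n = 2" "m \<ge> 3" | "n = 2" "m = 1"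
        using n diag exps by linarith
      then show False
      proof cases
        case 1
        then have "4 * a \<le> na" "4 * a' \<le> na'" using scale[of 4 n a] scale[of 4 n a'] nonneg by (auto simp: na_def na'_def)
        then show False using c2' ub na b facts4 ineqs4 by linarith
      next
        case 2
        then have "na = 3 * a" "na' = 3 * a'" "4 * a' \<le> ma'" using scale[of 4 m a'] nonneg by (auto simp: na_def na'_def ma'_def)
        then show False using c2' c1 ub na b facts4 ineqs4 by linarith
      next
        case 3
        then have "na = 3 * a" "na' = 3 * a'" "ma' \<le> 2 * a'" using scale[of m 2 a'] nonneg by (auto simp: na_def na'_def ma'_def)
        then show False using c2' c1 ub na b facts4 ineqs4 by linarith
      next
        case 4
        then have "na = 2 * a" "na' = 2 * a'" "3 * a' \<le> ma'" "3 * a \<le> ma"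
          using scale[of 3 m a'] scale[of 3 m a] nonneg by (auto simp: na_def na'_def ma'_def ma_def)
        then show False using c2' c1 ub na b facts4 ineqs4 by linarith
      next
        case 5
        then show False using neg l 4 by simp
      qed
    qed
  qed
qed

text \<open>For \<open>n = 1\<close> the inequality \<open>abc2\<close> reads
  \<open>a \<le> r + b' + E\<close>, so everything depends on how far \<open>r\<close> lies below
  \<open>a\<close>. That is decided by whether \<open>k\<close> divides \<open>m\<close>.\<close>

lemma exponents_of_cofactor_1:
  assumes n: "n = 1" and m: "m \<ge> 3" and diag: "k \<noteq> l"
  shows "(m, k, l) = (3, 2, 1) \<or> (m = 2 * k \<and> l = 1) \<or> (m = k \<and> l \<le> 2)"
proof (rule ccontr)
  assume neg: "\<not> ?thesis"
  note facts = nonneg E_nonneg radical_le large order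
  define kb' lb lb' ma' where "kb' = k * b'" and "lb = l * b" and "lb' = l * b'" and "ma' = m * a'"
  have c1: "kb' + w \<le> a + a' + E" "a + a' \<le> kb' + w + E"
    using cofactor1 n by (auto simp: kb'_def)
  have c2: "lb + lb' \<le> ma' + w + E" using cofactor2 by (auto simp: lb_def lb'_def ma'_def algebra_simps)
  have a1: "ma' \<le> r + a' + b' + E" using abc1 by (simp add: ma'_def)
  have a2: "a \<le> r + b' + E" using abc2 n by simp
  have m3: "3 * a' \<le> ma'" using scale[OF m, of a'] nonneg by (simp add: ma'_def)
  have bb: "b \<le> lb" "b' \<le> lb'" "b' \<le> kb'"
    using scale[OF exps(4), of b] scale[OF exps(4), of b'] scale[OF exps(3), of b'] nonneg
    by (auto simp: lb_def lb'_def kb'_def)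
  note ineqs = c1 c2 a1 a2 m3 bb
  show False
  proof (cases "k dvd m")
    case False
    \<comment> \<open>If \<open>k\<close> does not divide \<open>m\<close>, the common primes occur
      in \<open>g\<close> at least squared, which halves the bound on \<open>r\<close>.\<close>
    have "k div gcd m k \<ge> 2"
    proof -
      have "k div gcd m k \<noteq> 1"
        using False exps by (metis dvd_div_mult_self gcd_dvd1 gcd_dvd2 mult_1)
      moreover have "k div gcd m k \<noteq> 0" using exps by (simp add: dvd_div_eq_0_iff)
      ultimately show ?thesis by linarith
    qed
    then have r2: "2 * r \<le> a" using radical scale[of 2 "k div gcd m k" r] nonneg by simp
    have "k \<noteq> 1" using False by auto
    then consider "k \<ge> 4" | "k = 3" | "k = 2" using exps by linarith
    then show False
    proof cases
      case 1
      then have "4 * b' \<le> kb'" using scale[of 4 k b'] nonneg by (simp add: kb'_def)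
      then show False using facts ineqs r2 by linarith
    next
      case 2
      then have "m \<noteq> 3" using False by auto
      then have "m \<ge> 4" using m by linarith
      then have "4 * a' \<le> ma'" using scale[of 4 m a'] nonneg by (simp add: ma'_def)
      moreover have "kb' = 3 * b'" using 2 by (simp add: kb'_def)
      ultimately show False using facts ineqs r2 by linarith
    next
      case 3
      have kb: "kb' = 2 * b'" "m * a = 2 * b" using 3 common by (auto simp: kb'_def)
      have "m \<noteq> 4" using False 3 by auto
      then consider "m \<ge> 5" | "m = 3" using m by linarith
      then show False
      proof cases
        case 1
        then have "5 * a' \<le> ma'" "5 * a \<le> 2 * b" using scale[of 5 m a'] scale[of 5 m a] kb nonneg by (auto simp: ma'_def)
        then show False using facts ineqs r2 kb by linarith
      next
        case m3: 2
        have b: "3 * a = 2 * b" using kb m3 by simp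
        have "l \<ge> 3" using neg diag m3 3 exps by auto
        then have "3 * b \<le> lb" "3 * b' \<le> lb'" using scale[of 3 l b] scale[of 3 l b'] nonneg by (auto simp: lb_def lb'_def)
        then show False using facts ineqs r2 kb b by linarith
      qed
    qed
  next
    case True
    then obtain j where j: "m = k * j" by blast
    have b: "b = j * a" using common exps by (simp add: j)
    have lb: "lb = real (l * j) * a" by (simp add: lb_def b)
    have "j \<ge> 1" using j exps by (cases j) auto
    then have "l * j \<ge> 1" using exps by simp
    \<comment> \<open>This adds up \<open>cofactor1\<close>, \<open>cofactor2\<close>,
      \<open>abc1\<close> and \<open>r \<le> a\<close>. As \<open>b = j * a\<close>, the left side
      contains \<open>a\<close> with coefficient \<open>l * j\<close>, so large \<open>l * j\<close>
      is impossible, while \<open>l * j \<le> 2\<close> gives the last two patterns of the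
      statement.\<close>
    have key: "lb + lb' + kb' \<le> 2 * a + 2 * a' + b' + 3 * E"
      using facts ineqs by linarith
    have l3: "3 * b' \<le> lb' + kb'"
    proof -
      have "3 \<le> l + k" using diag exps by linarith
      then show ?thesis using scale[of 3 "l + k" b'] nonneg by (simp add: lb'_def kb'_def algebra_simps)
    qed
    consider "l * j \<ge> 4" | "l * j = 3" | "l * j = 2" | "l * j = 1" using \<open>l * j \<ge> 1\<close> by linarith
    then show False
    proof cases
      case 1
      then have "4 * a \<le> lb" using scale[of 4 "l * j" a] nonneg unfolding lb by simp
      then show False using facts ineqs key l3 by linarith
    next
      case 2
      have "m \<noteq> 3"
      proof
        assume "m = 3"
        with j 2 have "k = l" by (metis mult_cancel2 zero_neq_numeral mult_0_right)
        then show False using diag by simp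
      qed
      then have "m \<ge> 4" using m by linarith
      then have "4 * a' \<le> ma'" using scale[of 4 m a'] nonneg by (simp add: ma'_def)
      moreover have "lb = 3 * a" using lb 2 by simp
      ultimately show False using facts ineqs key l3 by linarith
    next
      case 3
      then have "(l = 1 \<and> j = 2) \<or> (l = 2 \<and> j = 1)"
        by (cases l; cases j; auto simp: add_eq_if split: if_splits)
      then show False using neg j by auto
    next
      case 4
      then show False using neg j by auto
    qed
  qed
qed

text \<open>As 2 and 3 are coprime, the common primes occur in \<open>g\<close> at least cubed. Up
  to multiples of \<open>E\<close>, the bound \<open>3 * r \<le> a\<close> yields both
  \<open>2 * a \<le> 3 * b'\<close> and \<open>3 * b' \<le> a\<close>, so that \<open>a\<close> and
  then all other pieces are negligible.\<close>

lemma exponents_2_1_3_2: "(m, n, k, l) \<noteq> (2, 1, 3, 2)"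
proof
  assume "(m, n, k, l) = (2, 1, 3, 2)"
  then have e: "m = 2" "n = 1" "k = 3" "l = 2" by auto
  have "gcd 2 (3::nat) = 1" by (simp add: gcd.commute[of 2] gcd_red_nat[of 3])
  then have "3 * r \<le> a" using radical e by simp
  then show False
    using nonneg E_nonneg large cofactor1 cofactor2 common abc1 abc2 e by simp
qed

end

text \<open>For larger \<open>d\<close> the exponents \<open>m\<close> and \<open>k\<close> exceed
  \<open>B + 1\<close>. Then \<open>g2 ^ m\<close> and \<open>h2 ^ k\<close>, which divide the
  bounded cofactors, can only be 1, and \<open>g ^ m = g1 ^ m = h1 ^ k = h ^ k\<close>.\<close>

lemma bounded_cofactors_imp_bounded:
  assumes rg: "rep d g m n s" and rh: "rep d h k l t" and ne: "g ^ m \<noteq> h ^ k"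
    and B: "g ^ n \<le> B" "h ^ l \<le> B"
  shows "d \<le> B ^ (nat B + 1) * (B + 1)"
proof (rule ccontr)
  assume neg: "\<not> ?thesis"
  have large: "m > nat B + 1" if r: "rep d g m n s" and gB: "g ^ n \<le> B" for g m n s
  proof (rule ccontr)
    assume "\<not> m > nat B + 1"
    have r': "g \<ge> 2" "n \<ge> 1" "\<bar>s\<bar> = 1" "d = g ^ m * (g ^ n + s)" using r by (auto simp: rep_def)
    have "g \<le> B" using gB self_le_power[of g n] r' by linarith
    have "g ^ m \<le> B ^ m" using \<open>g \<le> B\<close> r' by (intro power_mono) auto
    also have "\<dots> \<le> B ^ (nat B + 1)" using \<open>\<not> m > nat B + 1\<close> \<open>g \<le> B\<close> r' by (intro power_increasing) auto
    finally have "g ^ m \<le> B ^ (nat B + 1)" .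
    then have "d \<le> B ^ (nat B + 1) * (B + 1)"
      unfolding r'(4) using gB rep_cofactor(1)[OF r] r' \<open>g \<le> B\<close> by (intro mult_mono) auto
    then show False using neg by simp
  qed
  have m: "m > nat B + 1" and k: "k > nat B + 1" using large rg rh B by blast+
  have basic: "g \<ge> 2" "h \<ge> 2" "m \<ge> 1" "k \<ge> 1" "\<bar>s\<bar> = 1" "\<bar>t\<bar> = 1"
      "g ^ m * (g ^ n + s) = h ^ k * (h ^ l + t)" using rg rh by (auto simp: rep_def)
  obtain g1 g2 h1 h2 w r :: int where
      ge: "g1 \<ge> 1" "g2 \<ge> 1" "h1 \<ge> 1" "h2 \<ge> 1" "w \<ge> 1" "r \<ge> 1"
      and g: "g = g1 * g2" and h: "h = h1 * h2" and e1: "g1 ^ m = h1 ^ k"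
      and D: "g ^ n + s = h2 ^ k * w" and E: "h ^ l + t = g2 ^ m * w"
      and rk: "r ^ (k div gcd m k) \<le> g1" and rad: "rad (g * h) \<le> r * g2 * h2"
  proof (rule pair_decomposition)
    show "g \<ge> 1" "h \<ge> 1" using basic by auto
  qed (rule rep_cofactor[OF rg] rep_cofactor[OF rh] basic that; assumption?)+
  have one: "x = 1" if "x \<ge> 1" "x ^ j * w \<le> B + 1" "j > nat B + 1" for x :: int and j
  proof (rule ccontr)
    assume "x \<noteq> 1"
    then have "2 ^ j \<le> x ^ j" using that by (intro power_mono) auto
    also have "\<dots> \<le> x ^ j * w" using ge(5) that(1) mult_left_mono[of 1 w "x ^ j"] by simp
    also have "\<dots> \<le> B + 1" by fact
    finally have "2 ^ j \<le> B + 1" .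
    moreover have "int j < 2 ^ j" by (rule of_nat_less_two_power)
    ultimately show False using that(3) by linarith
  qed
  have "h2 = 1" "g2 = 1"
    using one[OF ge(4) _ k] one[OF ge(2) _ m] D E B basic(5,6) by linarith+
  then show False using ne e1 g h by simp
qed

lemma pair_exponents:
  assumes abc: abc_conjecture
  obtains N :: int where
    "\<And>d g m n s h k l t. rep d g m n s \<Longrightarrow> rep d h k l t \<Longrightarrow> g ^ m > h ^ k \<Longrightarrow> d > N \<Longrightarrow>
       m \<noteq> n \<Longrightarrow> k \<noteq> l \<Longrightarrow>
       (n \<ge> 2 \<longrightarrow> (m, n, k, l) = (4, 2, 2, 1) \<or> (m, n, k, l) = (1, 2, 1, 2)) \<and>
       (n = 1 \<longrightarrow> m \<ge> 3 \<longrightarrow> (m, k, l) = (3, 2, 1) \<or> (m = 2 * k \<and> l = 1) \<or> (m = k \<and> l \<le> 2)) \<and>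
       (m, n, k, l) \<noteq> (2, 1, 3, 2)"
proof (rule pair_inequalities[OF abc])
  \<comment> \<open>Half of the margin 1/1000 in \<open>large\<close>; the other half absorbs the
    constant \<open>C\<close>.\<close>
  show "(1 / 2000 :: real) > 0" by simp
next
  fix C :: real assume C: "C \<ge> 0" and main:
    "\<And>d g m n s h k l t. rep d g m n s \<Longrightarrow> rep d h k l t \<Longrightarrow> g ^ m > h ^ k \<Longrightarrow>
       \<exists>a a' b b' w r. 0 \<le> a \<and> 0 \<le> a' \<and> 0 \<le> b \<and> 0 \<le> b' \<and> 0 \<le> w \<and> 0 \<le> r \<and>
         a + a' = ln (real_of_int g) \<and> b + b' = ln (real_of_int h) \<and>
         \<bar>n * (a + a') - (k * b' + w)\<bar> \<le> C \<and> \<bar>l * (b + b') - (m * a' + w)\<bar> \<le> C \<and>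
         m * a = k * b \<and> real (k div gcd m k) * r \<le> a \<and>
         m * a' \<le> r + a' + b' + (1 / 2000) * (r + a' + b' + w) + C \<and>
         n * (a + a') \<le> r + a' + b' + (1 / 2000) * (r + a' + b' + w) + C \<and> k * b' \<le> m * a'"
  define B where "B = \<lceil>exp (5000 * C)\<rceil>"
  define N where "N = B ^ (nat B + 1) * (B + 1)"
  show thesis
  proof (rule that[of N])
    fix d g m n s h k l t
    assume rg: "rep d g m n s" and rh: "rep d h k l t" and gt: "g ^ m > h ^ k" and dN: "d > N"
      and diag: "m \<noteq> n" "k \<noteq> l"
    have exps: "m \<ge> 1" "n \<ge> 1" "k \<ge> 1" "l \<ge> 1" "g \<ge> 2" "h \<ge> 2" using rg rh by (auto simp: rep_def)
    obtain a a' b b' w r :: real where nn: "0 \<le> a" "0 \<le> a'" "0 \<le> b" "0 \<le> b'" "0 \<le> w" "0 \<le> r"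
      and lns: "a + a' = ln (real_of_int g)" "b + b' = ln (real_of_int h)"
      and cf: "\<bar>n * (a + a') - (k * b' + w)\<bar> \<le> C" "\<bar>l * (b + b') - (m * a' + w)\<bar> \<le> C"
      and cm: "m * a = k * b" "real (k div gcd m k) * r \<le> a"
      and abcs: "m * a' \<le> r + a' + b' + (1 / 2000) * (r + a' + b' + w) + C"
         "n * (a + a') \<le> r + a' + b' + (1 / 2000) * (r + a' + b' + w) + C"
      and ord: "k * b' \<le> m * a'"
      using main[OF rg rh gt] by (elim exE conjE) (rule that)
    define M where "M = r + a' + b' + w"
    define E where "E = M / 2000 + C"
    \<comment> \<open>Otherwise all logarithms of the pieces are bounded by multiples of
      \<open>C\<close>, hence so are both cofactors and, by the previous lemma,
      \<open>d\<close>.\<close>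
    have "M > 2000 * C"
    proof (rule ccontr)
      assume small: "\<not> M > 2000 * C"
      have "n * ln (real_of_int g) \<le> 5000 * C" "l * ln (real_of_int h) \<le> 5000 * C"
      proof -
        define X Y Z where "X = n * (a + a')" and "Y = l * (b + b')" and "Z = m * a'"
        have "Y \<le> Z + w + C" using cf(2)[THEN abs_le_D1] by (simp add: Y_def Z_def)
        moreover have "X \<le> r + a' + b' + M / 2000 + C" "Z \<le> r + a' + b' + M / 2000 + C"
          using abcs unfolding X_def Z_def M_def by simp_all
        ultimately have "X \<le> 5000 * C" "Y \<le> 5000 * C"
          using small nn C M_def by argo+
        then show "n * ln (real_of_int g) \<le> 5000 * C" "l * ln (real_of_int h) \<le> 5000 * C"
          unfolding X_def Y_def lns .
      qed
      then have "ln (real_of_int (g ^ n)) \<le> 5000 * C" "ln (real_of_int (h ^ l)) \<le> 5000 * C"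
        using exps by (auto simp: ln_realpow)
      then have "real_of_int (g ^ n) \<le> exp (5000 * C)" "real_of_int (h ^ l) \<le> exp (5000 * C)"
        using exps by (subst ln_le_cancel_iff[symmetric]; simp)+
      then have "g ^ n \<le> B" "h ^ l \<le> B" unfolding B_def by linarith+
      then show False
        using bounded_cofactors_imp_bounded[OF rg rh] gt dN unfolding N_def by fastforce
    qed
    moreover have "M \<ge> 0" using nn by (simp add: M_def)
    ultimately have E: "C \<le> E" "(1 / 2000) * (r + a' + b' + w) + C = E" "1000 * E < r + a' + b' + w"
      unfolding E_def M_def[symmetric] using C by (simp_all add: field_simps)
    interpret pair_config m n k l a a' b b' w r E
    proof
      show "m * a' \<le> r + a' + b' + E" "n * (a + a') \<le> r + a' + b' + E"
        using abcs unfolding E(2)[symmetric] by (simp_all only: add.assoc)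
    qed (use exps nn cm ord E order_trans[OF _ E(1)] cf in auto)
    show "(n \<ge> 2 \<longrightarrow> (m, n, k, l) = (4, 2, 2, 1) \<or> (m, n, k, l) = (1, 2, 1, 2)) \<and>
       (n = 1 \<longrightarrow> m \<ge> 3 \<longrightarrow> (m, k, l) = (3, 2, 1) \<or> (m = 2 * k \<and> l = 1) \<or> (m = k \<and> l \<le> 2)) \<and>
       (m, n, k, l) \<noteq> (2, 1, 3, 2)"
      using exponents_of_cofactor_ge_2[OF _ diag] exponents_of_cofactor_1[OF _ _ diag(2)] exponents_2_1_3_2 by blast
  qed
qed

section \<open>A Belyi map for four rational points\<close>

lemma power_linear_mod_square:
  fixes a p W :: int
  shows "\<exists>c. (a + p * W) ^ Suc M = a ^ Suc M + int (Suc M) * a ^ M * p * W + W\<^sup>2 * c"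
proof (induction M)
  case 0
  show ?case by (rule exI[of _ 0]) simp
next
  case (Suc M)
  then obtain c where c: "(a + p * W) ^ Suc M = a ^ Suc M + int (Suc M) * a ^ M * p * W + W\<^sup>2 * c" by blast
  have "(a + p * W) ^ Suc (Suc M) = (a + p * W) * (a ^ Suc M + int (Suc M) * a ^ M * p * W + W\<^sup>2 * c)"
    using c by simp
  also have "\<dots> = a ^ Suc (Suc M) + int (Suc (Suc M)) * a ^ Suc M * p * W
      + W\<^sup>2 * (int (Suc M) * a ^ M * p\<^sup>2 + a * c + p * W * c)"
    by (simp add: algebra_simps power2_eq_square)
  finally show ?case by blast
qed

text \<open>The last assumption says that the logarithmic derivative of the product with respect to
  \<open>W\<close> vanishes at \<open>W = 0\<close>, so that the linear term drops out. It is stated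
  without denominators.\<close>

lemma square_dvd_two_factor_power:
  fixes a b p q W :: int
  assumes "M \<ge> 1" "N \<ge> 1" "int M * p * b + int N * q * a = 0"
  shows "W\<^sup>2 dvd (a + p * W) ^ M * (b + q * W) ^ N - a ^ M * b ^ N"
proof -
  obtain M' N' where MN: "M = Suc M'" "N = Suc N'" using assms by (metis Suc_le_D One_nat_def)
  obtain c where c: "(a + p * W) ^ M = a ^ M + int M * a ^ M' * p * W + W\<^sup>2 * c"
    using power_linear_mod_square MN by blast
  obtain e where e: "(b + q * W) ^ N = b ^ N + int N * b ^ N' * q * W + W\<^sup>2 * e"
    using power_linear_mod_square MN by blast
  have "(a + p * W) ^ M * (b + q * W) ^ N - a ^ M * b ^ N =
      W * (a ^ M' * b ^ N') * (int M * p * b + int N * q * a)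
      + W\<^sup>2 * (a ^ M * e + int M * a ^ M' * p * (int N * b ^ N' * q) + int M * a ^ M' * p * W * e + c * (b + q * W) ^ N)"
    unfolding c e unfolding MN by (simp add: algebra_simps power2_eq_square)
  then show ?thesis using assms(3) by simp
qed

text \<open>The exponents \<open>M\<close> and \<open>N\<close> below are chosen such that the polynomial \<open>(v P)\<^sup>M (v Q)\<^sup>N\<close> has a critical
  point at the zero of \<open>W\<close>; they are positive because that zero lies between those of \<open>P\<close> and \<open>Q\<close>.\<close>

lemma belyi_radical_middle:
  fixes p q v p0 q0 v0 :: int and \<delta> :: real
  assumes abc: abc_conjecture and \<delta>: "\<delta> > 0"
    and lead: "p > 0" "q > 0" "v > 0"
    and middle: "(p0 * v - p * v0) * (q0 * v - q * v0) < 0"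
  obtains C :: real and U :: int where "\<And>u. u \<ge> U \<Longrightarrow>
      (2 - \<delta>) * ln (real_of_int u) \<le> ln (rad ((p * u + p0) * (q * u + q0) * (v * u + v0))) + C"
proof -
  \<comment> \<open>The constants in \<open>v * P = a + p * W\<close> and
    \<open>v * Q = b + q * W\<close>; they have opposite signs by assumption, which lets positive
    exponents balance them.\<close>
  define a where "a = p0 * v - p * v0"
  define b where "b = q0 * v - q * v0"
  define M where "M = nat \<bar>q * a\<bar>"
  define N where "N = nat \<bar>p * b\<bar>"
  have nz: "a \<noteq> 0" "b \<noteq> 0" using middle unfolding a_def b_def by auto
  have MN: "M \<ge> 1" "N \<ge> 1" using nz lead by (auto simp: M_def N_def Suc_le_eq)
  have cond: "int M * p * b + int N * q * a = 0"
  proof -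
    have "int M = q * \<bar>a\<bar>" "int N = p * \<bar>b\<bar>" using lead by (auto simp: M_def N_def abs_mult)
    then have "int M * p * b + int N * q * a = p * q * (\<bar>a\<bar> * b + \<bar>b\<bar> * a)" by (simp add: algebra_simps)
    moreover have "\<bar>a\<bar> * b + \<bar>b\<bar> * a = 0"
      using middle unfolding a_def[symmetric] b_def[symmetric] by (auto simp: mult_less_0_iff abs_if)
    ultimately show ?thesis by simp
  qed
  define c where "c = a ^ M * b ^ N"
  have "c \<noteq> 0" using nz by (simp add: c_def)
  \<comment> \<open>\<open>A\<close> below is at most a constant times \<open>u ^ (M + N)\<close>,
    so this choice turns \<open>\<epsilon> * ln A\<close> into \<open>\<delta> * ln u\<close> plus a
    constant.\<close>
  define \<epsilon> where "\<epsilon> = \<delta> / (M + N)"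
  have \<epsilon>: "\<epsilon> > 0" using \<delta> MN by (simp add: \<epsilon>_def)
  obtain K where K: "K \<ge> 0" "\<And>A B C :: int. A + B = C \<Longrightarrow> A \<noteq> 0 \<Longrightarrow> C \<noteq> 0 \<Longrightarrow>
       ln \<bar>real_of_int A\<bar> \<le> (1 + \<epsilon>) * (ln (rad (A * B)) + ln \<bar>real_of_int C\<bar>) + K"
    using abc_log[OF abc \<epsilon>] by metis
  \<comment> \<open>Beyond this bound each of the three linear forms is at least
    \<open>u / 2\<close>, and \<open>A\<close> exceeds \<open>\<bar>c\<bar>\<close>.\<close>
  define U where "U = 2 * (\<bar>p0\<bar> + \<bar>q0\<bar> + \<bar>v0\<bar> + \<bar>c\<bar>) + 4"
  define H where "H = v * (p + \<bar>p0\<bar>) + v * (q + \<bar>q0\<bar>)"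
  have "H \<ge> 1" using lead unfolding H_def by (smt (verit) mult_pos_pos)
  define C1 where "C1 = ln (real_of_int v) + ln 2 + ln \<bar>real_of_int c\<bar> + K"
  define C2 where "C2 = \<epsilon> * ((M + N) * ln (real_of_int H))"
  define C where "C = C1 + C2 + 2 * ln 2"
  have "(2 - \<delta>) * ln (real_of_int u) \<le> ln (rad ((p * u + p0) * (q * u + q0) * (v * u + v0))) + C"
    if u: "u \<ge> U" for u
  proof -
    define P Q W where "P = p * u + p0" and "Q = q * u + q0" and "W = v * u + v0"
    have u4: "u \<ge> 4" using u by (simp add: U_def)
    have big: "2 * (x * u + x0) \<ge> u" "x * u + x0 \<ge> 1" if "x > 0" "\<bar>x0\<bar> \<le> \<bar>p0\<bar> + \<bar>q0\<bar> + \<bar>v0\<bar>" for x x0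
    proof -
      define y where "y = x * u"
      have "y \<ge> u" unfolding y_def using that u4 mult_right_mono[of 1 x u] by simp
      moreover define S where "S = \<bar>p0\<bar> + \<bar>q0\<bar> + \<bar>v0\<bar>"
      have "u \<ge> 2 * S + 4" using u unfolding U_def S_def by simp
      moreover have "x0 \<ge> - S" using that(2) unfolding S_def by (simp add: abs_le_iff)
      ultimately show "2 * (x * u + x0) \<ge> u" "x * u + x0 \<ge> 1" using u4 unfolding y_def[symmetric] by (simp_all only: distrib_left)
    qed
    have P: "2 * P \<ge> u" "P \<ge> 1" and Q: "2 * Q \<ge> u" "Q \<ge> 1" and W: "2 * W \<ge> u" "W \<ge> 1"
      unfolding P_def Q_def W_def using big lead by auto
    have vP: "v * P = a + p * W" and vQ: "v * Q = b + q * W"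
      by (simp_all add: P_def Q_def W_def a_def b_def algebra_simps)
    define A where "A = (v * P) ^ M * (v * Q) ^ N"
    have A_ge: "2 * A \<ge> u"
    proof -
      have "v * P \<ge> P" "v * Q \<ge> 1" using lead P Q mult_right_mono[of 1 v P] mult_mono[of 1 v 1 Q] by auto
      then have "(v * P) ^ M \<ge> P" using self_le_power[of "v * P" M] P MN by linarith
      moreover have "(v * Q) ^ N \<ge> 1" using \<open>v * Q \<ge> 1\<close> by simp
      ultimately have "A \<ge> P * 1" unfolding A_def using P by (intro mult_mono) auto
      then show ?thesis using P by simp
    qed
    have "u \<ge> 2 * \<bar>c\<bar> + 4" using u unfolding U_def by simp
    then have Ac: "A > \<bar>c\<bar>" "A \<ge> 1" using A_ge by linarith+
    have "W\<^sup>2 dvd A - c"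
      unfolding A_def c_def vP vQ by (rule square_dvd_two_factor_power[OF MN cond])
    then obtain R where R: "A - c = W\<^sup>2 * R" by blast
    have "R \<noteq> 0" using R Ac by auto
    define L where "L = ln (real_of_int (rad (P * Q * W)))"
    \<comment> \<open>The abc conjecture for \<open>A - (A - c) = c\<close>. The radical of
      \<open>A\<close> divides that of \<open>v * P * Q\<close>, and \<open>A - c\<close> costs only
      \<open>rad W\<close> and \<open>R\<close>, where \<open>R\<close> is of size
      \<open>A / W^2\<close>. So \<open>ln A\<close> nearly cancels and \<open>2 * ln W\<close> is
      left against the radical.\<close>
    have "ln \<bar>real_of_int A\<bar> \<le> (1 + \<epsilon>) * (ln (rad (A * (- (A - c)))) + ln \<bar>real_of_int c\<bar>) + K"
      by (rule K(2)) (use Ac \<open>c \<noteq> 0\<close> in auto)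
    moreover have "ln (rad (A * (- (A - c)))) \<le> ln (real_of_int v) + L + (ln 2 + ln (real_of_int A) - 2 * ln (real_of_int W))"
    proof -
      have "A * (A - c) dvd (v * (P * Q * W)) ^ (M + N + 2) * R"
      proof -
        have "(v * P) ^ M dvd (v * (P * Q * W)) ^ M" "(v * Q) ^ N dvd (v * (P * Q * W)) ^ N"
          "W\<^sup>2 dvd (v * (P * Q * W))\<^sup>2"
          by (auto intro!: dvd_power_same)
        then have "(v * P) ^ M * (v * Q) ^ N * W\<^sup>2 dvd (v * (P * Q * W)) ^ M * (v * (P * Q * W)) ^ N * (v * (P * Q * W))\<^sup>2"
          by (intro mult_dvd_mono)
        then have "A * W\<^sup>2 * R dvd (v * (P * Q * W)) ^ (M + N + 2) * R"
          unfolding A_def power_add by (rule mult_dvd_mono) simp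
        then show ?thesis unfolding R by (simp add: mult.assoc)
      qed
      then have "rad (A * (A - c)) \<le> rad ((v * (P * Q * W)) ^ (M + N + 2) * R)"
        using \<open>R \<noteq> 0\<close> lead P Q W by (intro rad_dvd_mono) auto
      then have "ln (real_of_int (rad (A * (A - c)))) \<le> ln (rad ((v * (P * Q * W)) ^ (M + N + 2) * R))"
        using rad_ge_1[of "A * (A - c)"] by simp
      also have "\<dots> \<le> ln (rad (v * (P * Q * W))) + ln \<bar>real_of_int R\<bar>"
        using ln_rad_mult_le[of "(v * (P * Q * W)) ^ (M + N + 2)" R] ln_rad_power_le[of "v * (P * Q * W)" "M + N + 2"]
          ln_rad_le[OF \<open>R \<noteq> 0\<close>] by linarith
      also have "ln (rad (v * (P * Q * W))) \<le> ln (real_of_int v) + L"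
        using ln_rad_mult_le[of v "P * Q * W"] ln_rad_le[of v] lead unfolding L_def by simp
      also have "ln \<bar>real_of_int R\<bar> \<le> ln 2 + ln (real_of_int A) - 2 * ln (real_of_int W)"
      proof -
        have "W\<^sup>2 * \<bar>R\<bar> = \<bar>A - c\<bar>" unfolding R by (simp add: abs_mult)
        also have "\<dots> \<le> 2 * A" using Ac by linarith
        finally have "real_of_int (W\<^sup>2 * \<bar>R\<bar>) \<le> real_of_int (2 * A)" by (rule of_int_le_iff[THEN iffD2])
        then have "ln (real_of_int W ^ 2 * \<bar>real_of_int R\<bar>) \<le> ln (2 * real_of_int A)"
          using W Ac \<open>R \<noteq> 0\<close> by (subst ln_le_cancel_iff) auto
        then show ?thesis using W Ac \<open>R \<noteq> 0\<close> by (simp add: ln_mult_pos ln_realpow)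
      qed
      finally show ?thesis unfolding mult_minus_right rad_minus by simp
    qed
    ultimately have "ln (real_of_int A) \<le> (1 + \<epsilon>) * (ln (real_of_int v) + L + (ln 2 + ln (real_of_int A) - 2 * ln (real_of_int W)) + ln \<bar>real_of_int c\<bar>) + K"
      using \<epsilon> Ac by (smt (verit) mult_left_mono of_int_1_le_iff)
    then have "(1 + \<epsilon>) * (2 * ln (real_of_int W)) \<le> (1 + \<epsilon>) * (L + C1 - K) + \<epsilon> * ln (real_of_int A) + K"
      by (simp add: C1_def algebra_simps)
    also have "\<dots> \<le> (1 + \<epsilon>) * (L + C1 + \<epsilon> * ln (real_of_int A))"
    proof -
      have "0 \<le> \<epsilon> * K" "0 \<le> \<epsilon> * (\<epsilon> * ln (real_of_int A))" using \<epsilon> K Ac by auto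
      then show ?thesis by (simp add: algebra_simps)
    qed
    finally have 1: "2 * ln (real_of_int W) \<le> L + C1 + \<epsilon> * ln (real_of_int A)"
      using \<epsilon> by (simp add: mult_le_cancel_left)
    have "ln (real_of_int A) \<le> (M + N) * (ln (real_of_int H) + ln (real_of_int u))"
    proof -
      have x: "v * (x * u + x0) \<le> v * (x + \<bar>x0\<bar>) * u" if "x > 0" for x x0
      proof -
        have "x0 \<le> \<bar>x0\<bar> * u" using u4 mult_left_mono[of 1 u "\<bar>x0\<bar>"] by linarith
        then have "x * u + x0 \<le> (x + \<bar>x0\<bar>) * u" by (simp add: algebra_simps)
        then show ?thesis using lead by (simp add: mult.assoc)
      qed
      have H: "v * (p + \<bar>p0\<bar>) \<le> H" "v * (q + \<bar>q0\<bar>) \<le> H" using lead by (auto simp: H_def)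
      have "v * P \<le> H * u" "v * Q \<le> H * u"
        using x[of p p0] x[of q q0] lead mult_right_mono[OF H(1), of u] mult_right_mono[OF H(2), of u] u4
        unfolding P_def Q_def by linarith+
      then have "(v * P) ^ M \<le> (H * u) ^ M" "(v * Q) ^ N \<le> (H * u) ^ N"
        using lead P Q by (auto intro!: power_mono simp del: power_mult_distrib mult_le_cancel_left)
      then have "A \<le> (H * u) ^ M * (H * u) ^ N"
        unfolding A_def by (rule mult_mono) (use lead Q \<open>H \<ge> 1\<close> u4 in auto)
      then have "A \<le> (H * u) ^ (M + N)" by (simp add: power_add)
      then have "real_of_int A \<le> real_of_int ((H * u) ^ (M + N))" by (rule of_int_le_iff[THEN iffD2])
      then have "ln (real_of_int A) \<le> ln (real_of_int ((H * u) ^ (M + N)))"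
        using Ac by (subst ln_le_cancel_iff) auto
      then show ?thesis using \<open>H \<ge> 1\<close> u4 by (simp add: ln_realpow ln_mult_pos)
    qed
    then have "\<epsilon> * ln (real_of_int A) \<le> \<epsilon> * ((M + N) * (ln (real_of_int H) + ln (real_of_int u)))"
      using \<epsilon> by (intro mult_left_mono) auto
    also have "\<dots> = C2 + \<delta> * ln (real_of_int u)"
    proof -
      have "\<epsilon> * (M + N) = \<delta>" using MN by (simp add: \<epsilon>_def)
      then show ?thesis unfolding C2_def by (simp only: distrib_left mult.assoc[symmetric])
    qed
    finally have 2: "\<epsilon> * ln (real_of_int A) \<le> C2 + \<delta> * ln (real_of_int u)" .
    have 3: "ln (real_of_int u) \<le> ln 2 + ln (real_of_int W)"
    proof -
      have "real_of_int u \<le> 2 * real_of_int W" using W by linarith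
      then have "ln (real_of_int u) \<le> ln (2 * real_of_int W)" using u4 W by (subst ln_le_cancel_iff) auto
      then show ?thesis using W by (simp add: ln_mult_pos)
    qed
    have "2 * ln (real_of_int u) \<le> L + C + \<delta> * ln (real_of_int u)"
      using 1 2 3 unfolding C_def by argo
    then show ?thesis unfolding L_def P_def Q_def W_def by (simp add: algebra_simps)
  qed
  then show ?thesis using that by blast
qed

text \<open>One of three distinct zeros lies between the other two, and it plays the role of
  \<open>W\<close> in the previous lemma. The exponent 2 is the number of branch points, infinity
  included, minus 2.\<close>

lemma belyi_radical:
  fixes p q v p0 q0 v0 :: int and \<delta> :: real
  assumes abc: abc_conjecture and \<delta>: "\<delta> > 0"
    and lead: "p > 0" "q > 0" "v > 0"
    and distinct: "p0 * v - p * v0 \<noteq> 0" "q0 * v - q * v0 \<noteq> 0" "p0 * q - p * q0 \<noteq> 0"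
  obtains C :: real and U :: int where "\<And>u. u \<ge> U \<Longrightarrow>
      (2 - \<delta>) * ln (real_of_int u) \<le> ln (rad ((p * u + p0) * (q * u + q0) * (v * u + v0))) + C"
proof -
  consider "(p0 * v - p * v0) * (q0 * v - q * v0) < 0"
    | "(v0 * p - v * p0) * (q0 * p - q * p0) < 0" | "(p0 * q - p * q0) * (v0 * q - v * q0) < 0"
  proof -
    have "p0 * v < p * v0 \<or> p0 * v > p * v0" "q0 * v < q * v0 \<or> q0 * v > q * v0" "p0 * q < p * q0 \<or> p0 * q > p * q0"
      using distinct by linarith+
    then show ?thesis using that by (auto simp: mult_less_0_iff mult.commute)
  qed
  then show ?thesis
  proof cases
    case 1
    show ?thesis using belyi_radical_middle[OF abc \<delta> lead 1] that by blast
  next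
    case 2
    obtain C U where "\<And>u. u \<ge> U \<Longrightarrow>
      (2 - \<delta>) * ln (real_of_int u) \<le> ln (rad ((v * u + v0) * (q * u + q0) * (p * u + p0))) + C"
      using belyi_radical_middle[OF abc \<delta> lead(3,2,1) 2] by blast
    then show ?thesis using that[of U C] by (simp add: mult_ac)
  next
    case 3
    obtain C U where "\<And>u. u \<ge> U \<Longrightarrow>
      (2 - \<delta>) * ln (real_of_int u) \<le> ln (rad ((p * u + p0) * (v * u + v0) * (q * u + q0))) + C"
      using belyi_radical_middle[OF abc \<delta> lead(1,3,2) 3] by blast
    then show ?thesis using that[of U C] by (simp add: mult_ac)
  qed
qed

section \<open>Products of consecutive integers\<close>

text \<open>After division by the gcd, \<open>k'\<close> and \<open>l'\<close> divide a power of
  \<open>k' + l'\<close> but are coprime to it, so both are 1. This separates two branch points in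
  the next lemma.\<close>

lemma exponents_eq_if_critical_values_eq:
  fixes k l :: nat
  assumes "k \<ge> 1" "l \<ge> 1" and eq: "(k + l) ^ (k + l) = 4 ^ l * k ^ k * l ^ l"
  shows "k = l"
proof -
  define g where "g = gcd k l"
  have "g > 0" using assms by (simp add: g_def)
  obtain k' l' where kl: "k = k' * g" "l = l' * g" and cop: "coprime k' l'"
    using gcd_coprime_exists[of k l] \<open>g > 0\<close> unfolding g_def by (metis less_irrefl)
  have "g ^ (k + l) * (k' + l') ^ (k + l) = g ^ (k + l) * (4 ^ l * k' ^ k * l' ^ l)"
  proof -
    have "(k + l) ^ (k + l) = ((k' + l') * g) ^ (k + l)" by (simp add: kl algebra_simps)
    moreover have "4 ^ l * k ^ k * l ^ l = 4 ^ l * (k' * g) ^ k * (l' * g) ^ l" using kl by simp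
    ultimately show ?thesis using eq by (simp add: power_mult_distrib power_add mult_ac)
  qed
  then have e: "(k' + l') ^ (k + l) = 4 ^ l * k' ^ k * l' ^ l" using \<open>g > 0\<close> by simp
  have one: "x = 1" if "x dvd (k' + l') ^ (k + l)" "coprime x (k' + l')" for x
    using that by (metis coprime_power_right_iff coprime_absorb_left nat_dvd_1_iff_1)
  have "k' dvd (k' + l') ^ (k + l)" "l' dvd (k' + l') ^ (k + l)"
    unfolding e using assms(1,2) by (simp_all add: dvd_mult dvd_mult2 dvd_power)
  moreover have "coprime k' (k' + l')" "coprime l' (k' + l')"
    using cop gcd_add2[of k' l'] gcd_add2[of l' k']
    by (simp_all add: coprime_iff_gcd_eq_1 gcd.commute add.commute)
  ultimately have "k' = 1" "l' = 1" using one by blast+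
  then show ?thesis using kl by simp
qed

text \<open>With \<open>u = d\<^sup>l\<close> and \<open>y = h\<^sup>l\<close> we have \<open>u = y\<^sup>k (y + t)\<^sup>l\<close>, whose nonzero critical value is \<open>c0 / x\<^sup>x\<close>; it is taken
  to second order at \<open>x y + k t = 0\<close>. Likewise \<open>4 d + 1\<close> is a square.\<close>

lemma diagonal_pair_bounded_fixed_exponents:
  fixes k l :: nat and t :: int
  assumes abc: abc_conjecture and kl: "k \<ge> 1" "l \<ge> 1" "k \<noteq> l" and t: "\<bar>t\<bar> = 1"
  obtains N :: int where "\<And>G h. G \<ge> 1 \<Longrightarrow> rep (G * (G + 1)) h k l t \<Longrightarrow> G * (G + 1) \<le> N"
proof -
  define x where "x = k + l"
  have x: "x \<ge> 3" "x > k" using kl by (auto simp: x_def)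
  define c0 where "c0 = (- (int k * t)) ^ k * (int l * t) ^ l"
  have abs_c0: "\<bar>c0\<bar> = int (k ^ k * l ^ l)"
    using t by (simp add: c0_def abs_mult power_abs)
  \<comment> \<open>The loss \<open>\<delta> * (l * D)\<close> becomes \<open>D / 16\<close>, well
    below the saving \<open>D / 2\<close> obtained from \<open>4 * d + 1\<close> being a
    square.\<close>
  define \<delta> :: real where "\<delta> = 1 / (16 * l)"
  have \<delta>: "\<delta> > 0" "\<delta> * l = 1 / 16" using kl by (auto simp: \<delta>_def)
  \<comment> \<open>\<open>d1\<close>, \<open>d2\<close> and \<open>d3\<close> say that the finite
    branch points \<open>0\<close>, \<open>(- 1 / 4) ^ l\<close> and \<open>c0 / x ^ x\<close> are
    distinct.\<close>
  have d1: "0 * int x ^ x - 1 * (- c0) \<noteq> 0" using abs_c0 kl by auto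
  have d2: "(- ((- 1) ^ l)) * int x ^ x - 4 ^ l * (- c0) \<noteq> 0"
  proof
    assume "(- ((- 1) ^ l)) * int x ^ x - 4 ^ l * (- c0) = 0"
    then have "\<bar>(- 1) ^ l * int x ^ x\<bar> = \<bar>4 ^ l * c0\<bar>" by (simp add: algebra_simps)
    then have "int (x ^ x) = int (4 ^ l * (k ^ k * l ^ l))" by (simp add: abs_mult power_abs abs_c0)
    then have "x ^ x = 4 ^ l * k ^ k * l ^ l" by (metis mult.assoc of_nat_eq_iff)
    then show False using exponents_eq_if_critical_values_eq[of k l] kl by (simp add: x_def)
  qed
  have d3: "(0::int) * 4 ^ l - 1 * (- ((- 1) ^ l)) \<noteq> 0" by simp
  have lead: "(0::int) < 4 ^ l" "0 < int x ^ x" using x by auto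
  obtain C U where bel: "\<And>u. u \<ge> U \<Longrightarrow>
      (2 - \<delta>) * ln (real_of_int u) \<le> ln (rad ((1 * u + 0) * (4 ^ l * u + - ((- 1) ^ l)) * (int x ^ x * u + - c0))) + C"
    using belyi_radical[OF abc \<delta>(1) _ _ _ d1 d2 d3, OF zero_less_one lead] by blast
  define C' where "C' = ln 2 + ln (2 * 4 ^ l) + ln (2 * real x ^ x) + \<bar>C\<bar> + 2"
  define N where "N = max (max \<bar>U\<bar> \<bar>c0\<bar>) (2 * \<lceil>exp (4 * C')\<rceil> ^ x)"
  have "G * (G + 1) \<le> N" if G: "G \<ge> 1" and rep: "rep (G * (G + 1)) h k l t" for G h
  proof (rule ccontr)
    assume neg: "\<not> G * (G + 1) \<le> N"
    define d where "d = G * (G + 1)"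
    have h: "h \<ge> 2" and d: "d = h ^ k * (h ^ l + t)" using rep by (auto simp: rep_def d_def)
    have dN: "d > \<bar>U\<bar>" "d > \<bar>c0\<bar>" using neg by (auto simp: N_def d_def)
    then have "d \<ge> 1" by linarith
    define u where "u = d ^ l"
    have "u \<ge> d" unfolding u_def using \<open>d \<ge> 1\<close> kl by (intro self_le_power) auto
    define L D where "L = ln (real_of_int h)" and "D = ln (real_of_int d)"
    have "L \<ge> 0" "D \<ge> 0" using h \<open>d \<ge> 1\<close> by (auto simp: L_def D_def)
    have lu: "ln (real_of_int u) = l * D" using \<open>d \<ge> 1\<close> by (simp add: u_def D_def ln_realpow)
    have hl: "h ^ l \<ge> 2" using self_le_power[of h l] h kl by linarith
    have Dx: "x * L - ln 2 \<le> D" "D \<le> x * L + ln 2"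
    proof -
      have "D = k * L + ln (real_of_int (h ^ l + t))"
        unfolding D_def d L_def using rep_cofactor(1)[OF rep] h by (simp add: ln_mult_pos ln_realpow del: of_int_add)
      then show "x * L - ln 2 \<le> D" "D \<le> x * L + ln 2"
        using rep_cofactor(3)[OF rep] unfolding x_def L_def by (auto simp: algebra_simps abs_le_iff)
    qed
    \<comment> \<open>\<open>u\<close> is a power of \<open>d\<close>, so its radical is at most
      \<open>h * (h ^ l + t)\<close>.\<close>
    have rad_u: "ln (real_of_int (rad u)) \<le> (l + 1) * L + ln 2"
    proof -
      have "ln (real_of_int (rad u)) \<le> ln (rad (h ^ k * (h ^ l + t)))"
        using ln_rad_power_le[of d l] by (simp add: u_def d)
      also have "\<dots> \<le> ln (rad (h ^ k)) + ln (rad (h ^ l + t))" by (rule ln_rad_mult_le)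
      also have "ln (rad (h ^ k)) \<le> L" using ln_rad_power_le[of h k] ln_rad_le[of h] h by (simp add: L_def)
      also have "ln (rad (h ^ l + t)) \<le> ln \<bar>real_of_int (h ^ l + t)\<bar>"
        using rep_cofactor(1)[OF rep] by (intro ln_rad_le) auto
      also have "\<bar>real_of_int (h ^ l + t)\<bar> = real_of_int (h ^ l + t)" using rep_cofactor(1)[OF rep] by linarith
      also have "ln (real_of_int (h ^ l + t)) \<le> l * L + ln 2"
        using rep_cofactor(3)[OF rep] by (simp add: L_def abs_le_iff)
      finally show ?thesis by (simp add: algebra_simps)
    qed
    define Q where "Q = 4 ^ l * u + - ((- 1) ^ l)"
    have u4: "u \<ge> 1" "4 ^ l * u \<ge> 4"
    proof -
      show "u \<ge> 1" using \<open>u \<ge> d\<close> \<open>d \<ge> 1\<close> by linarith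
      have "(4::int) ^ l \<ge> 4" using self_le_power[of "4::int" l] kl by simp
      then show "4 ^ l * u \<ge> 4" using \<open>u \<ge> 1\<close> mult_mono[of 4 "4 ^ l" 1 u] by simp
    qed
    have m1: "\<bar>(- 1 :: int) ^ l\<bar> = 1" by (simp add: power_abs)
    have Q: "Q \<ge> 1" "Q \<le> 2 * (4 ^ l * u)" using u4 m1 unfolding Q_def by linarith+
    \<comment> \<open>\<open>Q = (4 * d) ^ l - (- 1) ^ l\<close> is divisible by
      \<open>4 * d + 1\<close>, the square of \<open>z = 2 * G + 1\<close>; this saves
      \<open>ln z\<close>, which is at least \<open>D / 2\<close>.\<close>
    have rad_Q: "ln (real_of_int (rad Q)) \<le> ln (2 * 4 ^ l) + l * D - D / 2"
    proof -
      define z where "z = 2 * G + 1"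
      have z2: "z\<^sup>2 = 4 * d + 1" by (simp add: z_def d_def power2_eq_square algebra_simps)
      have "(4 * d - (- 1)) dvd (4 * d) ^ l - (- 1) ^ l" by (metis power_diff_sumr2 dvd_triv_left)
      then have "z\<^sup>2 dvd Q" unfolding z2 Q_def u_def by (simp add: power_mult_distrib)
      then have "\<bar>z\<bar> * rad Q \<le> \<bar>Q\<bar>" using Q by (intro rad_le_of_square_dvd) auto
      then have "z * rad Q \<le> 2 * (4 ^ l * u)" using Q G by (simp add: z_def)
      then have "real_of_int (z * rad Q) \<le> real_of_int (2 * (4 ^ l * u))" by (rule of_int_le_iff[THEN iffD2])
      then have "ln (real_of_int z * rad Q) \<le> ln (2 * 4 ^ l * real_of_int u)"
        using G rad_ge_1[of Q] u4 by (subst ln_le_cancel_iff) (auto simp: z_def)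
      then have "ln (real_of_int z) + ln (rad Q) \<le> ln (2 * 4 ^ l) + l * D"
        using G rad_ge_1[of Q] u4 by (subst (asm) (1 2) ln_mult_pos) (auto simp: z_def lu)
      moreover have "D \<le> 2 * ln (real_of_int z)"
      proof -
        have "d \<le> z\<^sup>2" using z2 \<open>d \<ge> 1\<close> by linarith
        then have "real_of_int d \<le> real_of_int (z\<^sup>2)" by (rule of_int_le_iff[THEN iffD2])
        then have "D \<le> ln (real_of_int (z\<^sup>2))" unfolding D_def using \<open>d \<ge> 1\<close> G
          by (subst ln_le_cancel_iff) (auto simp: z_def)
        then show ?thesis using G by (simp add: ln_realpow z_def)
      qed
      ultimately show ?thesis by linarith
    qed
    define W where "W = int x ^ x * u + - c0"
    have xu: "int x ^ x * u \<ge> u" using x u4 mult_right_mono[of 1 "int x ^ x" u] by simp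
    have W: "W \<ge> 1" "W \<le> 2 * (int x ^ x * u)" using xu \<open>u \<ge> d\<close> dN unfolding W_def by linarith+
    \<comment> \<open>\<open>W\<close> is divisible by the square of \<open>v\<close>, the linear
      form in \<open>y\<close> that vanishes at the critical point. As \<open>v \<ge> y\<close>,
      this saves at least \<open>ln y = l * L\<close>.\<close>
    have rad_W: "ln (real_of_int (rad W)) \<le> ln (2 * real x ^ x) + l * D - l * L"
    proof -
      define y v where "y = h ^ l" and "v = int x * y + int k * t"
      have "y \<ge> 2" using hl by (simp add: y_def)
      have "v \<ge> y"
      proof -
        have "int (x - 1) * y \<ge> int k * 1" using x \<open>y \<ge> 2\<close> by (intro mult_mono) auto
        moreover have "int (x - 1) * y = int x * y - y" using x by (simp add: algebra_simps of_nat_diff)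
        moreover have "int k * t \<ge> - int k" using t by (cases "t = 1") (auto simp: abs_if split: if_splits)
        ultimately show ?thesis unfolding v_def by linarith
      qed
      have "v\<^sup>2 dvd (- (int k * t) + 1 * v) ^ k * (int l * t + 1 * v) ^ l - (- (int k * t)) ^ k * (int l * t) ^ l"
        by (rule square_dvd_two_factor_power) (use kl in auto)
      also have "- (int k * t) + 1 * v = int x * y" by (simp add: v_def)
      also have "int l * t + 1 * v = int x * (y + t)" by (simp add: v_def x_def algebra_simps)
      also have "(int x * y) ^ k * (int x * (y + t)) ^ l = int x ^ x * u"
        unfolding u_def d y_def x_def power_mult_distrib power_add by (simp add: mult_ac flip: power_mult)
      finally have "v\<^sup>2 dvd W" by (simp add: W_def c0_def)
      then have "\<bar>v\<bar> * rad W \<le> \<bar>W\<bar>" using W by (intro rad_le_of_square_dvd) auto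
      then have "v * rad W \<le> 2 * (int x ^ x * u)" using W \<open>v \<ge> y\<close> \<open>y \<ge> 2\<close> by simp
      moreover have "y * rad W \<le> v * rad W" using \<open>v \<ge> y\<close> rad_ge_1[of W] by (intro mult_right_mono) auto
      ultimately have "y * rad W \<le> 2 * (int x ^ x * u)" by linarith
      then have "real_of_int (y * rad W) \<le> real_of_int (2 * (int x ^ x * u))" by (rule of_int_le_iff[THEN iffD2])
      then have "ln (real_of_int y * rad W) \<le> ln (2 * real x ^ x * real_of_int u)"
        using \<open>y \<ge> 2\<close> rad_ge_1[of W] u4 x by (subst ln_le_cancel_iff) auto
      then have "ln (real_of_int y) + ln (rad W) \<le> ln (2 * real x ^ x) + l * D"
        using \<open>y \<ge> 2\<close> rad_ge_1[of W] u4 x by (subst (asm) (1 2) ln_mult_pos) (auto simp: lu)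
      moreover have "ln (real_of_int y) = l * L" using h by (simp add: y_def L_def ln_realpow)
      ultimately show ?thesis by linarith
    qed
    have "(2 - \<delta>) * (l * D) \<le> ln (rad (u * Q * W)) + C"
      using bel[of u] \<open>u \<ge> d\<close> dN unfolding lu Q_def W_def by simp
    also have "ln (rad (u * Q * W)) \<le> ln (rad u) + ln (rad Q) + ln (rad W)"
      using ln_rad_mult_le[of "u * Q" W] ln_rad_mult_le[of u Q] by linarith
    \<comment> \<open>The saving \<open>l * L\<close> reduces the \<open>(l + 1) * L\<close> from
      \<open>rad u\<close> to \<open>L\<close>. What remains is \<open>7 / 16 * D \<le> L\<close> up
      to constants, while \<open>D\<close> is about \<open>x * L \<ge> 3 * L\<close>; hence
      \<open>h\<close> is bounded, and so is \<open>d\<close>.\<close>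
    finally have "(2 - \<delta>) * (l * D) \<le> L + 2 * (l * D) - D / 2 + (C' - 2)"
      using rad_u rad_Q rad_W unfolding C'_def by (simp add: algebra_simps)
    moreover have "(2 - \<delta>) * (l * D) = 2 * (l * D) - D / 16"
      using \<delta>(2) by (simp add: left_diff_distrib mult.assoc[symmetric])
    ultimately have "7 / 16 * D \<le> L + C' - 2" by linarith
    moreover have "x * L \<ge> 3 * L" using x \<open>L \<ge> 0\<close> by (intro mult_right_mono) auto
    moreover have "ln 2 \<le> (1::real)" using ln_le_minus_one[of "2::real"] by simp
    ultimately have "L \<le> 4 * C'" using Dx(1) \<open>L \<ge> 0\<close> by linarith
    then have "real_of_int h \<le> exp (4 * C')" using h unfolding L_def by (metis exp_le_cancel_iff exp_ln of_int_0_less_iff order_less_le_trans zero_less_numeral)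
    then have hC: "h \<le> \<lceil>exp (4 * C')\<rceil>" by linarith
    have "d \<le> h ^ k * (2 * h ^ l)" unfolding d using hl t h by (intro mult_left_mono) auto
    also have "\<dots> = 2 * h ^ x" by (simp add: x_def power_add)
    also have "\<dots> \<le> 2 * \<lceil>exp (4 * C')\<rceil> ^ x" using hC h by (intro mult_left_mono power_mono) auto
    finally show False using neg by (simp add: N_def d_def)
  qed
  then show ?thesis using that by blast
qed

text \<open>\<open>G\<close> and \<open>G + 1\<close> are coprime, so \<open>h\<close> splits into a
  divisor of each, and the powers of the two parts cannot spread over both factors.\<close>

lemma consecutive_factorization:
  fixes G h :: int
  assumes "h \<ge> 1" "k \<ge> 1" and dv: "h ^ k dvd G * (G + 1)"
  obtains a b u v :: int where "a \<ge> 1" "b \<ge> 1" "h = a * b" "G = a ^ k * u" "G + 1 = b ^ k * v"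
proof -
  have "h dvd G * (G + 1)" using dv assms(2) by (meson dvd_power dvd_trans less_le_trans zero_less_one)
  then obtain a b where ab: "h = a * b" "a dvd G" "b dvd G + 1" using division_decomp by blast
  have cop: "coprime G (G + 1)" by simp
  have "a ^ k dvd G * (G + 1)" "b ^ k dvd G * (G + 1)"
    using dv ab by (metis dvd_mult_left dvd_mult_right power_mult_distrib)+
  moreover have "coprime (a ^ k) (G + 1)" "coprime (b ^ k) G"
    using ab cop by (meson coprime_commute coprime_divisors coprime_power_left_iff dvd_refl)+
  ultimately have "a ^ k dvd G" "b ^ k dvd G + 1"
    by (simp_all add: coprime_dvd_mult_left_iff coprime_dvd_mult_right_iff)
  then have "\<bar>a\<bar> ^ k dvd G" "\<bar>b\<bar> ^ k dvd G + 1" by (simp_all flip: power_abs)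
  then obtain u v where "G = \<bar>a\<bar> ^ k * u" "G + 1 = \<bar>b\<bar> ^ k * v" by (meson dvdE)
  moreover have "h = \<bar>a\<bar> * \<bar>b\<bar>" using ab assms(1) by (metis abs_mult abs_of_pos int_one_le_iff_zero_less)
  moreover have "\<bar>a\<bar> \<ge> 1" "\<bar>b\<bar> \<ge> 1" using ab assms(1) by (auto simp: int_one_le_iff_zero_less)
  ultimately show ?thesis using that by blast
qed

text \<open>A pair of consecutive integers whose product is \<open>h\<^sup>k (h\<^sup>l + t)\<close> yields a binary quadratic form
  representing \<open>1\<close> at a pair of high powers; completing the square in both variables gives two
  equations to which the \<open>abc\<close> conjecture applies.\<close>

lemma quadratic_form_cofactor_larger:
  fixes a b u v G h t :: int
  assumes t: "t * t = 1" and h: "h = a * b" "h \<noteq> 0"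
    and G: "G = a ^ k * u" "G + 1 = b ^ k * v" and eq: "G * (G + 1) = h ^ k * (h ^ (k + e) + t)"
  obtains X Y c1 c2 :: int where "c1 * c2 = h ^ e - 1"
    "X\<^sup>2 = h ^ e * (a ^ k)\<^sup>2 + c2" "Y\<^sup>2 = h ^ e * (b ^ k)\<^sup>2 - c1" "(X * Y)\<^sup>2 = (h ^ (k + e) + t)\<^sup>2"
proof -
  define A B where "A = a ^ k" and "B = b ^ k"
  have hk: "h ^ k = A * B" "h ^ k \<noteq> 0" using h by (auto simp: A_def B_def power_mult_distrib)
  define H where "H = h ^ e"
  have "h ^ k * (u * v) = h ^ k * (h ^ (k + e) + t)"
    using eq unfolding G(2) unfolding G(1) hk A_def B_def by (simp add: mult_ac)
  then have uv: "u * v = A * B * H + t" using hk by (simp add: power_add H_def)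
  have one: "B * v = A * u + 1" using G by (simp add: A_def B_def)
  \<comment> \<open>Multiplying \<open>B * v = A * u + 1\<close> by \<open>u\<close> or
    \<open>v\<close> and inserting the value of \<open>u * v\<close> shows that \<open>A\<close>
    divides \<open>u - t * B\<close> and \<open>B\<close> divides \<open>v + t * A\<close>;
    \<open>c1\<close> and \<open>c2\<close> are the quotients.\<close>
  define c1 where "c1 = B * B * H - u * u"
  define c2 where "c2 = v * v - A * A * H"
  have u: "u = t * B + A * c1"
  proof -
    have "B * (u * v) = (A * u + 1) * u" using one by (metis mult.assoc mult.commute)
    then show ?thesis unfolding uv c1_def by (simp add: algebra_simps)
  qed
  have v: "v = - t * A + B * c2"
  proof -
    have "A * (u * v) = (B * v - 1) * v" using one by (simp add: algebra_simps)
    then show ?thesis unfolding uv c2_def by (simp add: algebra_simps)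
  qed
  have form: "c2 * B * B - 2 * t * A * B - c1 * A * A = 1"
    using one unfolding v unfolding u by (simp add: algebra_simps)
  have "A * B * (c1 * c2) = A * B * (H - 1)"
  proof -
    have "u * v = (t * B + A * c1) * (- t * A + B * c2)" using u v by simp
    also have "\<dots> = - (t * t) * (A * B) + t * (c2 * B * B - c1 * A * A) + A * B * (c1 * c2)"
      by (simp add: algebra_simps)
    also have "c2 * B * B - c1 * A * A = 1 + 2 * t * A * B" using form by simp
    also have "- (t * t) * (A * B) + t * (1 + 2 * t * A * B) + A * B * (c1 * c2) = (t * t) * (A * B) + t + A * B * (c1 * c2)"
      by (simp add: algebra_simps)
    finally show ?thesis using uv t by (simp add: algebra_simps)
  qed
  then have c: "c1 * c2 = H - 1" using hk by auto
  \<comment> \<open>Multiplying \<open>form\<close> by \<open>c2\<close> or by \<open>- c1\<close>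
    completes the square in one variable; \<open>c1 * c2 = H - 1\<close> then simplifies the
    remaining coefficient to \<open>H\<close>.\<close>
  define X where "X = c2 * B - t * A"
  define Y where "Y = c1 * A + t * B"
  have X: "X\<^sup>2 = H * A\<^sup>2 + c2"
  proof -
    have "X\<^sup>2 = c2 * (c2 * B * B - 2 * t * A * B - c1 * A * A) + (t * t + c1 * c2) * A\<^sup>2"
      by (simp add: X_def power2_eq_square algebra_simps)
    then show ?thesis unfolding form t c by simp
  qed
  have Y: "Y\<^sup>2 = H * B\<^sup>2 - c1"
  proof -
    have "Y\<^sup>2 = - c1 * (c2 * B * B - 2 * t * A * B - c1 * A * A) + (t * t + c1 * c2) * B\<^sup>2"
      by (simp add: Y_def power2_eq_square algebra_simps)
    then show ?thesis unfolding form t c by simp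
  qed
  have XY: "(X * Y)\<^sup>2 = (A * B * H + t)\<^sup>2"
  proof -
    have "(X * Y)\<^sup>2 = (H * A\<^sup>2 + c2) * (H * B\<^sup>2 - c1)" using X Y by (simp add: power_mult_distrib)
    also have "\<dots> = (A * B * H)\<^sup>2 + H * (c2 * B * B - c1 * A * A) - c1 * c2"
      by (simp add: power2_eq_square algebra_simps)
    also have "c2 * B * B - c1 * A * A = 1 + 2 * t * A * B" using form by simp
    also have "(A * B * H)\<^sup>2 + H * (1 + 2 * t * A * B) - c1 * c2 = (A * B * H + t)\<^sup>2"
      unfolding c using t by (simp add: power2_eq_square algebra_simps)
    finally show ?thesis .
  qed
  show ?thesis
    by (rule that[of c1 c2 X Y]) (use c X Y XY hk in \<open>simp_all add: H_def A_def B_def power_add\<close>)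
qed

text \<open>The same reduction for \<open>k = l + e\<close>. The surplus \<open>h ^ e\<close> now
  belongs to the divisor \<open>h ^ k\<close>, so it splits as \<open>P * Q\<close> between
  \<open>G\<close> and \<open>G + 1\<close> and appears in the coefficients of the squares.\<close>

lemma quadratic_form_cofactor_smaller:
  fixes a b u v G h t :: int
  assumes t: "t * t = 1" and h: "h = a * b" "h \<noteq> 0"
    and G: "G = a ^ (l + e) * u" "G + 1 = b ^ (l + e) * v" and eq: "G * (G + 1) = h ^ (l + e) * (h ^ l + t)"
  obtains X Y c1 c2 :: int where "c1 * c2 = h ^ e - 1"
    "b ^ e * X\<^sup>2 = a ^ e * (a ^ l)\<^sup>2 + c2" "a ^ e * Y\<^sup>2 = b ^ e * (b ^ l)\<^sup>2 + c1" "(X * Y)\<^sup>2 = (h ^ l + t)\<^sup>2"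
proof -
  define A B where "A = a ^ l" and "B = b ^ l"
  define P Q where "P = a ^ e" and "Q = b ^ e"
  have hl: "h ^ l = A * B" "h ^ l \<noteq> 0" and he: "h ^ e = P * Q" "P * Q \<noteq> 0"
    using h by (auto simp: A_def B_def P_def Q_def power_mult_distrib)
  have ak: "a ^ (l + e) = A * P" "b ^ (l + e) = B * Q" "h ^ (l + e) = A * B * (P * Q)"
    using hl he by (auto simp: power_add A_def B_def P_def Q_def)
  have "A * B * (P * Q) * (u * v) = A * B * (P * Q) * (A * B + t)"
    using eq unfolding G(2) unfolding G(1) ak hl by (simp add: mult_ac)
  then have uv: "u * v = A * B + t" using hl he by simp
  have one: "B * Q * v = A * P * u + 1" using G ak by simp
  define c1 where "c1 = P * u * u - B * B * Q"
  define c2 where "c2 = Q * v * v - A * A * P"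
  have u: "u = t * B * Q - A * c1"
  proof -
    have "B * Q * (u * v) = (A * P * u + 1) * u" using one by (metis mult.assoc mult.commute)
    then show ?thesis unfolding uv c1_def by (simp add: algebra_simps)
  qed
  have v: "v = - t * A * P + B * c2"
  proof -
    have "A * P * (u * v) = (B * Q * v - 1) * v" using one by (simp add: algebra_simps)
    then show ?thesis unfolding uv c2_def by (simp add: algebra_simps)
  qed
  have form: "Q * B * B * c2 - 2 * t * (P * Q) * A * B + P * A * A * c1 = 1"
    using one unfolding v unfolding u by (simp add: algebra_simps)
  have "A * B * (c1 * c2) = A * B * (P * Q - 1)"
  proof -
    have "u * v = (t * B * Q - A * c1) * (- t * A * P + B * c2)" using u v by simp
    also have "\<dots> = - (t * t) * (A * B * P * Q) + t * (Q * B * B * c2 + P * A * A * c1) - A * B * (c1 * c2)"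
      by (simp add: algebra_simps)
    also have "Q * B * B * c2 + P * A * A * c1 = 1 + 2 * t * (P * Q) * A * B" using form by simp
    also have "- (t * t) * (A * B * P * Q) + t * (1 + 2 * t * (P * Q) * A * B) - A * B * (c1 * c2)
        = (t * t) * (A * B * P * Q) + t - A * B * (c1 * c2)"
      by (simp add: algebra_simps)
    finally show ?thesis using uv t by (simp add: algebra_simps)
  qed
  then have c: "c1 * c2 = P * Q - 1" using hl by auto
  define X where "X = c2 * B - t * P * A"
  define Y where "Y = c1 * A - t * Q * B"
  have X: "Q * X\<^sup>2 = P * A\<^sup>2 + c2"
  proof -
    have "Q * X\<^sup>2 = c2 * (Q * B * B * c2 - 2 * t * (P * Q) * A * B + P * A * A * c1) + P * (t * t * (P * Q) - c1 * c2) * A\<^sup>2"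
      by (simp add: X_def power2_eq_square algebra_simps)
    then show ?thesis unfolding form t c by simp
  qed
  have Y: "P * Y\<^sup>2 = Q * B\<^sup>2 + c1"
  proof -
    have "P * Y\<^sup>2 = c1 * (Q * B * B * c2 - 2 * t * (P * Q) * A * B + P * A * A * c1) + Q * (t * t * (P * Q) - c1 * c2) * B\<^sup>2"
      by (simp add: Y_def power2_eq_square algebra_simps)
    then show ?thesis unfolding form t c by simp
  qed
  have "P * Q * (X * Y)\<^sup>2 = P * Q * (A * B + t)\<^sup>2"
  proof -
    have "P * Q * (X * Y)\<^sup>2 = (Q * X\<^sup>2) * (P * Y\<^sup>2)" by (simp add: power_mult_distrib)
    also have "\<dots> = P * Q * (A * B)\<^sup>2 + (Q * B * B * c2 + P * A * A * c1) + c1 * c2"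
      unfolding X Y by (simp add: power2_eq_square algebra_simps)
    also have "Q * B * B * c2 + P * A * A * c1 = 1 + 2 * t * (P * Q) * A * B" using form by simp
    also have "P * Q * (A * B)\<^sup>2 + (1 + 2 * t * (P * Q) * A * B) + c1 * c2 = P * Q * ((A * B)\<^sup>2 + 2 * t * (A * B) + t * t)"
      unfolding c t by (simp add: algebra_simps)
    also have "\<dots> = P * Q * (A * B + t)\<^sup>2" by (simp add: power2_eq_square algebra_simps)
    finally show ?thesis .
  qed
  then have XY: "(X * Y)\<^sup>2 = (A * B + t)\<^sup>2" using he by auto
  show ?thesis
    by (rule that[of c1 c2 X Y]) (use c X Y XY hl he in \<open>simp_all add: A_def B_def P_def Q_def\<close>)
qed

text \<open>Each of the cases \<open>l > k\<close> and \<open>k > l\<close> combines the abc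
  conjecture for the two equations of the quadratic form with one further abc estimate. The two
  resulting inequalities bound the smaller exponent and the difference of the exponents by small
  multiples of each other, up to constants.\<close>

lemma diagonal_pair_bounded_exponents:
  assumes abc: abc_conjecture
  obtains B :: nat where
    "\<And>G h k l t. G \<ge> 1 \<Longrightarrow> rep (G * (G + 1)) h k l t \<Longrightarrow> k \<noteq> l \<Longrightarrow> k \<le> B \<and> l \<le> B"
proof -
  obtain K where K: "K \<ge> 0" "\<And>A B C :: int. A + B = C \<Longrightarrow> A \<noteq> 0 \<Longrightarrow> C \<noteq> 0 \<Longrightarrow>
       ln \<bar>real_of_int A\<bar> \<le> (1 + 1 / 20) * (ln (rad (A * B)) + ln \<bar>real_of_int C\<bar>) + K"
    using abc_log[OF abc, of "1 / 20"] by (metis zero_less_divide_1_iff zero_less_numeral)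
  \<comment> \<open>The conjecture for \<open>p - q = c\<close>, with the radical of
    \<open>p * q\<close> bounded by any \<open>y\<close> that has a power divisible by
    \<open>p * q\<close>.\<close>
  have abc': "ln \<bar>real_of_int p\<bar> \<le> 21 / 20 * (ln \<bar>real_of_int y\<bar> + ln \<bar>real_of_int c\<bar>) + K"
    if "p - q = c" "p \<noteq> 0" "c \<noteq> 0" "p * q dvd y ^ n" "y \<noteq> 0" for p q c y :: int and n
  proof -
    have "rad (p * - q) \<le> rad (y ^ n)" using that by (auto intro!: rad_dvd_mono)
    also have "\<dots> \<le> rad y" by (rule rad_power_le)
    also have "\<dots> \<le> \<bar>y\<bar>" by (rule rad_le_abs) fact
    finally have "real_of_int (rad (p * - q)) \<le> real_of_int \<bar>y\<bar>" by (rule of_int_le_iff[THEN iffD2])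
    then have "ln (real_of_int (rad (p * - q))) \<le> ln \<bar>real_of_int y\<bar>"
      using rad_ge_1[of "p * - q"] that(5) by (subst ln_le_cancel_iff) auto
    moreover have "ln \<bar>real_of_int p\<bar> \<le> (1 + 1 / 20) * (ln (rad (p * - q)) + ln \<bar>real_of_int c\<bar>) + K"
      by (rule K(2)) (use that in auto)
    ultimately show ?thesis by argo
  qed
  have ln2: "0 < ln (2::real)" "ln (2::real) \<le> 1" "ln (5::real) \<le> 4"
    using ln_le_minus_one[of "2::real"] ln_le_minus_one[of "5::real"] by auto
  \<comment> \<open>Both cases end with \<open>j * L \<le> 20 * L + 100 + 20 * K\<close>; dividing
    by \<open>L \<ge> ln 2\<close> gives this bound on \<open>j\<close>.\<close>
  define B where "B = nat \<lceil>20 + (100 + 20 * K) / ln 2\<rceil>"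
  have le_B: "j \<le> B" if "j * L \<le> 20 * L + 100 + 20 * K" "L \<ge> ln 2" for j :: nat and L :: real
  proof -
    have "L > 0" using that ln2 by linarith
    have "100 + 20 * K \<le> (100 + 20 * K) / ln 2 * L"
      using that(2) K(1) ln2(1) mult_left_mono[of "ln 2" L "100 + 20 * K"] by (simp add: pos_le_divide_eq)
    then have "j * L \<le> (20 + (100 + 20 * K) / ln 2) * L" using that by (simp add: distrib_right)
    then have "real j \<le> 20 + (100 + 20 * K) / ln 2" using \<open>L > 0\<close> by simp
    then show ?thesis unfolding B_def by linarith
  qed
  have "k \<le> B \<and> l \<le> B" if G1: "G \<ge> 1" and rep: "rep (G * (G + 1)) h k l t" and "k \<noteq> l" for G h k l t
  proof -
    have h: "h \<ge> 2" and kl: "k \<ge> 1" "l \<ge> 1" and t: "t = 1 \<or> t = -1"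
      and eq: "G * (G + 1) = h ^ k * (h ^ l + t)"
      using rep by (auto simp: rep_def)
    have tt: "t * t = 1" using t by auto
    obtain a b u v where ab: "a \<ge> 1" "b \<ge> 1" "h = a * b" and G: "G = a ^ k * u" "G + 1 = b ^ k * v"
      by (rule consecutive_factorization[of h k G]) (use h kl eq in auto)
    define L where "L = ln (real_of_int h)"
    have L: "L \<ge> ln 2" using h by (simp add: L_def)
    then have "L > 0" using ln2 by linarith
    define V where "V = h ^ l + t"
    have "V \<ge> 1" using rep_cofactor(1)[OF rep] by (simp add: V_def)
    have lnV: "ln (real_of_int V) \<le> l * L + 1" "l * L - 1 \<le> ln (real_of_int V)"
      using rep_cofactor(3)[OF rep] ln2 unfolding V_def L_def by linarith+
    have lab: "ln (real_of_int a) + ln (real_of_int b) = L" using ab by (simp add: L_def ln_mult_pos)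
    have D: "ln (real_of_int (G * (G + 1))) \<ge> k * L + l * L - 1"
      unfolding eq using lnV(2) \<open>V \<ge> 1\<close> h unfolding V_def[symmetric] L_def by (simp add: ln_mult_pos ln_realpow)
    have lnXY: "ln \<bar>real_of_int X\<bar> + ln \<bar>real_of_int Y\<bar> \<le> l * L + 1" "X \<noteq> 0" "Y \<noteq> 0"
      if "(X * Y)\<^sup>2 = V\<^sup>2" for X Y :: int
    proof -
      have "\<bar>X * Y\<bar> = V" using that \<open>V \<ge> 1\<close> by (metis abs_le_square_iff abs_of_nonneg dual_order.antisym order_refl order_trans zero_le_one)
      then show "X \<noteq> 0" "Y \<noteq> 0" using \<open>V \<ge> 1\<close> by auto
      then have "ln \<bar>real_of_int X\<bar> + ln \<bar>real_of_int Y\<bar> = ln \<bar>real_of_int X * real_of_int Y\<bar>"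
        by (simp add: abs_mult ln_mult_pos)
      also have "\<bar>real_of_int X * real_of_int Y\<bar> = real_of_int V"
        using \<open>\<bar>X * Y\<bar> = V\<close> by (metis of_int_abs of_int_mult)
      finally show "ln \<bar>real_of_int X\<bar> + ln \<bar>real_of_int Y\<bar> \<le> l * L + 1" using lnV by simp
    qed
    have lnc: "ln \<bar>real_of_int c1\<bar> + ln \<bar>real_of_int c2\<bar> \<le> e * L" "c1 \<noteq> 0" "c2 \<noteq> 0"
      if "c1 * c2 = h ^ e - 1" "e \<ge> 1" for c1 c2 :: int and e :: nat
    proof -
      have "h ^ e \<ge> 2" using self_le_power[of h e] h that(2) by linarith
      then have "\<bar>c1 * c2\<bar> \<le> h ^ e" "c1 * c2 \<noteq> 0" using that(1) by auto
      then show "c1 \<noteq> 0" "c2 \<noteq> 0" by auto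
      then have "ln \<bar>real_of_int c1\<bar> + ln \<bar>real_of_int c2\<bar> = ln \<bar>real_of_int (c1 * c2)\<bar>"
        by (simp add: abs_mult ln_mult_pos)
      also have "\<dots> \<le> ln (real_of_int (h ^ e))"
        using of_int_le_iff[THEN iffD2, OF \<open>\<bar>c1 * c2\<bar> \<le> h ^ e\<close>, where 'a1 = real] \<open>c1 * c2 \<noteq> 0\<close> h
        by (subst ln_le_cancel_iff) auto
      finally show "ln \<bar>real_of_int c1\<bar> + ln \<bar>real_of_int c2\<bar> \<le> e * L"
        using h by (simp add: L_def ln_realpow)
    qed
    consider "l > k" | "k > l" using \<open>k \<noteq> l\<close> by linarith
    then show ?thesis
    proof cases
      case 1
      then obtain e where e: "l = k + e" "e \<ge> 1" by (metis less_imp_add_positive One_nat_def Suc_leI)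
      obtain X Y c1 c2 where c: "c1 * c2 = h ^ e - 1"
        and X: "X\<^sup>2 = h ^ e * (a ^ k)\<^sup>2 + c2" and Y: "Y\<^sup>2 = h ^ e * (b ^ k)\<^sup>2 - c1"
        and XY: "(X * Y)\<^sup>2 = (h ^ (k + e) + t)\<^sup>2"
        by (rule quadratic_form_cofactor_larger[OF tt ab(3) _ G, of e]) (use eq e h in auto)
      have xy: "ln \<bar>real_of_int X\<bar> + ln \<bar>real_of_int Y\<bar> \<le> l * L + 1" "X \<noteq> 0" "Y \<noteq> 0"
        using lnXY[of X Y] XY unfolding V_def e(1) by auto
      note cc = lnc[OF c e(2)]
      have dvd: "h ^ e * (x ^ k)\<^sup>2 * Z\<^sup>2 dvd (h * Z) ^ (e + 2 * k + 2)" if "x dvd h" for x Z :: int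
      proof -
        have "h ^ e * (x ^ k)\<^sup>2 dvd h ^ e * (h ^ k)\<^sup>2" using that by (intro mult_dvd_mono dvd_power_same) auto
        also have "\<dots> = h ^ (e + 2 * k)" by (simp add: power_add power_mult mult.commute[of 2])
        also have "\<dots> dvd h ^ (e + 2 * k + 2)" by (rule le_imp_power_dvd) simp
        finally have "h ^ e * (x ^ k)\<^sup>2 dvd h ^ (e + 2 * k + 2)" .
        moreover have "Z\<^sup>2 dvd Z ^ (e + 2 * k + 2)" by (rule le_imp_power_dvd) simp
        ultimately show ?thesis unfolding power_mult_distrib by (rule mult_dvd_mono)
      qed
      have "ln \<bar>real_of_int (h ^ e * (a ^ k)\<^sup>2)\<bar> \<le> 21 / 20 * (ln \<bar>real_of_int (h * X)\<bar> + ln \<bar>real_of_int (- c2)\<bar>) + K"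
        by (rule abc'[OF _ _ _ dvd]) (use X ab h xy cc in auto)
      moreover have "ln \<bar>real_of_int (h ^ e * (b ^ k)\<^sup>2)\<bar> \<le> 21 / 20 * (ln \<bar>real_of_int (h * Y)\<bar> + ln \<bar>real_of_int c1\<bar>) + K"
        by (rule abc'[OF _ _ _ dvd]) (use Y ab h xy cc in auto)
      moreover have "ln \<bar>real_of_int (h ^ e * (a ^ k)\<^sup>2)\<bar> = e * L + 2 * (k * ln (real_of_int a))"
        "ln \<bar>real_of_int (h ^ e * (b ^ k)\<^sup>2)\<bar> = e * L + 2 * (k * ln (real_of_int b))"
        using h ab(1,2) by (simp_all add: L_def ln_mult_pos ln_realpow abs_mult power_abs)
      moreover have "ln \<bar>real_of_int (h * X)\<bar> = L + ln \<bar>real_of_int X\<bar>" "ln \<bar>real_of_int (h * Y)\<bar> = L + ln \<bar>real_of_int Y\<bar>"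
        using h xy by (simp_all add: L_def ln_mult_pos abs_mult)
      moreover have "k * ln (real_of_int a) + k * ln (real_of_int b) = k * L"
        unfolding lab[symmetric] by (simp add: distrib_left)
      moreover have lL: "l * L = k * L + e * L" using e by (simp add: algebra_simps)
      \<comment> \<open>The sum of the estimates for \<open>X\<close> and \<open>Y\<close>: the
        logarithms of \<open>a\<close> and \<open>b\<close> add up to \<open>L\<close>, those of
        \<open>X\<close> and \<open>Y\<close> to about \<open>l * L\<close>, those of
        \<open>c1\<close> and \<open>c2\<close> to at most \<open>e * L\<close>. So \<open>k\<close>
        is at most a small multiple of \<open>e\<close>, up to constants.\<close>
      ultimately have E1: "2 * (e * L) + 2 * (k * L) \<le> 21 / 20 * (2 * L + k * L + 2 * (e * L) + 1) + 2 * K"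
        using xy(1) cc(1) unfolding of_int_minus abs_minus_cancel by argo
      define z where "z = 2 * G + 1"
      have z2: "z\<^sup>2 = 4 * (G * (G + 1)) + 1" by (simp add: z_def power2_eq_square algebra_simps)
      \<comment> \<open>The abc conjecture for
        \<open>z^2 - 4 * h ^ (k + l) = 4 * t * h ^ k + 1\<close>. Together with \<open>E3\<close> it
        bounds \<open>e\<close> by a small multiple of \<open>k\<close>, up to constants.\<close>
      have E2: "2 * ln (real_of_int z) \<le> 21 / 20 * (1 + L + ln (real_of_int z) + 4 + k * L) + K"
      proof -
        define c where "c = 4 * t * h ^ k + 1"
        have hk: "h ^ k \<ge> 1" using h by simp
        have zc: "z\<^sup>2 - 4 * h ^ (k + l) = c" unfolding z2 eq c_def by (simp add: power_add algebra_simps)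
        have "c \<noteq> 0"
        proof -
          have "4 * t * y + 1 \<noteq> 0" for y :: int using t by presburger
          then show ?thesis by (simp add: c_def)
        qed
        have zd: "z\<^sup>2 * (4 * h ^ (k + l)) dvd (2 * h * z) ^ (k + l + 2)"
        proof -
          have "z\<^sup>2 dvd z ^ (k + l + 2)" "h ^ (k + l) dvd h ^ (k + l + 2)" by (rule le_imp_power_dvd; simp)+
          moreover have "(4::int) dvd 2 ^ (k + l + 2)" by (simp add: power_add)
          ultimately have "4 * h ^ (k + l) * z\<^sup>2 dvd 2 ^ (k + l + 2) * h ^ (k + l + 2) * z ^ (k + l + 2)"
            by (intro mult_dvd_mono)
          then show ?thesis unfolding power_mult_distrib by (simp add: mult_ac)
        qed
        have "z \<ge> 1" using G1 by (simp add: z_def)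
        have "ln \<bar>real_of_int (z\<^sup>2)\<bar> \<le> 21 / 20 * (ln \<bar>real_of_int (2 * h * z)\<bar> + ln \<bar>real_of_int c\<bar>) + K"
          by (rule abc'[OF zc _ \<open>c \<noteq> 0\<close> zd]) (use \<open>z \<ge> 1\<close> h in auto)
        moreover have "ln \<bar>real_of_int (z\<^sup>2)\<bar> = 2 * ln (real_of_int z)" using G1 by (simp add: z_def ln_realpow)
        moreover have "ln \<bar>real_of_int (2 * h * z)\<bar> = ln 2 + L + ln (real_of_int z)"
          using G1 h by (simp add: z_def ln_mult_pos L_def abs_mult)
        moreover have "ln \<bar>real_of_int c\<bar> \<le> ln 5 + k * L"
        proof -
          have "\<bar>c\<bar> \<le> 5 * h ^ k" using hk t unfolding c_def by auto
          then have "real_of_int \<bar>c\<bar> \<le> real_of_int (5 * h ^ k)" by (rule of_int_le_iff[THEN iffD2])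
          then have "ln \<bar>real_of_int c\<bar> \<le> ln (5 * real_of_int h ^ k)"
            using \<open>c \<noteq> 0\<close> h by (subst ln_le_cancel_iff) auto
          then show ?thesis using h by (simp add: ln_mult_pos ln_realpow L_def)
        qed
        ultimately show ?thesis using ln2 by argo
      qed
      have E3: "k * L + l * L - 1 \<le> 2 * ln (real_of_int z)"
      proof -
        have "G * (G + 1) \<le> z\<^sup>2" unfolding z2 using G1 mult_nonneg_nonneg[of G "G + 1"] by linarith
        then have "real_of_int (G * (G + 1)) \<le> real_of_int (z\<^sup>2)" by (rule of_int_le_iff[THEN iffD2])
        then have "ln (real_of_int (G * (G + 1))) \<le> ln (real_of_int (z\<^sup>2))"
          using G1 by (subst ln_le_cancel_iff) (auto simp: z_def)
        also have "\<dots> = 2 * ln (real_of_int z)" using G1 by (simp add: z_def ln_realpow)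
        finally show ?thesis using D by simp
      qed
      have "l * L \<le> 20 * L + 100 + 20 * K"
        using E1 E2 E3 lL K(1) \<open>L > 0\<close> by argo
      then show ?thesis using le_B[OF _ L] 1 by fastforce
    next
      case 2
      then obtain e where e: "k = l + e" "e \<ge> 1" by (metis less_imp_add_positive One_nat_def Suc_leI)
      obtain X Y c1 c2 where c: "c1 * c2 = h ^ e - 1"
        and X: "b ^ e * X\<^sup>2 = a ^ e * (a ^ l)\<^sup>2 + c2" and Y: "a ^ e * Y\<^sup>2 = b ^ e * (b ^ l)\<^sup>2 + c1"
        and XY: "(X * Y)\<^sup>2 = (h ^ l + t)\<^sup>2"
        by (rule quadratic_form_cofactor_smaller[OF tt ab(3) _ G[unfolded e(1)]]) (use eq e h in auto)
      have xy: "ln \<bar>real_of_int X\<bar> + ln \<bar>real_of_int Y\<bar> \<le> l * L + 1" "X \<noteq> 0" "Y \<noteq> 0"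
        using lnXY[of X Y] XY unfolding V_def by auto
      note cc = lnc[OF c e(2)]
      have dvd: "x ^ e * (x ^ l)\<^sup>2 * (y ^ e * Z\<^sup>2) dvd (h * Z) ^ (e + 2 * l + 2)" if "h = x * y" for x y Z :: int
      proof -
        have "x ^ e * (x ^ l)\<^sup>2 * y ^ e = h ^ e * (x ^ l)\<^sup>2" by (simp add: that power_mult_distrib)
        also have "\<dots> dvd h ^ e * (h ^ l)\<^sup>2" using that by (intro mult_dvd_mono dvd_power_same) auto
        also have "\<dots> = h ^ (e + 2 * l)" by (simp add: power_add power_mult mult.commute[of 2])
        also have "\<dots> dvd h ^ (e + 2 * l + 2)" by (rule le_imp_power_dvd) simp
        finally have "x ^ e * (x ^ l)\<^sup>2 * y ^ e dvd h ^ (e + 2 * l + 2)" .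
        moreover have "Z\<^sup>2 dvd Z ^ (e + 2 * l + 2)" by (rule le_imp_power_dvd) simp
        ultimately show ?thesis unfolding power_mult_distrib mult.assoc[symmetric] by (rule mult_dvd_mono)
      qed
      have "ln \<bar>real_of_int (a ^ e * (a ^ l)\<^sup>2)\<bar> \<le> 21 / 20 * (ln \<bar>real_of_int (h * X)\<bar> + ln \<bar>real_of_int (- c2)\<bar>) + K"
        by (rule abc'[OF _ _ _ dvd[OF ab(3)]]) (use X ab h xy cc in auto)
      moreover have "ln \<bar>real_of_int (b ^ e * (b ^ l)\<^sup>2)\<bar> \<le> 21 / 20 * (ln \<bar>real_of_int (h * Y)\<bar> + ln \<bar>real_of_int (- c1)\<bar>) + K"
        by (rule abc'[OF _ _ _ dvd[of b a]]) (use Y ab h xy cc in auto)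
      moreover have "ln \<bar>real_of_int (a ^ e * (a ^ l)\<^sup>2)\<bar> = e * ln (real_of_int a) + 2 * (l * ln (real_of_int a))"
        "ln \<bar>real_of_int (b ^ e * (b ^ l)\<^sup>2)\<bar> = e * ln (real_of_int b) + 2 * (l * ln (real_of_int b))"
        using ab(1,2) by (simp_all add: ln_mult_pos ln_realpow abs_mult power_abs)
      moreover have "ln \<bar>real_of_int (h * X)\<bar> = L + ln \<bar>real_of_int X\<bar>" "ln \<bar>real_of_int (h * Y)\<bar> = L + ln \<bar>real_of_int Y\<bar>"
        using h xy by (simp_all add: L_def ln_mult_pos abs_mult)
      moreover have "l * ln (real_of_int a) + l * ln (real_of_int b) = l * L" "e * ln (real_of_int a) + e * ln (real_of_int b) = e * L"
        unfolding lab[symmetric] by (simp_all add: distrib_left)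
      ultimately have E1: "e * L + 2 * (l * L) \<le> 21 / 20 * (2 * L + l * L + e * L + 1) + 2 * K"
        using xy(1) cc(1) unfolding of_int_minus abs_minus_cancel by argo
      have kL: "k * L = l * L + e * L" using e by (simp add: algebra_simps)
      \<comment> \<open>The abc conjecture for \<open>(G + 1) - G = 1\<close>, the product of the
        two having radical at most \<open>h * V\<close>. With \<open>E3\<close> it bounds
        \<open>e\<close> by a small multiple of \<open>l\<close>, while \<open>E1\<close> bounds
        \<open>l\<close> by a small multiple of \<open>e\<close>, both up to constants.\<close>
      have E2: "ln (real_of_int (G + 1)) \<le> 21 / 20 * (L + l * L + 1) + K"
      proof -
        have dv: "(G + 1) * G dvd (h * V) ^ k"
        proof -
          have "(G + 1) * G = h ^ k * V" using eq by (simp add: V_def mult.commute)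
          also have "\<dots> dvd h ^ k * V ^ k" using kl by (intro mult_dvd_mono dvd_power) auto
          finally show ?thesis by (simp add: power_mult_distrib)
        qed
        have "ln \<bar>real_of_int (G + 1)\<bar> \<le> 21 / 20 * (ln \<bar>real_of_int (h * V)\<bar> + ln \<bar>real_of_int 1\<bar>) + K"
          by (rule abc'[OF _ _ _ dv]) (use G1 h \<open>V \<ge> 1\<close> in auto)
        moreover have "ln \<bar>real_of_int (h * V)\<bar> = L + ln (real_of_int V)" using h \<open>V \<ge> 1\<close> by (simp add: L_def ln_mult_pos abs_mult)
        moreover have "\<bar>real_of_int (G + 1)\<bar> = real_of_int (G + 1)" using G1 by simp
        ultimately have "ln (real_of_int (G + 1)) \<le> 21 / 20 * (L + ln (real_of_int V)) + K" by simp
        then show ?thesis using lnV(1) by argo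
      qed
      have E3: "k * L + l * L - 1 \<le> 2 * ln (real_of_int (G + 1))"
      proof -
        have "G * (G + 1) \<le> (G + 1)\<^sup>2" using G1 by (simp add: power2_eq_square)
        then have "real_of_int (G * (G + 1)) \<le> real_of_int ((G + 1)\<^sup>2)" by (rule of_int_le_iff[THEN iffD2])
        then have "ln (real_of_int (G * (G + 1))) \<le> ln (real_of_int ((G + 1)\<^sup>2))"
          using G1 by (subst ln_le_cancel_iff) auto
        also have "ln (real_of_int ((G + 1)\<^sup>2)) = 2 * ln (real_of_int (G + 1))"
          using G1 by (simp add: ln_realpow del: of_int_add)
        finally show ?thesis using D by simp
      qed
      have "k * L \<le> 20 * L + 100 + 20 * K"
        using E1 E2 E3 kL K(1) \<open>L > 0\<close> by argo
      then show ?thesis using le_B[OF _ L] 2 by fastforce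
    qed
  qed
  then show ?thesis using that by blast
qed

text \<open>Only finitely many exponents and signs remain, so the bounds for fixed exponents have a
  maximum.\<close>

lemma diagonal_pair_bounded:
  assumes abc: abc_conjecture
  obtains N :: int where
    "\<And>G h k l t. G \<ge> 1 \<Longrightarrow> rep (G * (G + 1)) h k l t \<Longrightarrow> k \<noteq> l \<Longrightarrow> G * (G + 1) \<le> N"
proof -
  obtain B where B: "\<And>G h k l t. G \<ge> 1 \<Longrightarrow> rep (G * (G + 1)) h k l t \<Longrightarrow> k \<noteq> l \<Longrightarrow> k \<le> B \<and> l \<le> B"
    using diagonal_pair_bounded_exponents[OF abc] by blast
  define T :: "(nat \<times> nat \<times> int) set" where "T = {..B} \<times> {..B} \<times> {-1, 1}"
  have "\<exists>N. \<forall>G h. G \<ge> 1 \<longrightarrow> rep (G * (G + 1)) h k l t \<longrightarrow> k \<noteq> l \<longrightarrow> G * (G + 1) \<le> N" for k l t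
  proof (cases "k \<ge> 1 \<and> l \<ge> 1 \<and> k \<noteq> l \<and> \<bar>t\<bar> = 1")
    case True
    then show ?thesis using diagonal_pair_bounded_fixed_exponents[OF abc, of k l t] by metis
  next
    case False
    then show ?thesis by (auto simp: rep_def)
  qed
  then obtain f' where f': "\<forall>k l t G h. G \<ge> 1 \<longrightarrow> rep (G * (G + 1)) h k l t \<longrightarrow> k \<noteq> l \<longrightarrow> G * (G + 1) \<le> f' k l t"
    by metis
  define f where "f = (\<lambda>(k, l, t). f' k l t)"
  have f: "G * (G + 1) \<le> f (k, l, t)" if "G \<ge> 1" "rep (G * (G + 1)) h k l t" "k \<noteq> l" for G h k l t
    using f' that unfolding f_def prod.case by blast
  have "G * (G + 1) \<le> Max (f ` T)" if "G \<ge> 1" "rep (G * (G + 1)) h k l t" "k \<noteq> l" for G h k l t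
  proof -
    have "t = 1 \<or> t = -1" using that(2) by (auto simp: rep_def)
    then have "(k, l, t) \<in> T" using B[OF that] by (auto simp: T_def)
    moreover have "finite T" by (simp add: T_def)
    ultimately have "f (k, l, t) \<le> Max (f ` T)" by simp
    then show ?thesis using f[OF that] by linarith
  qed
  then show ?thesis using that by blast
qed

section \<open>At most two representations\<close>

text \<open>The largest value at \<open>G\<close>, namely \<open>G ^ m * (G + 1)\<close>, lies below
  the smallest value at the next base, \<open>(G + 1) ^ m * G\<close>.\<close>

lemma base_unique:
  fixes G H s t :: int
  assumes "G \<ge> 2" "H \<ge> 2" "m \<ge> 2" "\<bar>s\<bar> = 1" "\<bar>t\<bar> = 1" "G ^ m * (G + s) = H ^ m * (H + t)"
  shows "G = H"
proof -
  have less: False if GH: "2 \<le> G" "G < H" and st: "\<bar>s\<bar> = 1" "\<bar>t\<bar> = 1" and eq: "G ^ m * (G + s) = H ^ m * (H + t)"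
    for G H s t :: int
  proof -
    obtain j where j: "m = Suc j" "j \<ge> 1" using \<open>m \<ge> 2\<close> by (cases m) auto
    have "G ^ j < (G + 1) ^ j" using GH j by (intro power_strict_mono) auto
    then have "G ^ j * (G * (G + 1)) < (G + 1) ^ j * (G * (G + 1))"
      using GH by (intro mult_strict_right_mono) auto
    then have "G ^ m * (G + 1) < (G + 1) ^ m * G" by (simp add: j mult_ac)
    also have "\<dots> \<le> H ^ m * (H + t)"
      using GH st by (intro mult_mono power_mono) auto
    also have "\<dots> = G ^ m * (G + s)" using eq by simp
    also have "\<dots> \<le> G ^ m * (G + 1)" using GH st by (intro mult_left_mono) auto
    finally show False by simp
  qed
  then show ?thesis using assms by (metis linorder_neqE)
qed

text \<open>Again the largest value at \<open>g\<close> lies below the smallest value at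
  \<open>g + 1\<close>.\<close>

lemma base_unique_cubic:
  fixes g h s t :: int
  assumes "g \<ge> 2" "h \<ge> 2" "\<bar>s\<bar> = 1" "\<bar>t\<bar> = 1" "g * (g\<^sup>2 + s) = h * (h\<^sup>2 + t)"
  shows "g = h"
proof -
  have less: False if GH: "2 \<le> g" "g < h" and st: "\<bar>s\<bar> = 1" "\<bar>t\<bar> = 1" and eq: "g * (g\<^sup>2 + s) = h * (h\<^sup>2 + t)"
    for g h s t :: int
  proof -
    have "g * (g\<^sup>2 + s) \<le> g * (g\<^sup>2 + 1)" using GH st by (intro mult_left_mono) auto
    also have "\<dots> < (g + 1) * ((g + 1)\<^sup>2 - 1)"
    proof -
      have "(g + 1) * ((g + 1)\<^sup>2 - 1) = g * (g\<^sup>2 + 1) + (3 * (g * g) + g)"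
        by (simp add: power2_eq_square algebra_simps)
      moreover have "0 < g * g" using GH by simp
      ultimately show ?thesis using GH by linarith
    qed
    also have "\<dots> \<le> h * (h\<^sup>2 + t)"
    proof (rule mult_mono)
      have "(g + 1)\<^sup>2 \<le> h\<^sup>2" using GH by (intro power_mono) auto
      then show "(g + 1)\<^sup>2 - 1 \<le> h\<^sup>2 + t" using st by linarith
      show "0 \<le> (g + 1)\<^sup>2 - 1" using GH by (simp add: power2_eq_square algebra_simps)
    qed (use GH in auto)
    finally show False using eq by simp
  qed
  then show ?thesis using assms by (metis linorder_neqE)
qed

section \<open>Bases that are not perfect powers\<close>

definition primitive :: "int \<Rightarrow> bool" where
  "primitive g \<longleftrightarrow> g \<ge> 2 \<and> (\<forall>c j. g = c ^ j \<longrightarrow> j = 1)"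

text \<open>A Euclidean algorithm on \<open>A\<close> and \<open>B\<close>: the one with the smaller
  exponent is divisible by the other, and the quotient again has a power equal to a power of that
  other number.\<close>

lemma common_base:
  fixes A B :: int
  assumes "A \<ge> 2" "B \<ge> 2" "i \<ge> 1" "j \<ge> 1" "A ^ i = B ^ j"
  shows "\<exists>c x y. c \<ge> 2 \<and> x \<ge> 1 \<and> y \<ge> 1 \<and> A = c ^ x \<and> B = c ^ y"
  using assms
proof (induction "nat (A + B)" arbitrary: A B i j rule: less_induct)
  case less
  have step: "\<exists>c x y. c \<ge> 2 \<and> x \<ge> 1 \<and> y \<ge> 1 \<and> A' = c ^ x \<and> B' = c ^ y"
    if AB: "A' \<ge> 2" "B' \<ge> 2" "i' \<ge> 1" "j' \<ge> 1" "A' ^ i' = B' ^ j'" "i' \<ge> j'" "nat (A' + B') = nat (A + B)"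
    for A' B' :: int and i' j' :: nat
  proof -
    have "A' ^ j' dvd B' ^ j'" unfolding AB(5)[symmetric] by (rule le_imp_power_dvd) fact
    then have "A' dvd B'" using AB(4) by simp
    then obtain C where C: "B' = A' * C" by blast
    have "C \<ge> 1" using C AB(1,2) by (metis int_one_le_iff_zero_less less_le_trans zero_less_mult_pos zero_less_numeral)
    have "A' ^ j' * A' ^ (i' - j') = A' ^ j' * C ^ j'"
      using AB(5,6) unfolding C power_mult_distrib by (simp flip: power_add)
    then have eq: "A' ^ (i' - j') = C ^ j'" using AB(1) by simp
    show ?thesis
    proof (cases "C = 1")
      case True
      then have "A' = A' ^ 1" "B' = A' ^ 1" using C by auto
      then show ?thesis using AB(1) by blast
    next
      case False
      then have "C \<ge> 2" using \<open>C \<ge> 1\<close> by linarith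
      have "i' - j' \<ge> 1"
      proof (rule ccontr)
        assume "\<not> i' - j' \<ge> 1"
        then have "C ^ j' = 1" using eq by simp
        moreover have "C ^ j' \<ge> C" using \<open>C \<ge> 2\<close> AB(4) by (intro self_le_power) auto
        ultimately show False using \<open>C \<ge> 2\<close> by linarith
      qed
      moreover have "nat (A' + C) < nat (A + B)"
      proof -
        have "A' * C \<ge> 2 * C" using AB(1) \<open>C \<ge> 2\<close> by (intro mult_right_mono) auto
        then have "C < B'" using C \<open>C \<ge> 2\<close> by linarith
        then show ?thesis using AB(1,7) \<open>C \<ge> 2\<close> by linarith
      qed
      ultimately obtain c x y where "c \<ge> 2" "x \<ge> 1" "y \<ge> 1" "A' = c ^ x" "C = c ^ y"
        using less.hyps[of A' C "i' - j'" j'] AB(1,4) \<open>C \<ge> 2\<close> eq by blast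
      then have "A' = c ^ x" "B' = c ^ (x + y)" "x + y \<ge> 1" using C by (auto simp: power_add)
      then show ?thesis using \<open>c \<ge> 2\<close> \<open>x \<ge> 1\<close> by blast
    qed
  qed
  show ?case
  proof (cases "i \<ge> j")
    case True
    then show ?thesis using step[of A B i j] less.prems by blast
  next
    case False
    then show ?thesis using step[of B A j i] less.prems by (auto simp: add.commute)
  qed
qed

lemma primitive_eqI:
  assumes "primitive g" "primitive h" "g ^ m = h ^ k" "m \<ge> 1" "k \<ge> 1"
  shows "g = h"
proof -
  have "g \<ge> 2" "h \<ge> 2" using assms by (auto simp: primitive_def)
  then obtain c x y where c: "g = c ^ x" "h = c ^ y" using common_base[of g h m k] assms by blast
  then have "x = 1" "y = 1" using assms(1,2) unfolding primitive_def by blast+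
  then show ?thesis using c by simp
qed

lemma primitive_not_square: "primitive (c\<^sup>2) \<Longrightarrow> False"
  unfolding primitive_def by (elim conjE allE[of _ c] allE[of _ 2]) simp

lemma primitive_root:
  fixes A :: int
  assumes "A \<ge> 2"
  shows "\<exists>g j. primitive g \<and> j \<ge> 1 \<and> A = g ^ j"
  using assms
proof (induction "nat A" arbitrary: A rule: less_induct)
  case less
  show ?case
  proof (cases "primitive A")
    case True
    then show ?thesis by (metis order_refl power_one_right)
  next
    case False
    then obtain c j where cj: "A = c ^ j" "j \<noteq> 1" using less.prems by (auto simp: primitive_def)
    then have A: "A = \<bar>c\<bar> ^ j" using less.prems by (metis abs_of_nonneg order_trans power_abs zero_le_numeral)
    have "j \<noteq> 0" using A less.prems by (cases j) auto
    have "\<bar>c\<bar> \<ge> 2"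
    proof (rule ccontr)
      assume "\<not> \<bar>c\<bar> \<ge> 2"
      then have "\<bar>c\<bar> ^ j \<le> 1" by (intro power_le_one) auto
      then show False using A less.prems by linarith
    qed
    have "\<bar>c\<bar> ^ 1 < \<bar>c\<bar> ^ j" using \<open>\<bar>c\<bar> \<ge> 2\<close> cj(2) \<open>j \<noteq> 0\<close> by (intro power_strict_increasing) auto
    then have "\<bar>c\<bar> < A" using A by simp
    then have "nat \<bar>c\<bar> < nat A" by linarith
    then obtain g i where "primitive g" "i \<ge> 1" "\<bar>c\<bar> = g ^ i" using less.hyps \<open>\<bar>c\<bar> \<ge> 2\<close> by blast
    then have "primitive g" "i * j \<ge> 1" "A = g ^ (i * j)" using A \<open>j \<noteq> 0\<close> by (auto simp: power_mult)
    then show ?thesis by blast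
  qed
qed

text \<open>The cofactors are coprime to \<open>g\<close>, so \<open>m = k\<close> and the signs
  differ. Then two powers of \<open>g\<close> differ by 2, which happens only for 2 and 4.\<close>

lemma rep_same_base:
  assumes r1: "rep d g m n s" and r2: "rep d g k l t" and ne: "(g ^ m, s) \<noteq> (g ^ k, t)"
  shows "g = 2 \<and> m = k \<and> d = 3 * 2 ^ m"
proof -
  have b: "g \<ge> 2" "n \<ge> 1" "l \<ge> 1" "\<bar>s\<bar> = 1" "\<bar>t\<bar> = 1" "g ^ m * (g ^ n + s) = g ^ k * (g ^ l + t)"
    "d = g ^ m * (g ^ n + s)" "d = g ^ k * (g ^ l + t)"
    using r1 r2 by (auto simp: rep_def)
  have no_less: False if r1: "rep d g m n s" and r2: "rep d g k l t" and "m < k" for m n s k l t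
  proof -
    have "g \<ge> 2" and eq: "g ^ m * (g ^ n + s) = g ^ k * (g ^ l + t)" using r1 r2 by (auto simp: rep_def)
    obtain j where j: "k = m + Suc j" using \<open>m < k\<close> less_iff_Suc_add by auto
    have "g ^ m * (g ^ n + s) = g ^ m * (g ^ Suc j * (g ^ l + t))" unfolding eq j by (simp add: power_add)
    then have "g ^ n + s = g * (g ^ j * (g ^ l + t))" using \<open>g \<ge> 2\<close> by simp
    then have "g dvd g ^ n + s" by simp
    then have "is_unit g" using rep_cofactor(2)[OF r1] by (metis coprime_absorb_left)
    then show False using \<open>g \<ge> 2\<close> by auto
  qed
  have "m = k" using no_less[OF r1 r2] no_less[OF r2 r1] by (metis linorder_neqE_nat)
  then have "s \<noteq> t" using ne by simp
  have eq: "g ^ n + s = g ^ l + t" using b(6) b(1) \<open>m = k\<close> by simp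
  have two: "g = 2 \<and> n = 1" if "g ^ l = g ^ n + 2" "n \<ge> 1" for n l
  proof -
    have "n < l"
    proof (rule ccontr)
      assume "\<not> n < l"
      then have "g ^ l \<le> g ^ n" using b(1) by (intro power_increasing) auto
      then show False using that by simp
    qed
    then have "g ^ n dvd g ^ n + 2" unfolding that(1)[symmetric] by (intro le_imp_power_dvd) simp
    then have "g ^ n dvd 2" by (simp add: dvd_add_right_iff)
    then have "g ^ n \<le> 2" by (rule zdvd_imp_le) simp
    moreover have "g ^ n \<ge> g" using b(1) that by (intro self_le_power) auto
    ultimately have "g = 2" using b(1) by linarith
    then have "(2::int) ^ n \<le> 2 ^ 1" using \<open>g ^ n \<le> 2\<close> by simp
    then have "n \<le> 1" using power_increasing_iff[of "2::int" n 1] by simp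
    then show ?thesis using \<open>g = 2\<close> that by simp
  qed
  consider "s = 1" "t = -1" | "s = -1" "t = 1" using b(4,5) \<open>s \<noteq> t\<close> by linarith
  then show ?thesis
  proof cases
    case 1
    then have "g = 2 \<and> n = 1" using two[of l n] eq b(2) by simp
    then show ?thesis using b(7) 1 \<open>m = k\<close> by simp
  next
    case 2
    then have "g = 2 \<and> l = 1" using two[of n l] eq b(3) by simp
    then show ?thesis using b(8) 2 \<open>m = k\<close> by simp
  qed
qed

text \<open>Modulo 80 the powers of 3 are 1, 3, 9 and 27. For \<open>m \<ge> 4\<close> the value is
  divisible by 16, which leaves only \<open>1 - 1 = 0\<close>; then 5 would divide a power of
  2.\<close>

lemma three_power_plus_unit:
  fixes t :: int
  assumes "\<bar>t\<bar> = 1" "3 ^ l + t = 2 ^ m"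
  shows "m \<le> 3"
proof (rule ccontr)
  assume "\<not> m \<le> 3"
  define j where "j = m - 4"
  have j: "m = j + 4" using \<open>\<not> m \<le> 3\<close> by (simp add: j_def)
  define q r where "q = l div 4" and "r = l mod 4"
  have l: "l = 4 * q + r" by (simp add: q_def r_def)
  have "(81::int) ^ q mod 80 = 1" by (simp add: power_mod[symmetric, of "81::int" q 80])
  then have "(3::int) ^ l mod 80 = 3 ^ r mod 80"
    unfolding l power_add power_mult by (simp add: mod_mult_left_eq[symmetric, of "81 ^ q"])
  moreover have "r \<in> {0, 1, 2, 3}" by (auto simp: r_def)
  ultimately have "(3::int) ^ l mod 80 \<in> {1, 3, 9, 27}" by auto
  moreover have "(2::int) ^ m mod 16 = 0" by (simp add: j power_add)
  moreover have "(3::int) ^ l = 2 ^ m - t" using assms by simp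
  moreover have "5 dvd y" if "(y - t) mod 80 = 1 \<or> (y - t) mod 80 = 3 \<or> (y - t) mod 80 = 9 \<or> (y - t) mod 80 = 27"
    "y mod 16 = 0" for y :: int
  proof -
    define w c where "w = (y - t) div 80" and "c = (y - t) mod 80"
    have "y = 16 * (5 * w) + (c + t)" using div_mult_mod_eq[of "y - t" 80] by (simp add: w_def c_def)
    moreover from this have "(c + t) mod 16 = 0" using that(2) by (metis mod_mult_self4)
    moreover have "t = 1 \<or> t = -1" using assms(1) by linarith
    moreover have "c = 1 \<or> c = 3 \<or> c = 9 \<or> c = 27" using that(1) by (simp add: c_def)
    ultimately have "y = 5 * (16 * w)" by auto
    then show ?thesis by simp
  qed
  ultimately have "(5::int) dvd 2 ^ m" by simp
  then have "(5::int) dvd 2" by (rule prime_dvd_power[rotated]) simp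
  then show False by presburger
qed

text \<open>For even \<open>h\<close> the cofactor is coprime to \<open>2 ^ m\<close>, for odd
  \<open>h\<close> the power \<open>h ^ k\<close> is; that factor must then divide 3. The bound 24
  is the value \<open>3 * 2 ^ 3\<close> at the last exponent allowed by
  \<open>three_power_plus_unit\<close>.\<close>

lemma rep_3_times_power_of_2:
  assumes r: "rep d h k l t" and pr: "primitive h" and d: "d = 3 * 2 ^ m" "d > 24"
  shows "h = 2"
proof -
  have b: "h \<ge> 2" "k \<ge> 1" "l \<ge> 1" "\<bar>t\<bar> = 1" "3 * 2 ^ m = h ^ k * (h ^ l + t)" using r d by (auto simp: rep_def)
  have hl: "h ^ l \<ge> h" using b by (intro self_le_power) auto
  show ?thesis
  proof (cases "even h")
    case True
    have "odd (h ^ l + t)" using True b(3,4) by (auto simp: abs_if split: if_splits)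
    then have "coprime (h ^ l + t) (2 ^ m)" by (simp add: coprime_commute)
    moreover have "h ^ l + t dvd 3 * 2 ^ m" unfolding b(5) by simp
    ultimately have "h ^ l + t dvd 3" by (simp add: coprime_dvd_mult_left_iff)
    then have "h ^ l + t \<le> 3" by (rule zdvd_imp_le) simp
    then have "h ^ l \<le> 4" using b(4) by linarith
    then have "h \<le> 4" using hl by linarith
    then have "h = 2 \<or> h = 3 \<or> h = 4" using b(1) by linarith
    then consider "h = 2" | "h = 4" using True by auto
    then show ?thesis
    proof cases
      case 2
      then show ?thesis using pr primitive_not_square[of 2] by simp
    qed
  next
    case False
    then have "coprime (h ^ k) (2 ^ m)" by (simp add: coprime_commute)
    moreover have "h ^ k dvd 3 * 2 ^ m" unfolding b(5) by simp
    ultimately have "h ^ k dvd 3" by (simp add: coprime_dvd_mult_left_iff)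
    then have "h ^ k \<le> 3" by (rule zdvd_imp_le) simp
    moreover have "h ^ k \<ge> h" using b by (intro self_le_power) auto
    ultimately have "h = 2 \<or> h = 3" "h ^ k \<le> 3" "h \<le> h ^ k" using b(1) by linarith+
    then have "h = 3" "h ^ k = 3" using False by auto
    then have "3 ^ l + t = 2 ^ m" using b(5) by simp
    then have "m \<le> 3" using three_power_plus_unit b(4) by blast
    then have "(2::int) ^ m \<le> 2 ^ 3" by (intro power_increasing) auto
    then show ?thesis using d by simp
  qed
qed

section \<open>Three representations with distinct bases\<close>

lemma primitive_bases_distinct_powers:
  assumes "primitive g" "primitive h" "g \<noteq> h" "m \<ge> 1" "k \<ge> 1"
  shows "g ^ m \<noteq> h ^ k"
  using primitive_eqI[of g h m k] assms by blast

lemma rep_diagonal: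
  assumes "rep d g n n s"
  shows "\<exists>G \<ge> 1. d = G * (G + 1) \<and> ((g ^ n, s) = (G, 1) \<or> (g ^ n, s) = (G + 1, -1))"
proof -
  have r: "g \<ge> 2" "n \<ge> 1" "s = 1 \<or> s = -1" "d = g ^ n * (g ^ n + s)" using assms by (auto simp: rep_def)
  have "g ^ n \<ge> 2" using self_le_power[of g n] r by linarith
  from r(3) show ?thesis
  proof
    assume "s = 1"
    then show ?thesis using r(4) \<open>g ^ n \<ge> 2\<close> by (intro exI[of _ "g ^ n"]) auto
  next
    assume "s = -1"
    then show ?thesis using r(4) \<open>g ^ n \<ge> 2\<close> by (intro exI[of _ "g ^ n - 1"]) (auto simp: algebra_simps)
  qed
qed

lemma consecutive_product_unique:
  fixes G H :: int
  assumes "G \<ge> 1" "H \<ge> 1" "G * (G + 1) = H * (H + 1)"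
  shows "G = H"
proof -
  have "(G - H) * (G + H + 1) = 0" using assms(3) by (simp add: algebra_simps)
  then show ?thesis using assms(1,2) by auto
qed

lemma three_ordered_reps_bounded:
  assumes abc: abc_conjecture
  obtains N :: int where
    "\<And>d g1 m1 n1 s1 g2 m2 n2 s2 g3 m3 n3 s3.
       rep d g1 m1 n1 s1 \<Longrightarrow> rep d g2 m2 n2 s2 \<Longrightarrow> rep d g3 m3 n3 s3 \<Longrightarrow>
       primitive g1 \<Longrightarrow> primitive g2 \<Longrightarrow> primitive g3 \<Longrightarrow>
       g1 ^ m1 > g2 ^ m2 \<Longrightarrow> g2 ^ m2 > g3 ^ m3 \<Longrightarrow> g1 \<noteq> g2 \<Longrightarrow> g2 \<noteq> g3 \<Longrightarrow> g1 \<noteq> g3 \<Longrightarrow> d \<le> N"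
proof -
  obtain N1 where N1: "\<And>G h k l t. G \<ge> 1 \<Longrightarrow> rep (G * (G + 1)) h k l t \<Longrightarrow> k \<noteq> l \<Longrightarrow> G * (G + 1) \<le> N1"
    using diagonal_pair_bounded[OF abc] by blast
  obtain N2 where N2: "\<And>d g m n s h k l t. rep d g m n s \<Longrightarrow> rep d h k l t \<Longrightarrow> g ^ m > h ^ k \<Longrightarrow> d > N2 \<Longrightarrow>
       m \<noteq> n \<Longrightarrow> k \<noteq> l \<Longrightarrow>
       (n \<ge> 2 \<longrightarrow> (m, n, k, l) = (4, 2, 2, 1) \<or> (m, n, k, l) = (1, 2, 1, 2)) \<and>
       (n = 1 \<longrightarrow> m \<ge> 3 \<longrightarrow> (m, k, l) = (3, 2, 1) \<or> (m = 2 * k \<and> l = 1) \<or> (m = k \<and> l \<le> 2)) \<and>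
       (m, n, k, l) \<noteq> (2, 1, 3, 2)"
    using pair_exponents[OF abc] by blast
  have "d \<le> max N1 N2"
    if r1: "rep d g1 m1 n1 s1" and r2: "rep d g2 m2 n2 s2" and r3: "rep d g3 m3 n3 s3"
      and p: "primitive g1" "primitive g2" "primitive g3"
      and gt: "g1 ^ m1 > g2 ^ m2" "g2 ^ m2 > g3 ^ m3" and ne: "g1 \<noteq> g2" "g2 \<noteq> g3" "g1 \<noteq> g3"
    for d g1 m1 n1 s1 g2 m2 n2 s2 g3 m3 n3 s3
  proof (rule ccontr)
    assume "\<not> d \<le> max N1 N2"
    then have d: "d > N1" "d > N2" by auto
    have gt13: "g1 ^ m1 > g3 ^ m3" using gt by linarith
    \<comment> \<open>Beyond \<open>N1\<close>, one representation with equal exponents forces all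
      of them to have equal exponents.\<close>
    have diag_all: "k = l" if "rep d g n n s" "rep d h k l t" for g n s h k l t
      using rep_diagonal[OF that(1)] N1[of _ h k l t] that(2) d(1) by (metis linorder_not_le)
    show False
    proof (cases "m1 = n1 \<or> m2 = n2 \<or> m3 = n3")
      case True
      then have "m1 = n1" "m2 = n2" "m3 = n3" using diag_all r1 r2 r3 by blast+
      then obtain G1 G2 G3 where G: "G1 \<ge> 1" "d = G1 * (G1 + 1)" "(g1 ^ m1, s1) = (G1, 1) \<or> (g1 ^ m1, s1) = (G1 + 1, -1)"
         "G2 \<ge> 1" "d = G2 * (G2 + 1)" "(g2 ^ m2, s2) = (G2, 1) \<or> (g2 ^ m2, s2) = (G2 + 1, -1)"
         "G3 \<ge> 1" "d = G3 * (G3 + 1)" "(g3 ^ m3, s3) = (G3, 1) \<or> (g3 ^ m3, s3) = (G3 + 1, -1)"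
        using rep_diagonal r1 r2 r3 by metis
      \<comment> \<open>All three powers then lie in \<open>{G, G + 1}\<close>, so they cannot be
        strictly decreasing.\<close>
      then have "G1 = G2" "G2 = G3" using consecutive_product_unique by metis+
      then show False using G(3,6,9) gt by auto
    next
      case False
      then have nd: "m1 \<noteq> n1" "m2 \<noteq> n2" "m3 \<noteq> n3" by auto
      \<comment> \<open>\<open>base1\<close>, \<open>base2\<close> and \<open>base3\<close> deal
        with the exponent patterns that the inequalities leave open: the bases would coincide, or
        one would be the square of another.\<close>
      have base1: "g = h" if "rep d g m 1 s" "rep d h m 1 t" "m \<ge> 2" for g h s t m
        using that base_unique[of g h m s t] unfolding rep_def by auto
      have base2: False if "rep d g m 1 s" "rep d h (2 * m) 2 t" "m \<ge> 2" "primitive g" for g h s t m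
      proof -
        have "g = h\<^sup>2"
          using that base_unique[of g "h\<^sup>2" m s t] self_le_power[of h 2] unfolding rep_def
          by (auto simp: power_mult)
        then show False using that(4) primitive_not_square by blast
      qed
      have base3: "g = h" if "rep d g 1 2 s" "rep d h 1 2 t" for g h s t
        using that base_unique_cubic[of g h s t] unfolding rep_def by auto
      have n1: "n = 1" if r: "rep d g m n s" "rep d h k l t" "g ^ m > h ^ k" "m \<noteq> n" "k \<noteq> l" "primitive h" "g \<noteq> h"
        for g h s t m n k l
      proof (rule ccontr)
        assume "n \<noteq> 1"
        then have "n \<ge> 2" using r(1) by (auto simp: rep_def)
        then have "(m, n, k, l) = (4, 2, 2, 1) \<or> (m, n, k, l) = (1, 2, 1, 2)" using N2[OF r(1-3) d(2) r(4,5)] by blast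
        then show False using base2[of h 2 t g s] base3[of g s h t] r by auto
      qed
      have one: "n1 = 1" "n2 = 1"
        using n1[OF r1 r2 gt(1) nd(1,2) p(2) ne(1)] n1[OF r2 r3 gt(2) nd(2,3) p(3) ne(2)] .
      have ge2: "m1 \<ge> 2" "m2 \<ge> 2" using r1 r2 nd one by (auto simp: rep_def)
      have R1: "g1 \<ge> 2" "\<bar>s1\<bar> = 1" "d = g1 ^ m1 * (g1 + s1)" and R2: "g2 \<ge> 2" "\<bar>s2\<bar> = 1" "d = g2 ^ m2 * (g2 + s2)"
        using r1 r2 one by (auto simp: rep_def)
      \<comment> \<open>Otherwise \<open>g1 > g2\<close> while \<open>g1 + s1 < g2 + s2\<close>,
        which leaves only \<open>g1 = g2 + 1\<close> with signs \<open>- 1\<close> and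
        \<open>1\<close>. Dividing by \<open>g2 * (g2 + 1)\<close> then equates powers of
        consecutive integers.\<close>
      have "m1 > m2"
      proof (rule ccontr)
        assume "\<not> m1 > m2"
        then have "m1 \<le> m2" by simp
        have "g1 + s1 < g2 + s2"
        proof (rule ccontr)
          assume "\<not> g1 + s1 < g2 + s2"
          then have "g2 ^ m2 * (g2 + s2) < g1 ^ m1 * (g1 + s1)"
            using gt(1) R1 R2 by (intro mult_less_le_imp_less) auto
          then show False using R1 R2 by simp
        qed
        moreover have "g2 < g1"
        proof (rule ccontr)
          assume "\<not> g2 < g1"
          then have "g1 ^ m1 \<le> g2 ^ m1" using R1 by (intro power_mono) auto
          also have "\<dots> \<le> g2 ^ m2" using \<open>m1 \<le> m2\<close> R2 by (intro power_increasing) auto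
          finally show False using gt(1) by simp
        qed
        ultimately have s: "g1 = g2 + 1" "s1 = -1" "s2 = 1" using R1(2) R2(2) by linarith+
        obtain i j where ij: "m1 = Suc (Suc i)" "m2 = Suc j" using ge2 by (metis Suc_le_D numeral_2_eq_2 Suc_le_mono)
        have "(g2 * (g2 + 1)) * (g2 + 1) ^ Suc i = (g2 * (g2 + 1)) * g2 ^ j"
          using R1(3) R2(3) unfolding s ij by (simp add: algebra_simps)
        then have "(g2 + 1) ^ Suc i = g2 ^ j" using R2(1) by simp
        then have "g2 + 1 dvd g2 ^ j" by (metis dvd_triv_left power_Suc)
        moreover have "coprime (g2 + 1) (g2 ^ j)" by (simp add: coprime_commute)
        ultimately have "is_unit (g2 + 1)" by (metis coprime_absorb_left)
        then show False using R2(1) by auto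
      qed
      then have m1: "m1 \<ge> 3" using ge2 by linarith
      have c12: "(m1, m2) = (3, 2) \<or> m1 = 2 * m2"
        using N2[OF r1 r2 gt(1) d(2) nd(1,2)] one m1 \<open>m1 > m2\<close> by auto
      have c13: "(m1, m3, n3) = (3, 2, 1) \<or> (m1 = 2 * m3 \<and> n3 = 1) \<or> (m1 = m3 \<and> n3 \<le> 2)"
        using N2[OF r1 r3 gt13 d(2) nd(1,3)] one m1 by auto
      have "n3 \<ge> 1" using r3 by (simp add: rep_def)
      \<comment> \<open>These are the combinations of \<open>c12\<close> and \<open>c13\<close>. The
        last one arises from \<open>m1 = 3\<close> and is the reason for treating the pattern 2, 1,
        3, 2 separately.\<close>
      then consider "n3 = 1" "m3 = m2" | "n3 = 1" "m3 = m1" | "n3 = 2" "m3 = m1" "m1 = 2 * m2" | "(m2, n2, m3, n3) = (2, 1, 3, 2)"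
        using c12 c13 one by force
      then show False
      proof cases
        case 1
        then show False using base1[of g2 m2 s2 g3 s3] r2 r3 one ge2 ne by simp
      next
        case 2
        then show False using base1[of g1 m1 s1 g3 s3] r1 r3 one ge2 ne by simp
      next
        case 3
        then show False using base2[of g2 m2 s2 g3 s3] r2 r3 one ge2 p by simp
      next
        case 4
        then show False using N2[OF r2 r3 gt(2) d(2) nd(2,3)] by blast
      qed
    qed
  qed
  then show ?thesis using that by blast
qed

text \<open>Reduction to distinct bases and decreasing powers. Two representations with a common
  base force \<open>d = 3 * 2 ^ m\<close>; then the third has base 2 and exponent \<open>m\<close>
  too, but only two signs are available.\<close>

lemma three_reps_bounded:
  assumes abc: abc_conjecture
  obtains N :: int where
    "\<And>d g1 m1 n1 s1 g2 m2 n2 s2 g3 m3 n3 s3.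
       rep d g1 m1 n1 s1 \<Longrightarrow> rep d g2 m2 n2 s2 \<Longrightarrow> rep d g3 m3 n3 s3 \<Longrightarrow>
       primitive g1 \<Longrightarrow> primitive g2 \<Longrightarrow> primitive g3 \<Longrightarrow>
       (g1 ^ m1, s1) \<noteq> (g2 ^ m2, s2) \<Longrightarrow> (g2 ^ m2, s2) \<noteq> (g3 ^ m3, s3) \<Longrightarrow> (g1 ^ m1, s1) \<noteq> (g3 ^ m3, s3) \<Longrightarrow> d \<le> N"
proof (rule three_ordered_reps_bounded[OF abc])
  fix N
  assume N: "\<And>d g1 m1 n1 s1 g2 m2 n2 s2 g3 m3 n3 s3.
       rep d g1 m1 n1 s1 \<Longrightarrow> rep d g2 m2 n2 s2 \<Longrightarrow> rep d g3 m3 n3 s3 \<Longrightarrow>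
       primitive g1 \<Longrightarrow> primitive g2 \<Longrightarrow> primitive g3 \<Longrightarrow>
       g1 ^ m1 > g2 ^ m2 \<Longrightarrow> g2 ^ m2 > g3 ^ m3 \<Longrightarrow> g1 \<noteq> g2 \<Longrightarrow> g2 \<noteq> g3 \<Longrightarrow> g1 \<noteq> g3 \<Longrightarrow> d \<le> N"
  show thesis
  proof (rule that[of "max N 24"], rule ccontr)
    fix d g1 m1 n1 s1 g2 m2 n2 s2 g3 m3 n3 s3
    assume r: "rep d g1 m1 n1 s1" "rep d g2 m2 n2 s2" "rep d g3 m3 n3 s3"
      and p: "primitive g1" "primitive g2" "primitive g3"
      and ne: "(g1 ^ m1, s1) \<noteq> (g2 ^ m2, s2)" "(g2 ^ m2, s2) \<noteq> (g3 ^ m3, s3)" "(g1 ^ m1, s1) \<noteq> (g3 ^ m3, s3)"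
      and "\<not> d \<le> max N 24"
    then have d: "d > N" "d > 24" by auto
    have same: False
      if r: "rep d g m n s" "rep d g k l t" "rep d h i j v" and p: "primitive h"
        and ne: "(g ^ m, s) \<noteq> (g ^ k, t)" "(g ^ m, s) \<noteq> (h ^ i, v)" "(g ^ k, t) \<noteq> (h ^ i, v)"
      for g m n s k l t h i j v
    proof -
      have e: "g = 2" "m = k" "d = 3 * 2 ^ m" using rep_same_base[OF r(1,2) ne(1)] by auto
      then have "h = 2" using rep_3_times_power_of_2[OF r(3) p e(3) d(2)] by simp
      then have "rep d g i j v" "(g ^ m, s) \<noteq> (g ^ i, v)" using r(3) ne(2) e(1) by simp_all
      then have "m = i" using rep_same_base[OF r(1)] by simp
      then have "s \<noteq> t" "s \<noteq> v" "t \<noteq> v" using ne e \<open>h = 2\<close> by auto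
      moreover have "s \<in> {1, -1}" "t \<in> {1, -1}" "v \<in> {1, -1}" using r by (auto simp: rep_def)
      ultimately show False by auto
    qed
    have bases: "g1 \<noteq> g2" "g2 \<noteq> g3" "g1 \<noteq> g3"
      using same[of g1 m1 n1 s1 m2 n2 s2 g3 m3 n3 s3] same[of g2 m2 n2 s2 m3 n3 s3 g1 m1 n1 s1]
        same[of g1 m1 n1 s1 m3 n3 s3 g2 m2 n2 s2] r p ne by metis+
    have exps: "m1 \<ge> 1" "m2 \<ge> 1" "m3 \<ge> 1" using r by (auto simp: rep_def)
    have powers: "g1 ^ m1 \<noteq> g2 ^ m2" "g2 ^ m2 \<noteq> g3 ^ m3" "g1 ^ m1 \<noteq> g3 ^ m3"
      using primitive_bases_distinct_powers p bases exps by blast+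
    then consider "g1 ^ m1 > g2 ^ m2" "g2 ^ m2 > g3 ^ m3" | "g1 ^ m1 > g3 ^ m3" "g3 ^ m3 > g2 ^ m2"
      | "g2 ^ m2 > g1 ^ m1" "g1 ^ m1 > g3 ^ m3" | "g2 ^ m2 > g3 ^ m3" "g3 ^ m3 > g1 ^ m1"
      | "g3 ^ m3 > g1 ^ m1" "g1 ^ m1 > g2 ^ m2" | "g3 ^ m3 > g2 ^ m2" "g2 ^ m2 > g1 ^ m1"
      by linarith
    then have "d \<le> N"
    proof cases
      case 1 show ?thesis using N[OF r p 1] bases by auto
    next
      case 2 show ?thesis using N[OF r(1,3,2) p(1,3,2) 2] bases by auto
    next
      case 3 show ?thesis using N[OF r(2,1,3) p(2,1,3) 3] bases by auto
    next
      case 4 show ?thesis using N[OF r(2,3,1) p(2,3,1) 4] bases by auto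
    next
      case 5 show ?thesis using N[OF r(3,1,2) p(3,1,2) 5] bases by auto
    next
      case 6 show ?thesis using N[OF r(3,2,1) p(3,2,1) 6] bases by auto
    qed
    then show False using d by simp
  qed
qed

section \<open>Counting pairs\<close>

text \<open>Only the power and the sign are recorded, since together with \<open>d\<close> they
  determine the pairs to be counted.\<close>

definition reps :: "int \<Rightarrow> (int \<times> int) set" where
  "reps d = {(P, s). \<exists>g m n. primitive g \<and> rep d g m n s \<and> P = g ^ m}"

lemma finite_reps: "finite (reps d)"
proof (rule finite_subset)
  show "reps d \<subseteq> {1..d} \<times> {-1, 1}"
  proof
    fix q assume "q \<in> reps d"
    then obtain P s g m n where r: "rep d g m n s" "P = g ^ m" "q = (P, s)" by (auto simp: reps_def)
    then have "P \<ge> 1" "s = 1 \<or> s = -1" "d = P * (g ^ n + s)" by (auto simp: rep_def)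
    moreover from this have "P \<le> d"
      using rep_cofactor(1)[OF r(1)] mult_left_mono[of 1 "g ^ n + s" P] by simp
    ultimately show "q \<in> {1..d} \<times> {-1, 1}" using r(3) by auto
  qed
qed auto

lemma card_reps_le_2:
  assumes abc: abc_conjecture
  obtains N :: int where "\<And>d. d > N \<Longrightarrow> card (reps d) \<le> 2"
proof (rule three_reps_bounded[OF abc])
  fix N
  assume N: "\<And>d g1 m1 n1 s1 g2 m2 n2 s2 g3 m3 n3 s3.
       rep d g1 m1 n1 s1 \<Longrightarrow> rep d g2 m2 n2 s2 \<Longrightarrow> rep d g3 m3 n3 s3 \<Longrightarrow>
       primitive g1 \<Longrightarrow> primitive g2 \<Longrightarrow> primitive g3 \<Longrightarrow>
       (g1 ^ m1, s1) \<noteq> (g2 ^ m2, s2) \<Longrightarrow> (g2 ^ m2, s2) \<noteq> (g3 ^ m3, s3) \<Longrightarrow> (g1 ^ m1, s1) \<noteq> (g3 ^ m3, s3) \<Longrightarrow> d \<le> N"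
  show thesis
  proof (rule that[of N], rule ccontr)
    fix d assume d: "d > N" and "\<not> card (reps d) \<le> 2"
    then have "3 \<le> card (reps d)" by simp
    then obtain T where T: "T \<subseteq> reps d" "card T = 3" using obtain_subset_with_card_n by metis
    then obtain x y z where xyz: "T = {x, y, z}" "x \<noteq> y" "y \<noteq> z" "x \<noteq> z" by (auto simp: card_3_iff)
    have ex: "\<exists>g m n s. primitive g \<and> rep d g m n s \<and> q = (g ^ m, s)" if "q \<in> reps d" for q
      using that by (cases q) (auto simp: reps_def)
    obtain g1 m1 n1 s1 where 1: "primitive g1" "rep d g1 m1 n1 s1" "x = (g1 ^ m1, s1)" using ex[of x] T xyz by auto
    obtain g2 m2 n2 s2 where 2: "primitive g2" "rep d g2 m2 n2 s2" "y = (g2 ^ m2, s2)" using ex[of y] T xyz by auto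
    obtain g3 m3 n3 s3 where 3: "primitive g3" "rep d g3 m3 n3 s3" "z = (g3 ^ m3, s3)" using ex[of z] T xyz by auto
    have "d \<le> N"
      by (rule N[OF 1(2) 2(2) 3(2) 1(1) 2(1) 3(1)]) (use 1 2 3 xyz in auto)
    then show False using d by simp
  qed
qed

text \<open>For \<open>p, q > 1\<close> the exponents must be non-zero and of opposite sign, so one
  factor can be moved to the other side.\<close>

lemma power_relation:
  fixes p q :: rat and k1 k2 :: int
  assumes "p > 1" "q > 1" "(k1, k2) \<noteq> (0, 0)" "p powi k1 * q powi k2 = 1"
  shows "\<exists>i j :: nat. i \<ge> 1 \<and> j \<ge> 1 \<and> p ^ i = q ^ j"
proof -
  have prod: "i = 0 \<and> j = 0" if "p ^ i * q ^ j = 1" for i j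
  proof -
    have ge: "1 \<le> p ^ i" "1 \<le> q ^ j" using assms by auto
    then have "p ^ i = 1" "q ^ j = 1"
      using that mult_mono[of 1 "p ^ i" "q ^ j" "q ^ j"] mult_mono[of "p ^ i" "p ^ i" 1 "q ^ j"] by auto
    then show ?thesis using assms(1,2) by (metis less_irrefl one_less_power bot_nat_0.not_eq_extremum)
  qed
  have quot: "i \<ge> 1 \<and> j \<ge> 1 \<or> i = 0 \<and> j = 0" if "p ^ i = q ^ j" for i j
    using that assms(1,2) one_less_power[of p i] one_less_power[of q j] by (cases i; cases j) auto
  show ?thesis
  proof (cases k1; cases k2)
    fix i j assume k: "k1 = int i" "k2 = int j"
    then show ?thesis using assms prod[of i j] by simp
  next
    fix i j assume k: "k1 = int i" "k2 = - int (Suc j)"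
    then have "p ^ i = q ^ Suc j" using assms by (simp add: power_int_minus field_simps del: of_nat_Suc)
    then show ?thesis using quot[of i "Suc j"] by blast
  next
    fix i j assume k: "k1 = - int (Suc i)" "k2 = int j"
    then have "p ^ Suc i = q ^ j" using assms by (simp add: power_int_minus field_simps del: of_nat_Suc)
    then show ?thesis using quot[of "Suc i" j] by blast
  next
    fix i j assume k: "k1 = - int (Suc i)" "k2 = - int (Suc j)"
    then have "p ^ Suc i * q ^ Suc j = 1" using assms by (simp add: power_int_minus field_simps del: of_nat_Suc)
    then show ?thesis using prod[of "Suc i" "Suc j"] by simp
  qed
qed

text \<open>Absolute values turn the relation into one between integers at least 2, to which
  \<open>common_base\<close> and then \<open>primitive_root\<close> apply.\<close>

lemma mult_dependent_common_base:
  assumes dep: "mult_dependent a b" and ab: "\<bar>a\<bar> \<ge> 2" "\<bar>b\<bar> \<ge> 2"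
  obtains g x y where "primitive g" "x \<ge> 1" "y \<ge> 1" "\<bar>a\<bar> = g ^ x" "\<bar>b\<bar> = g ^ y"
proof -
  obtain k1 k2 where k: "(k1, k2) \<noteq> (0, 0)" "rat_of_int a powi k1 * rat_of_int b powi k2 = 1"
    using dep by (auto simp: mult_dependent_def)
  have "rat_of_int \<bar>a\<bar> powi k1 * rat_of_int \<bar>b\<bar> powi k2 = \<bar>rat_of_int a powi k1 * rat_of_int b powi k2\<bar>"
    by (simp add: abs_mult power_int_abs)
  then have "rat_of_int \<bar>a\<bar> powi k1 * rat_of_int \<bar>b\<bar> powi k2 = 1" using k by simp
  moreover have "rat_of_int \<bar>a\<bar> > 1" "rat_of_int \<bar>b\<bar> > 1" using ab by linarith+
  ultimately obtain i j :: nat where ij: "i \<ge> 1" "j \<ge> 1" "rat_of_int \<bar>a\<bar> ^ i = rat_of_int \<bar>b\<bar> ^ j"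
    using power_relation k by blast
  then have "\<bar>a\<bar> ^ i = \<bar>b\<bar> ^ j" by (metis of_int_eq_iff of_int_power)
  then obtain c x y where c: "c \<ge> 2" "x \<ge> 1" "y \<ge> 1" "\<bar>a\<bar> = c ^ x" "\<bar>b\<bar> = c ^ y"
    using common_base[OF ab ij(1,2)] by blast
  obtain g l where g: "primitive g" "l \<ge> 1" "c = g ^ l" using primitive_root[OF c(1)] by blast
  show ?thesis
    by (rule that[of g "l * x" "l * y"]) (use c g in \<open>auto simp: power_mult\<close>)
qed

text \<open>The five listed pairs cover the cases \<open>\<bar>a\<bar> = 1\<close>,
  \<open>\<bar>b\<bar> = 1\<close> and \<open>a = - b\<close>. Otherwise the member of smaller
  absolute value is \<open>P\<close> up to sign; the two images correspond to that member being
  \<open>a\<close> or \<open>b\<close>. Only an inclusion is claimed: for odd \<open>d\<close> the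
  last listed pair does not have difference \<open>d\<close>.\<close>

lemma mult_dep_pairs_subset:
  assumes "d > 0"
  shows "mult_dep_pairs d \<subseteq>
    {(1, d + 1), (-1, d - 1), (1 - d, 1), (-1 - d, -1), (- (d div 2), d div 2)} \<union>
    ((\<lambda>(P, s). (- (s * P), d - s * P)) ` reps d \<union> (\<lambda>(P, s). (s * P - d, s * P)) ` reps d)"
    (is "_ \<subseteq> ?T \<union> (?f ` _ \<union> ?h ` _)")
proof
  fix q assume "q \<in> mult_dep_pairs d"
  then obtain a b where q: "q = (a, b)" and dep: "mult_dependent a b" and nz: "a \<noteq> 0" "b \<noteq> 0" and ba: "b - a = d"
    by (auto simp: mult_dep_pairs_def)
  show "q \<in> ?T \<union> (?f ` reps d \<union> ?h ` reps d)"
  proof (cases "\<bar>a\<bar> = 1 \<or> \<bar>b\<bar> = 1 \<or> \<bar>a\<bar> = \<bar>b\<bar>")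
    case True
    then have "a = 1 \<or> a = -1 \<or> b = 1 \<or> b = -1 \<or> a = - b" using ba assms by linarith
    then have "(a, b) \<in> ?T"
    proof (elim disjE)
      assume "a = - b"
      then have "d = 2 * b" using ba by simp
      then show ?thesis using \<open>a = - b\<close> by simp
    qed (use ba in auto)
    then show ?thesis unfolding q by blast
  next
    case False
    then have "\<bar>a\<bar> \<ge> 2" "\<bar>b\<bar> \<ge> 2" using nz by linarith+
    then obtain g x y where g: "primitive g" "x \<ge> 1" "y \<ge> 1" "\<bar>a\<bar> = g ^ x" "\<bar>b\<bar> = g ^ y"
      using mult_dependent_common_base[OF dep] by blast
    have "g \<ge> 2" using g by (simp add: primitive_def)
    have "x \<noteq> y" using g False by auto
    then consider "x < y" | "y < x" by linarith
    then show ?thesis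
    proof cases
      case 1
      have "g ^ x < g ^ y" using 1 \<open>g \<ge> 2\<close> by (intro power_strict_increasing) auto
      \<comment> \<open>The member of larger absolute value carries the sign of the difference, and
        \<open>d > 0\<close>.\<close>
      then have "b = g ^ y" using g ba assms by linarith
      define s :: int where "s = (if a < 0 then 1 else -1)"
      have s: "\<bar>s\<bar> = 1" "a = - (s * g ^ x)" unfolding g(4)[symmetric] by (auto simp: s_def)
      have "d = g ^ x * (g ^ (y - x) + s)"
        using ba s(2) \<open>b = g ^ y\<close> 1 by (simp add: distrib_left mult.commute flip: power_add)
      then have "rep d g x (y - x) s" using \<open>g \<ge> 2\<close> g 1 s by (simp add: rep_def)
      then have "(g ^ x, s) \<in> reps d" using g(1) by (auto simp: reps_def)
      moreover have "q = ?f (g ^ x, s)" using q s ba by simp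
      ultimately show ?thesis by blast
    next
      case 2
      have "g ^ y < g ^ x" using 2 \<open>g \<ge> 2\<close> by (intro power_strict_increasing) auto
      then have "a = - (g ^ x)" using g ba assms by linarith
      define s :: int where "s = (if b < 0 then -1 else 1)"
      have s: "\<bar>s\<bar> = 1" "b = s * g ^ y" unfolding g(5)[symmetric] by (auto simp: s_def)
      have "d = g ^ y * (g ^ (x - y) + s)"
        using ba s(2) \<open>a = - (g ^ x)\<close> 2 by (simp add: distrib_left mult.commute flip: power_add)
      then have "rep d g y (x - y) s" using \<open>g \<ge> 2\<close> g 2 s by (simp add: rep_def)
      then have "(g ^ y, s) \<in> reps d" using g(1) by (auto simp: reps_def)
      moreover have "q = ?h (g ^ y, s)" using q s ba by simp
      ultimately show ?thesis by blast
    qed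
  qed
qed

lemma finite_mult_dep_pairs:
  assumes "d > 0"
  shows "finite (mult_dep_pairs d)"
  by (rule finite_subset[OF mult_dep_pairs_subset[OF assms]]) (simp add: finite_reps)

lemma mult_dep_count_le:
  assumes "d > 0"
  shows "mult_dep_count d \<le> 5 + 2 * card (reps d)"
proof -
  let ?T = "{(1, d + 1), (-1, d - 1), (1 - d, 1), (-1 - d, -1), (- (d div 2), d div 2)}"
  let ?f = "\<lambda>(P, s). (- (s * P), d - s * P)" and ?h = "\<lambda>(P, s). (s * P - d, s * P)"
  have "mult_dep_count d \<le> card (?T \<union> (?f ` reps d \<union> ?h ` reps d))"
    unfolding mult_dep_count_def by (rule card_mono[OF _ mult_dep_pairs_subset[OF assms]]) (simp add: finite_reps)
  also have "\<dots> \<le> card ?T + (card (?f ` reps d) + card (?h ` reps d))"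
    by (rule order_trans[OF card_Un_le]) (intro add_left_mono card_Un_le)
  \<comment> \<open>The five pairs may coincide for small \<open>d\<close>; counting list entries
    still bounds the cardinality.\<close>
  also have "card ?T \<le> 5"
    using card_length[of "[(1, d + 1), (-1, d - 1), (1 - d, 1), (-1 - d, -1), (- (d div 2), d div 2)]"] by simp
  also have "card (?f ` reps d) \<le> card (reps d)" by (rule card_image_le[OF finite_reps])
  also have "card (?h ` reps d) \<le> card (reps d)" by (rule card_image_le[OF finite_reps])
  finally show ?thesis by simp
qed

theorem theorem4p8:
  assumes "abc_conjecture"
  shows "(\<exists>C1 :: nat. C1 > 0 \<and>
            (\<forall>d :: int. d > 0 \<longrightarrow> finite (mult_dep_pairs d) \<and> mult_dep_count d \<le> C1)) \<and>
         (\<exists>d0 :: int. \<forall>d :: int. d > 0 \<longrightarrow> d \<ge> d0 \<longrightarrow>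
            finite (mult_dep_pairs d) \<and> mult_dep_count d \<le> 9)"
proof -
  obtain N where N: "\<And>d. d > N \<Longrightarrow> card (reps d) \<le> 2"
    using card_reps_le_2[OF assms] by blast
  have large: "mult_dep_count d \<le> 9" if "d > 0" "d > N" for d
    using mult_dep_count_le[OF that(1)] N[OF that(2)] by linarith
  \<comment> \<open>The finitely many \<open>d \<le> N\<close> are covered by the sum of their
    counts.\<close>
  define C where "C = 9 + (\<Sum>d\<in>{1..N}. mult_dep_count d)"
  have "mult_dep_count d \<le> C" if "d > 0" for d
  proof (cases "d > N")
    case True
    then show ?thesis using large[OF that] by (simp add: C_def)
  next
    case False
    then have "mult_dep_count d \<le> (\<Sum>d\<in>{1..N}. mult_dep_count d)" using that by (intro member_le_sum) auto
    then show ?thesis by (simp add: C_def)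
  qed
  moreover have "C > 0" by (simp add: C_def)
  moreover have "\<forall>d :: int. d > 0 \<longrightarrow> d \<ge> N + 1 \<longrightarrow> finite (mult_dep_pairs d) \<and> mult_dep_count d \<le> 9"
    using large finite_mult_dep_pairs by auto
  ultimately show ?thesis using finite_mult_dep_pairs by blast
qed

end
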